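(* Let $n\geq1$. The single type C Schubert polynomials $\mathfrak{C}_w(X)$ for $w\in W^{(n)}$ form a $\mathbb{Z}$-basis of $\Gamma[X_n]$.
   Context: $c_1,c_2,\ldots$ are commuting variables, $c_0:=1$, $c_p:=0$ for $p<0$; $\Gamma$ is the quotient of $\mathbb{Z}[c_1,c_2,\ldots]$ by the relations $c_p^2+2\sum_{i=1}^p(-1)^ic_{p+i}c_{p-i}=0$, $p\geq1$. $X=(x_1,x_2,\ldots)$, $Y=(y_1,y_2,\ldots)$ are independent variables, $X_n=(x_1,\ldots,x_n)$. $W_k$ is the group of signed permutations $w=(w_1,\ldots,w_k)$ of $\{1,\ldots,k\}$, $W_\infty=\bigcup_kW_k$ (adjoining fixed points), generated by $s_i=(i,i+1)$, $i\geq1$, and the sign change $s_0$ of $1$; $\ell$ is the length. $W^{(n)}:=\{w\in W_\infty: w_{n+1}<w_{n+2}<\cdots\}$. $W_\infty$ acts on $\Gamma[X,Y]$ by ring automorphisms: $s_i$ ($i\geq1$) interchanges $x_i,x_{i+1}$ and fixes all other variables and all $c_p$; $s_0$ sends $x_1\mapsto-x_1$, fixes $x_j$ ($j\geq2$) and all $y_j$, and $s_0(c_p)=c_p+2\sum_{j=1}^px_1^jc_{p-j}$. $\partial_0^xf=\frac{f-s_0f}{-2x_1}$, $\partial_i^xf=\frac{f-s_if}{x_i-x_{i+1}}$ ($i\geq1$); $\omega$ is the ring involution of $\Gamma[X,Y]$ with $\omega(x_j)=-y_j$, $\omega(y_j)=-x_j$, $\omega(c_p)=c_p$, and $\partial_i^y=\omega\partial_i^x\omega$.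 The type C double Schubert polynomials $\mathfrak{C}_w(X,Y)$, $w\in W_\infty$, are the unique family in $\Gamma[X,Y]$ such that for all $i\geq0$: $\partial_i^x\mathfrak{C}_w=\mathfrak{C}_{ws_i}$ if $\ell(ws_i)<\ell(w)$ and $0$ otherwise; $\partial_i^y\mathfrak{C}_w=\mathfrak{C}_{s_iw}$ if $\ell(s_iw)<\ell(w)$ and $0$ otherwise; and the constant term of $\mathfrak{C}_w$ is $1$ if $w=1$ and $0$ otherwise. $\mathfrak{C}_w(X):=\mathfrak{C}_w(X,0)$. It is known that the $\mathfrak{C}_w(X)$, $w\in W_\infty$, form a $\mathbb{Z}$-basis of $\Gamma[X]$. *)

theory Defs
  imports Complex_Main "HOL-Library.Poly_Mapping" "HOL-Computational_Algebra.Formal_Power_Series"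
begin

type_synonym ('v, 'r) mpoly = "('v \<Rightarrow>\<^sub>0 nat) \<Rightarrow>\<^sub>0 'r"

definition Const :: "'r::zero \<Rightarrow> ('v, 'r) mpoly"
  where "Const c = Poly_Mapping.single 0 c"

definition Var :: "'v \<Rightarrow> ('v, 'r::zero_neq_one) mpoly"
  where "Var v = Poly_Mapping.single (Poly_Mapping.single v 1) 1"

definition monom_subst :: "('v \<Rightarrow> 's::comm_ring_1) \<Rightarrow> ('v \<Rightarrow>\<^sub>0 nat) \<Rightarrow> 's"
  where "monom_subst a m = (\<Prod>v\<in>Poly_Mapping.keys m. a v ^ Poly_Mapping.lookup m v)"

text \<open>The substitution applying \<open>\<phi>\<close> to the coefficients and sending each variable \<open>v\<close> to \<open>a v\<close>.\<close>

definition mpoly_subst :: "('r::comm_ring_1 \<Rightarrow> 's::comm_ring_1) \<Rightarrow> ('v \<Rightarrow> 's) \<Rightarrow> ('v, 'r) mpoly \<Rightarrow> 's"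
  where "mpoly_subst \<phi> a f =
    (\<Sum>m\<in>Poly_Mapping.keys f. \<phi> (Poly_Mapping.lookup f m) * monom_subst a m)"

definition is_ring_hom :: "('r::comm_ring_1 \<Rightarrow> 's::comm_ring_1) \<Rightarrow> bool"
  where "is_ring_hom \<phi> \<longleftrightarrow> \<phi> 1 = 1 \<and> (\<forall>a b. \<phi> (a + b) = \<phi> a + \<phi> b) \<and> (\<forall>a b. \<phi> (a * b) = \<phi> a * \<phi> b)"

lemma is_ring_homD:
  assumes "is_ring_hom \<phi>"
  shows "\<phi> 1 = 1" "\<phi> (a + b) = \<phi> a + \<phi> b" "\<phi> (a * b) = \<phi> a * \<phi> b"
    "\<phi> 0 = 0" "\<phi> (- a) = - \<phi> a" "\<phi> (a - b) = \<phi> a - \<phi> b"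
    "\<phi> (sum g S) = (\<Sum>x\<in>S. \<phi> (g x))" "\<phi> (a ^ k) = \<phi> a ^ k"
    "\<phi> (of_nat k) = of_nat k" "\<phi> (numeral q) = numeral q"
proof -
  show 1: "\<phi> 1 = 1" and add: "\<phi> (a + b) = \<phi> a + \<phi> b"
    and mult: "\<phi> (a * b) = \<phi> a * \<phi> b" for a b
    using assms by (auto simp: is_ring_hom_def)
  interpret additive \<phi> by standard (rule add)
  show z: "\<phi> 0 = 0" and "\<phi> (- a) = - \<phi> a" and "\<phi> (a - b) = \<phi> a - \<phi> b"
    and "\<phi> (sum g S) = (\<Sum>x\<in>S. \<phi> (g x))"
    by (rule zero minus diff sum)+
  show "\<phi> (a ^ k) = \<phi> a ^ k" by (induction k) (simp_all add: 1 mult)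
  show of_nat: "\<phi> (of_nat k) = of_nat k" for k by (induction k) (simp_all add: 1 z add)
  show "\<phi> (numeral q) = numeral q" using of_nat[of "numeral q"] by simp
qed

lemma is_ring_hom_Const: "is_ring_hom (Const :: 'r::comm_ring_1 \<Rightarrow> ('v, 'r) mpoly)"
  by (simp add: is_ring_hom_def Const_def single_add mult_single)

lemma is_ring_hom_of_int: "is_ring_hom (of_int :: int \<Rightarrow> 'r::comm_ring_1)"
  by (simp add: is_ring_hom_def)

lemma is_ring_hom_id: "is_ring_hom (\<lambda>x. x)"
  by (simp add: is_ring_hom_def)

lemma monom_subst_superset:
  assumes "finite S" "Poly_Mapping.keys m \<subseteq> S"
  shows "monom_subst a m = (\<Prod>v\<in>S. a v ^ Poly_Mapping.lookup m v)"
  unfolding monom_subst_def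
  by (rule prod.mono_neutral_left) (use assms in \<open>auto simp: in_keys_iff\<close>)

lemma monom_subst_add: "monom_subst a (m + m') = monom_subst a m * monom_subst a m'"
proof -
  let ?S = "Poly_Mapping.keys m \<union> Poly_Mapping.keys m'"
  have "Poly_Mapping.keys (m + m') \<subseteq> ?S" by (rule keys_add)
  then show ?thesis
    by (simp add: monom_subst_superset[where S = ?S] lookup_add power_add prod.distrib)
qed

lemma monom_subst_0 [simp]: "monom_subst a 0 = 1"
  by (simp add: monom_subst_def)

lemma monom_subst_single [simp]: "monom_subst a (Poly_Mapping.single v k) = a v ^ k"
  by (cases "k = 0") (simp_all add: monom_subst_def)

context
  fixes \<phi> :: "'r::comm_ring_1 \<Rightarrow> 's::comm_ring_1"
  assumes hom: "is_ring_hom \<phi>"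
begin

lemma mpoly_subst_superset:
  assumes "finite S" "Poly_Mapping.keys f \<subseteq> S"
  shows "mpoly_subst \<phi> a f = (\<Sum>m\<in>S. \<phi> (Poly_Mapping.lookup f m) * monom_subst a m)"
  unfolding mpoly_subst_def
  by (rule sum.mono_neutral_left) (use assms in \<open>auto simp: in_keys_iff is_ring_homD[OF hom]\<close>)

lemma mpoly_subst_add: "mpoly_subst \<phi> a (f + g) = mpoly_subst \<phi> a f + mpoly_subst \<phi> a g"
proof -
  let ?S = "Poly_Mapping.keys f \<union> Poly_Mapping.keys g"
  have "Poly_Mapping.keys (f + g) \<subseteq> ?S" by (rule keys_add)
  then show ?thesis
    by (simp add: mpoly_subst_superset[where S = ?S] lookup_add is_ring_homD[OF hom]
        distrib_right sum.distrib)
qed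

lemma mpoly_subst_single: "mpoly_subst \<phi> a (Poly_Mapping.single m c) = \<phi> c * monom_subst a m"
  by (cases "c = 0") (simp_all add: mpoly_subst_def is_ring_homD[OF hom])

lemma mpoly_subst_sum: "mpoly_subst \<phi> a (sum g S) = (\<Sum>x\<in>S. mpoly_subst \<phi> a (g x))"
proof -
  interpret additive "mpoly_subst \<phi> a" by standard (rule mpoly_subst_add)
  show ?thesis by (rule sum)
qed

end

lemma mpoly_sum_monoms:
  "f = (\<Sum>m\<in>Poly_Mapping.keys f. Poly_Mapping.single m (Poly_Mapping.lookup f m))"
  by (rule poly_mapping_eqI) (auto simp: lookup_sum lookup_single when_def in_keys_iff)

lemma is_ring_hom_subst:
  assumes hom: "is_ring_hom \<phi>"
  shows "is_ring_hom (mpoly_subst \<phi> a)"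
proof -
  have "mpoly_subst \<phi> a (f * g) = mpoly_subst \<phi> a f * mpoly_subst \<phi> a g" for f g
  proof -
    have "f * g = (\<Sum>m\<in>Poly_Mapping.keys f. \<Sum>m'\<in>Poly_Mapping.keys g.
        Poly_Mapping.single (m + m') (Poly_Mapping.lookup f m * Poly_Mapping.lookup g m'))"
      by (subst mpoly_sum_monoms[of f], subst mpoly_sum_monoms[of g])
         (simp add: sum_product mult_single)
    then have "mpoly_subst \<phi> a (f * g) = (\<Sum>m\<in>Poly_Mapping.keys f. \<Sum>m'\<in>Poly_Mapping.keys g.
        (\<phi> (Poly_Mapping.lookup f m) * monom_subst a m) * (\<phi> (Poly_Mapping.lookup g m') * monom_subst a m'))"
      by (simp add: mpoly_subst_sum[OF hom] mpoly_subst_single[OF hom] monom_subst_add is_ring_homD[OF hom] mult_ac)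
    then show ?thesis by (simp add: mpoly_subst_def sum_product)
  qed
  moreover have "mpoly_subst \<phi> a 1 = 1"
    using mpoly_subst_single[OF hom, of a 0 1] by (simp add: is_ring_homD[OF hom])
  ultimately show ?thesis by (simp add: is_ring_hom_def mpoly_subst_add[OF hom])
qed

lemma mpoly_subst_Const: "is_ring_hom \<phi> \<Longrightarrow> mpoly_subst \<phi> a (Const c) = \<phi> c"
  by (simp add: Const_def mpoly_subst_single)

lemma mpoly_subst_Var: "is_ring_hom \<phi> \<Longrightarrow> mpoly_subst \<phi> a (Var v) = a v"
  by (simp add: Var_def mpoly_subst_single is_ring_homD)

text \<open>The polynomial variable with index \<open>k :: nat\<close> is \<open>c\<^bsub>k+1\<^esub>\<close>.\<close>

definition cpoly :: "nat \<Rightarrow> (nat, int) mpoly"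
  where "cpoly p = (if p = 0 then 1 else Var (p - 1))"

definition gamma_relator :: "(nat \<Rightarrow> 'a::comm_ring_1) \<Rightarrow> nat \<Rightarrow> 'a"
  where "gamma_relator c p = c p ^ 2 + 2 * (\<Sum>i=1..p. (- 1) ^ i * c (p + i) * c (p - i))"

text \<open>The ideal generated by the relations: the span in the ring as a module over itself.\<close>

definition gamma_ideal :: "(nat, int) mpoly set"
  where "gamma_ideal = module.span (*) (gamma_relator cpoly ` {1..})"

lemma module_mult: "module ((*) :: 'a::comm_ring_1 \<Rightarrow> 'a \<Rightarrow> 'a)"
  by standard (simp_all add: algebra_simps)

lemma gamma_ideal_add: "f \<in> gamma_ideal \<Longrightarrow> g \<in> gamma_ideal \<Longrightarrow> f + g \<in> gamma_ideal"
  and gamma_ideal_neg: "f \<in> gamma_ideal \<Longrightarrow> - f \<in> gamma_ideal"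
  and gamma_ideal_mult: "f \<in> gamma_ideal \<Longrightarrow> h * f \<in> gamma_ideal"
  and gamma_ideal_0: "0 \<in> gamma_ideal"
  unfolding gamma_ideal_def
  by (fact module.span_add[OF module_mult] module.span_neg[OF module_mult]
      module.span_scale[OF module_mult] module.span_zero[OF module_mult])+

definition gamma_cong :: "(nat, int) mpoly \<Rightarrow> (nat, int) mpoly \<Rightarrow> bool"
  where "gamma_cong f g \<longleftrightarrow> f - g \<in> gamma_ideal"

lemma equivp_gamma_cong: "equivp gamma_cong"
proof (rule equivpI)
  show "reflp gamma_cong" by (rule reflpI) (simp add: gamma_cong_def gamma_ideal_0)
  show "symp gamma_cong"
    using gamma_ideal_neg[of "f - g" for f g] by (auto intro!: sympI simp: gamma_cong_def)
  show "transp gamma_cong"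
    using gamma_ideal_add[of "f - g" "g - h" for f g h] by (auto intro!: transpI simp: gamma_cong_def)
qed

quotient_type gamma = "(nat, int) mpoly" / gamma_cong
  by (rule equivp_gamma_cong)

lemma relator_hom:
  assumes "is_ring_hom \<phi>"
  shows "\<phi> (gamma_relator c p) = gamma_relator (\<lambda>k. \<phi> (c k)) p"
  by (simp add: gamma_relator_def is_ring_homD[OF assms])

lemma gamma_cong_hom:
  assumes hom: "is_ring_hom \<phi>"
    and rel: "\<And>p. p \<ge> 1 \<Longrightarrow> gamma_relator (\<lambda>k. \<phi> (cpoly k)) p = 0"
    and "gamma_cong f g"
  shows "\<phi> f = \<phi> g"
proof -
  have "module.subspace (*) {h. \<phi> h = 0}"
    by (rule module.subspaceI[OF module_mult]) (simp_all add: is_ring_homD[OF hom])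
  then have "gamma_ideal \<subseteq> {h. \<phi> h = 0}"
    unfolding gamma_ideal_def
    by (intro module.span_minimal[OF module_mult]) (auto simp: relator_hom[OF hom] rel)
  with assms(3) have "\<phi> (f - g) = 0"
    by (auto simp: gamma_cong_def)
  then show ?thesis
    by (simp add: is_ring_homD[OF hom])
qed

text \<open>The augmentation \<open>c\<^sub>p \<mapsto> 0\<close> (\<open>p \<ge> 1\<close>); \<open>\<Gamma>\<close> is graded with \<open>c\<^sub>p\<close> in degree \<open>p\<close>, so this is
  the constant term of an element of \<open>\<Gamma>\<close>.\<close>

abbreviation augment :: "(nat, int) mpoly \<Rightarrow> int"
  where "augment \<equiv> mpoly_subst (\<lambda>x. x) (\<lambda>_. 0)"

lemma gamma_cong_augment:
  assumes "gamma_cong f g"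
  shows "augment f = augment g"
proof (rule gamma_cong_hom[OF is_ring_hom_subst[OF is_ring_hom_id] _ assms])
  fix p :: nat assume "p \<ge> 1"
  then show "gamma_relator (\<lambda>k. augment (cpoly k)) p = 0"
    by (simp add: gamma_relator_def cpoly_def mpoly_subst_Var is_ring_hom_id
        is_ring_homD[OF is_ring_hom_subst[OF is_ring_hom_id]])
qed

instantiation gamma :: comm_ring_1
begin

lift_definition zero_gamma :: gamma is 0 .
lift_definition one_gamma :: gamma is 1 .
lift_definition plus_gamma :: "gamma \<Rightarrow> gamma \<Rightarrow> gamma" is "(+)"
proof -
  fix f f' g g' :: "(nat, int) mpoly"
  assume "gamma_cong f f'" "gamma_cong g g'"
  then have "(f - f') + (g - g') \<in> gamma_ideal"
    by (simp add: gamma_cong_def gamma_ideal_add)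
  then show "gamma_cong (f + g) (f' + g')"
    by (simp add: gamma_cong_def add_diff_add)
qed
lift_definition uminus_gamma :: "gamma \<Rightarrow> gamma" is uminus
proof -
  fix f f' :: "(nat, int) mpoly"
  assume "gamma_cong f f'"
  then have "- (f - f') \<in> gamma_ideal"
    unfolding gamma_cong_def by (rule gamma_ideal_neg)
  then show "gamma_cong (- f) (- f')"
    by (simp add: gamma_cong_def)
qed
lift_definition minus_gamma :: "gamma \<Rightarrow> gamma \<Rightarrow> gamma" is "(-)"
proof -
  fix f f' g g' :: "(nat, int) mpoly"
  assume "gamma_cong f f'" "gamma_cong g g'"
  then have "(f - f') + - (g - g') \<in> gamma_ideal"
    unfolding gamma_cong_def by (intro gamma_ideal_add gamma_ideal_neg)
  then show "gamma_cong (f - g) (f' - g')"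
    by (simp add: gamma_cong_def algebra_simps)
qed
lift_definition times_gamma :: "gamma \<Rightarrow> gamma \<Rightarrow> gamma" is "(*)"
proof -
  fix f f' g g' :: "(nat, int) mpoly"
  assume "gamma_cong f f'" "gamma_cong g g'"
  then have "g * (f - f') + f' * (g - g') \<in> gamma_ideal"
    by (simp add: gamma_cong_def gamma_ideal_add gamma_ideal_mult)
  then show "gamma_cong (f * g) (f' * g')"
    by (simp add: gamma_cong_def algebra_simps)
qed

lemma gamma_congI: "f = g \<Longrightarrow> gamma_cong f g"
  by (simp add: gamma_cong_def gamma_ideal_0)

instance
proof
  fix a b c :: gamma
  show "a + b + c = a + (b + c)" by transfer (rule gamma_congI, rule add.assoc)
  show "a + b = b + a" by transfer (rule gamma_congI, rule add.commute)
  show "0 + a = a" by transfer (rule gamma_congI, simp)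
  show "- a + a = 0" by transfer (rule gamma_congI, simp)
  show "a - b = a + - b" by transfer (rule gamma_congI, simp)
  show "a * b * c = a * (b * c)" by transfer (rule gamma_congI, rule mult.assoc)
  show "a * b = b * a" by transfer (rule gamma_congI, rule mult.commute)
  show "1 * a = a" by transfer (rule gamma_congI, simp)
  show "(a + b) * c = a * c + b * c" by transfer (rule gamma_congI, rule distrib_right)
  show "(0::gamma) \<noteq> 1"
  proof transfer
    have "augment 0 \<noteq> augment 1" by (simp add: is_ring_homD[OF is_ring_hom_subst[OF is_ring_hom_id]])
    then show "\<not> gamma_cong 0 1" using gamma_cong_augment by blast
  qed
qed

end

lift_definition cvar :: "nat \<Rightarrow> gamma" is cpoly .

lift_definition gamma_const_term :: "gamma \<Rightarrow> int" is augment
  by (rule gamma_cong_augment)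

lemma is_ring_hom_abs_gamma: "is_ring_hom abs_gamma"
  by (simp add: is_ring_hom_def one_gamma.abs_eq plus_gamma.abs_eq times_gamma.abs_eq)

lemma cvar_0: "cvar 0 = 1"
  by (simp add: cvar.abs_eq cpoly_def one_gamma.abs_eq)

lemma gamma_relations:
  assumes "p \<ge> 1"
  shows "gamma_relator cvar p = 0"
proof -
  have "gamma_relator cpoly p \<in> gamma_ideal"
    unfolding gamma_ideal_def using assms by (intro module.span_base[OF module_mult]) auto
  then have "abs_gamma (gamma_relator cpoly p) = 0"
    by (simp add: zero_gamma.abs_eq gamma.abs_eq_iff gamma_cong_def)
  then show ?thesis by (simp add: relator_hom[OF is_ring_hom_abs_gamma] cvar.abs_eq[abs_def])
qed

text \<open>\<open>XV k\<close> and \<open>YV k\<close> are the variables \<open>x\<^bsub>k+1\<^esub>\<close> and \<open>y\<^bsub>k+1\<^esub>\<close>.\<close>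

datatype xyvar = XV nat | YV nat

type_synonym gammaXY = "(xyvar, gamma) mpoly"

definition xvar :: "nat \<Rightarrow> gammaXY"
  where "xvar j = Var (XV (j - 1))"

definition yvar :: "nat \<Rightarrow> gammaXY"
  where "yvar j = Var (YV (j - 1))"

definition GammaX :: "nat \<Rightarrow> gammaXY set"
  where "GammaX n = {f. \<forall>m\<in>Poly_Mapping.keys f. Poly_Mapping.keys m \<subseteq> XV ` {..<n}}"

text \<open>The integer constant term: all \<open>c\<^sub>p\<close> (\<open>p \<ge> 1\<close>), \<open>x\<^sub>j\<close> and \<open>y\<^sub>j\<close> are set to zero.\<close>

definition constant_term :: "gammaXY \<Rightarrow> int"
  where "constant_term f = gamma_const_term (Poly_Mapping.lookup f 0)"

definition at_Y_0 :: "gammaXY \<Rightarrow> gammaXY"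
  where "at_Y_0 = mpoly_subst Const (\<lambda>v. case v of XV k \<Rightarrow> Var (XV k) | YV k \<Rightarrow> 0)"

definition omega :: "gammaXY \<Rightarrow> gammaXY"
  where "omega = mpoly_subst Const (\<lambda>v. case v of XV k \<Rightarrow> - Var (YV k) | YV k \<Rightarrow> - Var (XV k))"

definition s0_c :: "(nat \<Rightarrow> 'a::comm_ring_1) \<Rightarrow> 'a \<Rightarrow> nat \<Rightarrow> 'a"
  where "s0_c c z p = c p + 2 * (\<Sum>j=1..p. z ^ j * c (p - j))"

text \<open>\<open>s0_c c z\<close> is the image of the sequence \<open>c\<close> under \<open>s\<^sub>0\<close>, with \<open>z\<close> in place of \<open>x\<^sub>1\<close>.
  It respects the relations: the relations say that \<open>C(t) C(-t)\<close>, with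
  \<open>C(t) = \<Sum>\<^sub>p c\<^sub>p t\<^sup>p\<close>, has no even coefficients in positive degree, and \<open>s0_c\<close> multiplies \<open>C(t)\<close>
  by \<open>(1 + z t) / (1 - z t)\<close>.\<close>

context
  includes fps_syntax
begin

lemma gamma_relator_fps_nth:
  fixes c :: "nat \<Rightarrow> 'a::comm_ring_1"
  shows "(Abs_fps (\<lambda>n. (- 1) ^ n * c n) * Abs_fps c) $ (2 * p) = (- 1) ^ p * gamma_relator c p"
proof -
  let ?f = "\<lambda>i. (- 1) ^ i * c i * c (2 * p - i)"
  let ?g = "\<lambda>i. (- 1) ^ i * c (p + i) * c (p - i)"
  have sgn: "(- 1) ^ k * (- 1) ^ k = (1 :: 'a)" for k
    by (simp flip: power_mult_distrib)
  have "{0..2 * p} = ({0..<p} \<union> {p}) \<union> {p<..2 * p}" by auto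
  then have "sum ?f {0..2 * p} = sum ?f ({0..<p} \<union> {p}) + sum ?f {p<..2 * p}"
    by (simp only:) (rule sum.union_disjoint, auto)
  also have "sum ?f ({0..<p} \<union> {p}) = sum ?f {0..<p} + ?f p"
    by (subst sum.union_disjoint) auto
  also have "sum ?f {0..<p} = (\<Sum>i=1..p. (- 1) ^ p * ?g i)"
  proof (rule sum.reindex_bij_witness[of _ "\<lambda>i. p - i" "\<lambda>i. p - i"])
    fix i assume "i \<in> {0..<p}"
    then obtain k where p: "p = i + k" by (auto dest: less_imp_add_positive)
    have "(- 1) ^ p * ?g (p - i) = ((- 1) ^ k * (- 1) ^ k) * ((- 1) ^ i * c i * c (p + k))"
      by (simp add: p power_add ac_simps)
    moreover have "2 * p - i = p + k" by (simp add: p)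
    ultimately show "(- 1) ^ p * ?g (p - i) = ?f i" by (simp add: sgn)
  qed auto
  also have "sum ?f {p<..2 * p} = (\<Sum>i=1..p. (- 1) ^ p * ?g i)"
  proof (rule sum.reindex_bij_witness[of _ "\<lambda>i. p + i" "\<lambda>i. i - p"])
    fix i assume "i \<in> {p<..2 * p}"
    then obtain k where i: "i = p + k" by (auto dest: less_imp_add_positive)
    then have "2 * p - i = p - k" by simp
    then show "(- 1) ^ p * ?g (i - p) = ?f i" by (simp add: i power_add ac_simps)
  qed auto
  also have "?f p = (- 1) ^ p * c p ^ 2"
    by (simp add: power2_eq_square mult.assoc)
  finally have "sum ?f {0..2 * p} = (- 1) ^ p * gamma_relator c p"
    unfolding gamma_relator_def by (simp add: distrib_left mult.left_commute flip: sum_distrib_left)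
  then show ?thesis by (simp add: fps_mult_nth)
qed

lemma one_plus_fps_X_mult_nth:
  fixes f :: "'a::comm_ring_1 fps"
  shows "((1 + fps_const z * fps_X) * f) $ n = f $ n + (case n of 0 \<Rightarrow> 0 | Suc k \<Rightarrow> z * f $ k)"
  by (cases n) (simp_all add: distrib_right mult.assoc)

lemma gamma_relator_s0_c:
  fixes c :: "nat \<Rightarrow> 'a::comm_ring_1"
  assumes rel: "\<And>p. p \<ge> 1 \<Longrightarrow> gamma_relator c p = 0" and p: "p \<ge> 1"
  shows "gamma_relator (s0_c c z) p = 0"
proof -
  define neg :: "(nat \<Rightarrow> 'a) \<Rightarrow> 'a fps" where "neg c = Abs_fps (\<lambda>n. (- 1) ^ n * c n)" for c
  define d where "d = s0_c c z"
  define A B where "A = 1 + fps_const z * fps_X" and "B = 1 + fps_const (- z) * fps_X"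
  have d_0: "d 0 = c 0" by (simp add: d_def s0_c_def)
  have d_Suc: "d (Suc n) - z * d n = c (Suc n) + z * c n" for n
  proof -
    have "(\<Sum>j=1..Suc n. z ^ j * c (Suc n - j)) = (\<Sum>j=0..n. z * (z ^ j * c (n - j)))"
      by (rule sum.reindex_bij_witness[of _ Suc "\<lambda>j. j - 1"]) (auto simp: mult.assoc Suc_le_eq gr0_conv_Suc)
    also have "\<dots> = z * c n + z * (\<Sum>j=1..n. z ^ j * c (n - j))"
      by (simp add: sum.atLeast_Suc_atMost[of 0] distrib_left flip: sum_distrib_left)
    finally show ?thesis
      unfolding d_def s0_c_def mult_2 by (simp add: distrib_left)
  qed
  have shift: "B * Abs_fps d = A * Abs_fps c"
  proof (rule fps_ext)
    fix n show "(B * Abs_fps d) $ n = (A * Abs_fps c) $ n"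
      unfolding A_def B_def one_plus_fps_X_mult_nth
      by (cases n) (use d_0 d_Suc in simp_all)
  qed
  have shift': "A * neg d = B * neg c"
  proof (rule fps_ext)
    fix n
    show "(A * neg d) $ n = (B * neg c) $ n"
    proof (cases n)
      case (Suc k)
      have "(- 1) ^ n * (d n - z * d k) = (- 1) ^ n * (c n + z * c k)"
        using d_Suc[of k] Suc by simp
      then show ?thesis
        unfolding A_def B_def one_plus_fps_X_mult_nth
        by (simp add: Suc neg_def algebra_simps)
    qed (simp add: A_def B_def one_plus_fps_X_mult_nth neg_def d_0)
  qed
  define E where "E = neg d * Abs_fps d - neg c * Abs_fps c"
  have "(A * neg d) * (B * Abs_fps d) = (B * neg c) * (A * Abs_fps c)"
    by (simp only: shift shift')
  then have "A * (B * E) = 0"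
    by (simp add: E_def algebra_simps)
  then have E0: "(A * (B * E)) $ n = 0" for n
    by simp
  have E_step: "E $ Suc (Suc n) = z * z * E $ n" for n
    using E0[of "Suc (Suc n)"]
    unfolding A_def B_def one_plus_fps_X_mult_nth
    by (simp add: algebra_simps)
  have "E $ (2 * k) = 0" for k
  proof (induction k)
    case 0
    show ?case using E0[of 0] by (simp add: A_def B_def one_plus_fps_X_mult_nth)
  qed (simp add: E_step)
  from this[of p] have "(neg d * Abs_fps d) $ (2 * p) = (neg c * Abs_fps c) $ (2 * p)"
    by (simp add: E_def)
  then have "(- 1) ^ p * gamma_relator d p = (- 1) ^ p * gamma_relator c p"
    by (simp only: neg_def gamma_relator_fps_nth)
  then have "(- 1) ^ p * ((- 1) ^ p * gamma_relator d p) = 0"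
    by (simp add: rel[OF p])
  then have "((- 1) ^ p * (- 1) ^ p) * gamma_relator d p = 0"
    by (simp only: mult.assoc)
  then show ?thesis by (simp add: d_def flip: power_mult_distrib)
qed

end

abbreviation s0_lift :: "(nat, int) mpoly \<Rightarrow> gammaXY"
  where "s0_lift \<equiv> mpoly_subst of_int (\<lambda>k. s0_c (\<lambda>p. Const (cvar p)) (xvar 1) (Suc k))"

lemma s0_lift_cpoly: "s0_lift (cpoly p) = s0_c (\<lambda>p. Const (cvar p)) (xvar 1) p"
  by (cases p) (simp_all add: cpoly_def mpoly_subst_Var is_ring_hom_of_int s0_c_def cvar_0
      is_ring_homD[OF is_ring_hom_subst[OF is_ring_hom_of_int]] is_ring_homD[OF is_ring_hom_Const])

lift_definition s0_gamma :: "gamma \<Rightarrow> gammaXY" is s0_lift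
proof (rule gamma_cong_hom[OF is_ring_hom_subst[OF is_ring_hom_of_int]])
  fix p :: nat assume p: "p \<ge> 1"
  have "gamma_relator (\<lambda>k. Const (cvar k) :: gammaXY) q = 0" if "q \<ge> 1" for q
    using relator_hom[OF is_ring_hom_Const, of cvar q] gamma_relations[OF that]
    by (simp add: is_ring_homD[OF is_ring_hom_Const])
  then show "gamma_relator (\<lambda>k. s0_lift (cpoly k)) p = 0"
    unfolding s0_lift_cpoly
    by (intro gamma_relator_s0_c p) (simp_all add: cvar_0 is_ring_homD[OF is_ring_hom_Const])
qed

definition act :: "nat \<Rightarrow> gammaXY \<Rightarrow> gammaXY"
  where "act i =
    (if i = 0
     then mpoly_subst s0_gamma (\<lambda>v. if v = XV 0 then - Var v else Var v)
     else mpoly_subst Const (\<lambda>v. if v = XV (i - 1) then Var (XV i)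
                         else if v = XV i then Var (XV (i - 1)) else Var v))"

lemma is_ring_hom_s0_gamma: "is_ring_hom s0_gamma"
  unfolding is_ring_hom_def
  by (safe; transfer; simp add: is_ring_homD[OF is_ring_hom_subst[OF is_ring_hom_of_int]])

lemma is_ring_hom_act: "is_ring_hom (act i)"
  by (simp add: act_def is_ring_hom_subst is_ring_hom_s0_gamma is_ring_hom_Const)

lemma act_0_c: "act 0 (Const (cvar p)) = Const (cvar p) + 2 * (\<Sum>j=1..p. xvar 1 ^ j * Const (cvar (p - j)))"
proof -
  have "act 0 (Const (cvar p)) = s0_gamma (cvar p)"
    by (simp add: act_def mpoly_subst_Const is_ring_hom_s0_gamma)
  also have "\<dots> = s0_lift (cpoly p)" by (simp add: cvar.abs_eq s0_gamma.abs_eq)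
  finally show ?thesis unfolding s0_lift_cpoly by (simp only: s0_c_def)
qed

lemma act_0_x: "j \<ge> 1 \<Longrightarrow> act 0 (xvar j) = (if j = 1 then - xvar 1 else xvar j)"
  and act_0_y: "act 0 (yvar j) = yvar j"
  by (auto simp: act_def xvar_def yvar_def mpoly_subst_Var is_ring_hom_s0_gamma)

lemma act_Suc_c: "i \<ge> 1 \<Longrightarrow> act i (Const a) = Const a"
  and act_Suc_x: "i \<ge> 1 \<Longrightarrow> j \<ge> 1 \<Longrightarrow>
    act i (xvar j) = (if j = i then xvar (i + 1) else if j = i + 1 then xvar i else xvar j)"
  and act_Suc_y: "i \<ge> 1 \<Longrightarrow> act i (yvar j) = yvar j"
  by (auto simp: act_def xvar_def yvar_def mpoly_subst_Var mpoly_subst_Const is_ring_hom_Const)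

text \<open>The exact quotient exists in \<open>\<Gamma>[X,Y]\<close>, and is unique because \<open>\<Gamma>\<close> has no 2-torsion.\<close>

definition ddx :: "nat \<Rightarrow> gammaXY \<Rightarrow> gammaXY"
  where "ddx i f =
    (THE g. (if i = 0 then - 2 * xvar 1 else xvar i - xvar (i + 1)) * g = f - act i f)"

definition ddy :: "nat \<Rightarrow> gammaXY \<Rightarrow> gammaXY"
  where "ddy i f = omega (ddx i (omega f))"

text \<open>A signed permutation is extended to an odd bijection of the integers, so that the group
  product is composition.\<close>

definition signed_perms :: "nat \<Rightarrow> (int \<Rightarrow> int) set"
  where "signed_perms k =
    {w. bij w \<and> (\<forall>i. w (- i) = - w i) \<and> (\<forall>i > int k. w i = i)}"

definition W_inf :: "(int \<Rightarrow> int) set"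
  where "W_inf = (\<Union>k. signed_perms k)"

definition gen :: "nat \<Rightarrow> int \<Rightarrow> int"
  where "gen i m =
    (if i = 0 then (if \<bar>m\<bar> = 1 then - m else m)
     else if \<bar>m\<bar> = int i then sgn m * (int i + 1)
     else if \<bar>m\<bar> = int i + 1 then sgn m * int i
     else m)"

definition len :: "(int \<Rightarrow> int) \<Rightarrow> nat"
  where "len w = (LEAST r. \<exists>v. length v = r \<and> w = foldr (\<lambda>i u. gen i \<circ> u) v id)"

definition W_upper :: "nat \<Rightarrow> (int \<Rightarrow> int) set"
  where "W_upper n = {w \<in> W_inf. \<forall>i > int n. w i < w (i + 1)}"

definition typeC_double_schubert :: "((int \<Rightarrow> int) \<Rightarrow> gammaXY) \<Rightarrow> bool"
  where "typeC_double_schubert S \<longleftrightarrow>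
    (\<forall>w\<in>W_inf. \<forall>i.
       ddx i (S w) = (if len (w \<circ> gen i) < len w then S (w \<circ> gen i) else 0) \<and>
       ddy i (S w) = (if len (gen i \<circ> w) < len w then S (gen i \<circ> w) else 0)) \<and>
    (\<forall>w\<in>W_inf. constant_term (S w) = (if w = id then 1 else 0))"

definition is_Z_basis :: "('i \<Rightarrow> 'a::comm_ring_1) \<Rightarrow> 'i set \<Rightarrow> 'a set \<Rightarrow> bool"
  where "is_Z_basis b I M \<longleftrightarrow>
    inj_on b I \<and>
    \<not> module.dependent (\<lambda>(k::int) a. of_int k * a) (b ` I) \<and>
    module.span (\<lambda>(k::int) a. of_int k * a) (b ` I) = M"

end

theory Submission
  imports Defs
begin

text \<open>
  Write \<open>C\<^sub>w\<close> for the single Schubert polynomial \<open>C\<^sub>w(X)\<close> and \<open>\<partial>\<^sub>i\<close> for the divided difference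
  \<open>ddx i\<close>. Setting \<open>Y = 0\<close> commutes with \<open>\<partial>\<^sub>i\<close> and keeps constant terms, so \<open>\<partial>\<^sub>i C\<^sub>w\<close> is
  \<open>C\<close> of \<open>w s\<^sub>i\<close> if \<open>w\<close> has a descent at \<open>i\<close> (\<open>w\<^sub>i > w\<^bsub>i+1\<^esub>\<close>, respectively \<open>w\<^sub>1 < 0\<close> for \<open>i = 0\<close>) and \<open>0\<close>
  otherwise, and the constant term of \<open>C\<^sub>w\<close> detects \<open>w = 1\<close>.

  Independence: applied to a linear relation, the divided differences along a reduced word of
  \<open>w\<close> followed by the constant term leave exactly the coefficient of \<open>C\<^sub>w\<close> (\<open>C_independent\<close>).
  Moreover \<open>C\<^sub>w\<close> lies in \<open>\<Gamma>[X\<^sub>n]\<close> for \<open>w \<in> W\<^sup>(\<^sup>n\<^sup>)\<close>: it is killed by \<open>\<partial>\<^sub>i\<close> for \<open>i > n\<close>, and a polynomial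
  that is symmetric in \<open>x\<^sub>N, x\<^bsub>N+1\<^esub>\<close> but does not involve \<open>x\<^bsub>N+1\<^esub>\<close> does not involve \<open>x\<^sub>N\<close> either
  (\<open>GammaX_descend\<close>).

  Spanning (\<open>zspan_C_of_ddx_nilpotent\<close>) is an induction on the number of divided differences
  that suffices to kill \<open>f \<in> \<Gamma>[X\<^sub>n]\<close>, with an inner induction on \<open>n\<close>. For \<open>n \<ge> 1\<close> the polynomial \<open>\<partial>\<^sub>n f\<close> lies
  in \<open>\<Gamma>[X\<^bsub>n+1\<^esub>]\<close>, hence it is a combination of \<open>C\<^sub>v\<close> with \<open>v \<in> W\<^sup>(\<^sup>n\<^sup>+\<^sup>1\<^sup>)\<close>. The identities \<open>\<partial>\<^sub>n \<partial>\<^sub>n f = 0\<close> and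
  \<open>\<partial>\<^sub>n \<partial>\<^bsub>n+1\<^esub> \<partial>\<^sub>n f = 0\<close> (a braid relation, because \<open>f\<close> is symmetric in \<open>x\<^bsub>n+1\<^esub>, x\<^bsub>n+2\<^esub>\<close>) and independence rule
  out every \<open>v\<close> for which \<open>v s\<^sub>n\<close> is shorter than \<open>v\<close> or outside \<open>W\<^sup>(\<^sup>n\<^sup>)\<close>. Replacing each \<open>C\<^sub>v\<close> by the
  Schubert polynomial of \<open>v s\<^sub>n\<close> therefore gives a combination of the allowed kind with the same
  \<open>\<partial>\<^sub>n\<close> as \<open>f\<close>, and the difference lies in \<open>\<Gamma>[X\<^bsub>n-1\<^esub>]\<close>. For \<open>n = 0\<close> the same works with \<open>\<partial>\<^sub>0\<close> and the
  identity \<open>\<partial>\<^sub>1 \<partial>\<^sub>0 \<partial>\<^sub>1 \<partial>\<^sub>0 f = 0\<close> on \<open>\<Gamma>\<close>; what remains is an element of \<open>\<Gamma>\<close> invariant under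
  \<open>s\<^sub>0\<close>, and such an element is an integer (\<open>invariant_imp_integer\<close>).

  Two facts about \<open>\<Gamma>\<close> enter: it has no torsion, so that divided differences are well defined, and
  \<open>s\<^sub>0\<close> has only the trivial invariants. Both follow from the fact that the products of distinct
  \<open>c\<^sub>p\<close> are a \<open>\<int>\<close>-basis of \<open>\<Gamma>\<close> (\<open>gamma_span_induct\<close>, \<open>gcoef_cmon\<close>).
\<close>

section \<open>The products of distinct \<open>c\<^sub>p\<close> form a basis of \<open>\<Gamma>\<close>\<close>

text \<open>
  The relations rewrite \<open>c\<^sub>p\<^sup>2\<close> into products \<open>c\<^bsub>p+i\<^esub> c\<^bsub>p-i\<^esub>\<close> with \<open>i \<ge> 1\<close>. They preserve the degree
  \<open>deg\<close>, in which \<open>c\<^sub>p\<close> has degree \<open>p\<close>, and they increase \<open>wt\<close>, in which \<open>c\<^sub>p\<close> has weight \<open>p\<^sup>2\<close>. As the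
  weight is bounded by the square of the degree, rewriting terminates; and since the leading
  monomials \<open>c\<^sub>p\<^sup>2\<close> of the relations are pairwise coprime, no further relations arise.
\<close>
definition mweight :: "(nat \<Rightarrow> nat) \<Rightarrow> (nat \<Rightarrow>\<^sub>0 nat) \<Rightarrow> nat"
  where "mweight \<phi> m = (\<Sum>k\<in>Poly_Mapping.keys m. \<phi> k * Poly_Mapping.lookup m k)"

abbreviation deg :: "(nat \<Rightarrow>\<^sub>0 nat) \<Rightarrow> nat" where "deg \<equiv> mweight Suc"
abbreviation wt :: "(nat \<Rightarrow>\<^sub>0 nat) \<Rightarrow> nat" where "wt \<equiv> mweight (\<lambda>k. Suc k ^ 2)"

lemma mweight_superset:
  assumes "finite S" "Poly_Mapping.keys m \<subseteq> S"
  shows "mweight \<phi> m = (\<Sum>k\<in>S. \<phi> k * Poly_Mapping.lookup m k)"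
  unfolding mweight_def
  by (rule sum.mono_neutral_left) (use assms in \<open>auto simp: in_keys_iff\<close>)

lemma mweight_add: "mweight \<phi> (m + m') = mweight \<phi> m + mweight \<phi> m'"
proof -
  let ?S = "Poly_Mapping.keys m \<union> Poly_Mapping.keys m'"
  have "Poly_Mapping.keys (m + m') \<subseteq> ?S" by (rule keys_add)
  then show ?thesis
    by (simp add: mweight_superset[where S = ?S] lookup_add distrib_left sum.distrib)
qed

lemma mweight_0 [simp]: "mweight \<phi> 0 = 0"
  by (simp add: mweight_def)

lemma mweight_single [simp]: "mweight \<phi> (Poly_Mapping.single k n) = \<phi> k * n"
  by (cases "n = 0") (simp_all add: mweight_def)

lemma sum_squares_le_square_sum:
  fixes f :: "'a \<Rightarrow> nat"
  assumes "finite A"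
  shows "(\<Sum>k\<in>A. f k ^ 2) \<le> (\<Sum>k\<in>A. f k) ^ 2"
  using assms by (induction A) (auto simp: power2_sum)

lemma wt_le_deg_squared: "wt m \<le> deg m ^ 2"
proof -
  have "wt m \<le> (\<Sum>k\<in>Poly_Mapping.keys m. (Suc k * Poly_Mapping.lookup m k) ^ 2)"
    unfolding mweight_def
  proof (intro sum_mono)
    fix k
    have "Poly_Mapping.lookup m k * 1 \<le> Poly_Mapping.lookup m k ^ 2"
      unfolding power2_eq_square by (cases "Poly_Mapping.lookup m k") auto
    then show "Suc k ^ 2 * Poly_Mapping.lookup m k \<le> (Suc k * Poly_Mapping.lookup m k) ^ 2"
      unfolding power_mult_distrib by (intro mult_left_mono) auto
  qed
  also have "\<dots> \<le> deg m ^ 2"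
    unfolding mweight_def by (intro sum_squares_le_square_sum) auto
  finally show ?thesis .
qed

definition homog_above :: "nat \<Rightarrow> nat \<Rightarrow> (nat, int) mpoly \<Rightarrow> bool"
  where "homog_above d w f \<longleftrightarrow> (\<forall>m\<in>Poly_Mapping.keys f. deg m = d \<and> w \<le> wt m)"

lemma homog_above_add: "homog_above d w f \<Longrightarrow> homog_above d w g \<Longrightarrow> homog_above d w (f + g)"
  using keys_add[of f g] by (auto simp: homog_above_def)

lemma homog_above_neg: "homog_above d w f \<Longrightarrow> homog_above d w (- f)"
  by (auto simp: homog_above_def)

lemma homog_above_0: "homog_above d w 0"
  by (auto simp: homog_above_def)

lemma homog_above_sum: "(\<And>i. i \<in> I \<Longrightarrow> homog_above d w (f i)) \<Longrightarrow> homog_above d w (sum f I)"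
  by (induction I rule: infinite_finite_induct) (auto intro: homog_above_add homog_above_0)

lemma homog_above_mult:
  "homog_above d w f \<Longrightarrow> homog_above d' w' g \<Longrightarrow> homog_above (d + d') (w + w') (f * g)"
  unfolding homog_above_def using keys_mult[of f g] by (auto simp: mweight_add intro!: add_mono dest!: subsetD)

lemma homog_above_mono: "homog_above d w f \<Longrightarrow> w' \<le> w \<Longrightarrow> homog_above d w' f"
  by (fastforce simp: homog_above_def)

lemma homog_above_single: "d = deg m \<Longrightarrow> w = wt m \<Longrightarrow> homog_above d w (Poly_Mapping.single m a)"
  by (auto simp: homog_above_def)

text \<open>Normalisation and triangularity in one: \<open>m\<close> occurs in \<open>f\<close> with coefficient \<open>1\<close>, and all other
  monomials of \<open>f\<close> have the same degree and larger weight.\<close>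
definition leads :: "(nat \<Rightarrow>\<^sub>0 nat) \<Rightarrow> (nat, int) mpoly \<Rightarrow> bool"
  where "leads m f \<longleftrightarrow> homog_above (deg m) (Suc (wt m)) (f - Poly_Mapping.single m 1)"

lemma leads_imp_homog_above:
  assumes "leads m f" shows "homog_above (deg m) (wt m) f"
proof -
  have "homog_above (deg m) (wt m) ((f - Poly_Mapping.single m 1) + Poly_Mapping.single m 1)"
    using assms unfolding leads_def
    by (intro homog_above_add homog_above_single) (auto elim: homog_above_mono)
  then show ?thesis by simp
qed

lemma leads_single: "leads m (Poly_Mapping.single m 1)"
  by (simp add: leads_def homog_above_0)

lemma leads_1: "leads 0 1"
  using leads_single[of 0] by simp

lemma leads_mult:
  assumes "leads m f" "leads m' g"
  shows "leads (m + m') (f * g)"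
proof -
  have "f * g - Poly_Mapping.single (m + m') 1 =
      (f - Poly_Mapping.single m 1) * g + Poly_Mapping.single m 1 * (g - Poly_Mapping.single m' 1)"
    by (simp add: algebra_simps mult_single)
  moreover have "homog_above (deg m + deg m') (Suc (wt m) + wt m') ((f - Poly_Mapping.single m 1) * g)"
    using assms leads_imp_homog_above[of m' g] by (intro homog_above_mult) (auto simp: leads_def)
  moreover have "homog_above (deg m + deg m') (wt m + Suc (wt m'))
      (Poly_Mapping.single m 1 * (g - Poly_Mapping.single m' 1))"
    using assms by (intro homog_above_mult homog_above_single) (auto simp: leads_def)
  ultimately show ?thesis
    by (auto simp: leads_def mweight_add intro: homog_above_add)
qed

lemma leads_prod:
  "finite A \<Longrightarrow> (\<And>k. k \<in> A \<Longrightarrow> leads (m k) (f k)) \<Longrightarrow> leads (\<Sum>k\<in>A. m k) (\<Prod>k\<in>A. f k)"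
  by (induction A rule: finite_induct) (auto intro: leads_1 leads_mult)

abbreviation rel :: "nat \<Rightarrow> (nat, int) mpoly"
  where "rel k \<equiv> gamma_relator cpoly (Suc k)"

lemma homog_above_cpoly: "homog_above p (p ^ 2) (cpoly p)"
proof (cases p)
  case (Suc k)
  then show ?thesis unfolding cpoly_def Var_def
    by (auto intro!: homog_above_single)
qed (auto simp: cpoly_def homog_above_def)

lemma leads_rel: "leads (Poly_Mapping.single k 2) (rel k)"
proof -
  let ?p = "Suc k"
  have "cpoly ?p ^ 2 = Poly_Mapping.single (Poly_Mapping.single k 2) 1"
    by (simp add: cpoly_def Var_def power2_eq_square mult_single numeral_2_eq_2 flip: single_add)
  moreover have "homog_above (2 * ?p) (Suc (2 * ?p ^ 2))
      (\<Sum>i = 1..?p. (- 1) ^ i * cpoly (?p + i) * cpoly (?p - i))"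
  proof (rule homog_above_sum)
    fix i assume i: "i \<in> {1..?p}"
    then obtain j where j: "?p = i + j" using le_Suc_ex by auto
    have "homog_above ((?p + i) + (?p - i)) ((?p + i) ^ 2 + (?p - i) ^ 2) (cpoly (?p + i) * cpoly (?p - i))"
      by (intro homog_above_mult homog_above_cpoly)
    moreover have "(?p + i) + (?p - i) = 2 * ?p" using i by auto
    moreover have "Suc (2 * ?p ^ 2) \<le> (?p + i) ^ 2 + (?p - i) ^ 2"
    proof -
      \<comment> \<open>\<open>(p + i)\<^sup>2 + (p - i)\<^sup>2 = 2 p\<^sup>2 + 2 i\<^sup>2\<close>\<close>
      have "1 \<le> i * i" using i by (cases i) auto
      then show ?thesis
        unfolding j diff_add_inverse power2_eq_square distrib_left distrib_right mult.commute[of j i] by linarith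
    qed
    ultimately have *: "homog_above (2 * ?p) (Suc (2 * ?p ^ 2)) (cpoly (?p + i) * cpoly (?p - i))"
      by (metis (no_types) homog_above_mono)
    show "homog_above (2 * ?p) (Suc (2 * ?p ^ 2)) ((- 1) ^ i * cpoly (?p + i) * cpoly (?p - i))"
    proof (cases "even i")
      case True
      with * show ?thesis by (simp only: power_minus_even power_one mult_1)
    next
      case False
      with homog_above_neg[OF *] show ?thesis by (simp only: power_minus_odd power_one mult_1 mult_minus_left simp_thms not_False_eq_True)
    qed
  qed
  moreover have "deg (Poly_Mapping.single k 2) = 2 * ?p" "wt (Poly_Mapping.single k 2) = 2 * ?p ^ 2"
    by (simp_all only: mweight_single mult.commute)
  ultimately show ?thesis
    unfolding leads_def gamma_relator_def mult_2[of "sum _ _"] by (simp only: add_diff_cancel_left' homog_above_add)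
qed

lemma poly_mapping_sum_single:
  "m = (\<Sum>k\<in>Poly_Mapping.keys m. Poly_Mapping.single k (Poly_Mapping.lookup m k))"
  by (rule poly_mapping_eqI) (auto simp: lookup_sum lookup_single when_def in_keys_iff)

lemma leads_rel_power: "leads (Poly_Mapping.single k (2 * n)) (rel k ^ n)"
proof (induction n)
  case (Suc n)
  then show ?case
    using leads_mult[OF leads_rel Suc.IH, of k] by (simp flip: single_add)
qed (auto intro: leads_1)

lemma leads_monom_subst_rel: "leads (a + a) (monom_subst rel a)"
proof -
  have "leads (\<Sum>k\<in>Poly_Mapping.keys a. Poly_Mapping.single k (2 * Poly_Mapping.lookup a k)) (monom_subst rel a)"
    unfolding monom_subst_def by (intro leads_prod leads_rel_power) auto
  moreover have "(\<Sum>k\<in>Poly_Mapping.keys a. Poly_Mapping.single k (2 * Poly_Mapping.lookup a k)) = a + a"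
    by (rule poly_mapping_eqI) (auto simp: lookup_add lookup_sum lookup_single when_def in_keys_iff)
  ultimately show ?thesis by simp
qed

definition odd_part :: "(nat \<Rightarrow>\<^sub>0 nat) \<Rightarrow> (nat \<Rightarrow>\<^sub>0 nat)"
  where "odd_part = Poly_Mapping.map (\<lambda>n. n mod 2)"
definition half :: "(nat \<Rightarrow>\<^sub>0 nat) \<Rightarrow> (nat \<Rightarrow>\<^sub>0 nat)"
  where "half = Poly_Mapping.map (\<lambda>n. n div 2)"

lemma lookup_odd_part: "Poly_Mapping.lookup (odd_part m) k = Poly_Mapping.lookup m k mod 2"
  and lookup_half: "Poly_Mapping.lookup (half m) k = Poly_Mapping.lookup m k div 2"
  by (auto simp: odd_part_def half_def Poly_Mapping.map.rep_eq when_def)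

text \<open>For \<open>m = m\<^sub>0 + 2 a\<close> with \<open>m\<^sub>0\<close> square-free, the monomial \<open>c\<^sup>m\<close> is replaced by the product of
  \<open>c\<close> to the power \<open>m\<^sub>0\<close> and the \<open>a\<close>-th power product of the relators. By triangularity this is a new
  \<open>\<int>\<close>-basis of the polynomial ring. It is adapted to the ideal, because multiplication by a relator
  maps it injectively into its members with \<open>a \<noteq> 0\<close>.\<close>
definition adapted :: "(nat \<Rightarrow>\<^sub>0 nat) \<Rightarrow> (nat, int) mpoly"
  where "adapted m = Poly_Mapping.single (odd_part m) 1 * monom_subst rel (half m)"

lemma leads_adapted: "leads m (adapted m)"
proof -
  have "odd_part m + (half m + half m) = m"
  proof (rule poly_mapping_eqI)
    fix k
    show "Poly_Mapping.lookup (odd_part m + (half m + half m)) k = Poly_Mapping.lookup m k"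
      unfolding lookup_add lookup_odd_part lookup_half by presburger
  qed
  then show ?thesis
    unfolding adapted_def using leads_mult[OF leads_single leads_monom_subst_rel] by metis
qed

lemma rel_mult_adapted: "rel k * adapted m = adapted (m + Poly_Mapping.single k 2)"
proof -
  have "odd_part (m + Poly_Mapping.single k 2) = odd_part m"
    by (rule poly_mapping_eqI) (auto simp: lookup_odd_part lookup_add lookup_single when_def)
  moreover have "half (m + Poly_Mapping.single k 2) = half m + Poly_Mapping.single k 1"
    by (rule poly_mapping_eqI) (auto simp: lookup_half lookup_add lookup_single when_def)
  ultimately show ?thesis
    by (simp add: adapted_def monom_subst_add mult_ac)
qed

definition sqfree :: "(nat \<Rightarrow>\<^sub>0 nat) \<Rightarrow> bool"
  where "sqfree m \<longleftrightarrow> (\<forall>k. Poly_Mapping.lookup m k < 2)"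

lemma adapted_sqfree:
  assumes "sqfree m" shows "adapted m = Poly_Mapping.single m 1"
proof -
  have "odd_part m = m" "half m = 0"
    using assms by (auto intro!: poly_mapping_eqI simp: sqfree_def lookup_odd_part lookup_half)
  then show ?thesis by (simp add: adapted_def)
qed

lemma rel_in_gamma_ideal: "rel k \<in> gamma_ideal"
  unfolding gamma_ideal_def by (intro module.span_base[OF module_mult]) auto

lemma adapted_in_gamma_ideal:
  assumes "\<not> sqfree m" shows "adapted m \<in> gamma_ideal"
proof -
  obtain k where k: "Poly_Mapping.lookup m k \<ge> 2"
    using assms by (auto simp: sqfree_def not_less)
  have "m = (m - Poly_Mapping.single k 2) + Poly_Mapping.single k 2"
    by (rule poly_mapping_eqI) (use k in \<open>auto simp: lookup_add lookup_minus lookup_single when_def\<close>)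
  then have "adapted m = adapted (m - Poly_Mapping.single k 2) * rel k"
    using rel_mult_adapted by (metis mult.commute)
  then show ?thesis
    using gamma_ideal_mult[OF rel_in_gamma_ideal] by metis
qed

text \<open>Well-founded because every monomial of \<open>adapted m\<close> other than \<open>m\<close> has the degree of \<open>m\<close> and a
  larger weight, which is bounded.\<close>
lemma monomial_rewrite_induct [case_names step]:
  assumes "\<And>m. (\<And>m'. m' \<in> Poly_Mapping.keys (adapted m - Poly_Mapping.single m 1) \<Longrightarrow> P m') \<Longrightarrow> P m"
  shows "P m"
proof (induction "deg m ^ 2 - wt m" arbitrary: m rule: less_induct)
  case less
  show ?case
  proof (rule assms)
    fix m' assume "m' \<in> Poly_Mapping.keys (adapted m - Poly_Mapping.single m 1)"
    with leads_adapted[of m] have "deg m' = deg m" "wt m < wt m'"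
      by (auto simp: leads_def homog_above_def)
    with wt_le_deg_squared[of m'] show "P m'"
      by (intro less) auto
  qed
qed

text \<open>The coefficient of the basis element \<open>adapted b\<close> in the monomial \<open>m\<close>. The recursion solves
  \<open>c\<^sup>m = adapted m - (adapted m - c\<^sup>m)\<close> for this coefficient, which produces the coordinate
  functional directly, with the property \<open>nf_coeff_poly_adapted\<close>.\<close>
function nf_coeff :: "(nat \<Rightarrow>\<^sub>0 nat) \<Rightarrow> (nat \<Rightarrow>\<^sub>0 nat) \<Rightarrow> int" where
  "nf_coeff b m = (if m = b then 1 else 0) -
    (\<Sum>m'\<in>Poly_Mapping.keys (adapted m - Poly_Mapping.single m 1).
      Poly_Mapping.lookup (adapted m - Poly_Mapping.single m 1) m' * nf_coeff b m')"
  by auto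
termination
proof (relation "measure (\<lambda>(b, m). deg m ^ 2 - wt m)", goal_cases)
  case (2 b m m')
  then have "deg m' = deg m" "wt m < wt m'"
    using leads_adapted[of m] by (auto simp: leads_def homog_above_def)
  with wt_le_deg_squared[of m'] show ?case by auto
qed auto

declare nf_coeff.simps [simp del]

definition nf_coeff_poly :: "(nat \<Rightarrow>\<^sub>0 nat) \<Rightarrow> (nat, int) mpoly \<Rightarrow> int"
  where "nf_coeff_poly b f = (\<Sum>m\<in>Poly_Mapping.keys f. Poly_Mapping.lookup f m * nf_coeff b m)"

lemma nf_coeff_poly_superset:
  assumes "finite S" "Poly_Mapping.keys f \<subseteq> S"
  shows "nf_coeff_poly b f = (\<Sum>m\<in>S. Poly_Mapping.lookup f m * nf_coeff b m)"
  unfolding nf_coeff_poly_def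
  by (rule sum.mono_neutral_left) (use assms in \<open>auto simp: in_keys_iff\<close>)

lemma nf_coeff_poly_add: "nf_coeff_poly b (f + g) = nf_coeff_poly b f + nf_coeff_poly b g"
proof -
  let ?S = "Poly_Mapping.keys f \<union> Poly_Mapping.keys g"
  have "Poly_Mapping.keys (f + g) \<subseteq> ?S" by (rule keys_add)
  then show ?thesis
    by (simp add: nf_coeff_poly_superset[where S = ?S] lookup_add distrib_right sum.distrib)
qed

lemma additive_nf_coeff_poly: "additive (nf_coeff_poly b)"
  by standard (rule nf_coeff_poly_add)

lemma nf_coeff_poly_single: "nf_coeff_poly b (Poly_Mapping.single m c) = c * nf_coeff b m"
  by (cases "c = 0") (simp_all add: nf_coeff_poly_def)

lemma nf_coeff_poly_adapted: "nf_coeff_poly b (adapted m) = (if m = b then 1 else 0)"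
proof -
  interpret additive "nf_coeff_poly b" by (rule additive_nf_coeff_poly)
  have "nf_coeff_poly b (adapted m) = nf_coeff_poly b (adapted m - Poly_Mapping.single m 1) + nf_coeff_poly b (Poly_Mapping.single m 1)"
    by (simp flip: nf_coeff_poly_add)
  then show ?thesis
    by (simp add: nf_coeff_poly_single nf_coeff.simps[of b m] flip: nf_coeff_poly_def)
qed

lemma adapted_span_induct:
  assumes zero: "P 0" and add: "\<And>f g. P f \<Longrightarrow> P g \<Longrightarrow> P (f + g)" and neg: "\<And>f. P f \<Longrightarrow> P (- f)"
    and adapted: "\<And>m. P (adapted m)"
  shows "P (f :: (nat, int) mpoly)"
proof -
  have sum: "P (sum g S)" if "\<And>i. i \<in> S \<Longrightarrow> P (g i)" for g :: "(nat \<Rightarrow>\<^sub>0 nat) \<Rightarrow> (nat, int) mpoly" and S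
    using that by (induction S rule: infinite_finite_induct) (auto intro: zero add)
  have scale: "P (Poly_Mapping.single m c)" if m: "P (Poly_Mapping.single m 1)" for m c
  proof (induction c rule: int_induct[where k = 0])
    case (step2 i)
    then show ?case using add[OF _ neg[OF m]] by (metis single_diff diff_conv_add_uminus)
  qed (auto simp: zero single_add intro: add m)
  have monomial: "P (Poly_Mapping.single m 1)" for m
  proof (induction m rule: monomial_rewrite_induct)
    case (step m)
    have "P (adapted m - Poly_Mapping.single m 1)"
      by (subst mpoly_sum_monoms) (auto intro!: sum scale step)
    from add[OF adapted[of m] neg[OF this]] show ?case by simp
  qed
  show ?thesis
    by (subst mpoly_sum_monoms[of f], rule sum, rule scale, rule monomial)
qed

text \<open>The ideal is spanned by the products of a relator with some \<open>adapted m\<close>, and each of them is again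
  \<open>adapted\<close> of a monomial that is not square-free.\<close>
lemma nf_coeff_poly_gamma_ideal:
  assumes "f \<in> gamma_ideal" "sqfree b"
  shows "nf_coeff_poly b f = 0"
proof -
  interpret additive "nf_coeff_poly b" by (rule additive_nf_coeff_poly)
  have rel: "nf_coeff_poly b (g * rel k) = 0" for g k
  proof (rule adapted_span_induct[where f = g])
    fix m
    have "m + Poly_Mapping.single k 2 \<noteq> b"
      using assms(2) by (auto simp: sqfree_def lookup_add dest!: spec[of _ k])
    then show "nf_coeff_poly b (adapted m * rel k) = 0"
      by (simp add: mult.commute[of "adapted m"] rel_mult_adapted nf_coeff_poly_adapted)
  qed (auto simp: zero add minus distrib_right)
  interpret module "(*) :: (nat, int) mpoly \<Rightarrow> _" by (rule module_mult)
  from assms(1) show ?thesis unfolding gamma_ideal_def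
  proof (induction rule: span_induct_alt)
    case (step c x y)
    then obtain p where "p \<ge> 1" "x = gamma_relator cpoly p" by auto
    then obtain k where "x = rel k" by (cases p) auto
    with step show ?case by (simp add: add rel)
  qed (simp add: zero)
qed

lemma is_ring_hom_prod: "is_ring_hom \<phi> \<Longrightarrow> \<phi> (prod g S) = (\<Prod>x\<in>S. \<phi> (g x))"
  by (induction S rule: infinite_finite_induct) (simp_all add: is_ring_homD)

lemma is_ring_hom_of_int_commute: "is_ring_hom \<phi> \<Longrightarrow> \<phi> (of_int k) = of_int k"
  by (cases k) (simp_all add: is_ring_homD)

text \<open>A finite set of positive integers stands for a strict partition; these index the products
  \<open>cmon\<close> of distinct \<open>c\<^sub>p\<close>.\<close>
definition strict_sets :: "nat set set"
  where "strict_sets = {A. finite A \<and> 0 \<notin> A}"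

definition cmon :: "nat set \<Rightarrow> gamma"
  where "cmon A = (\<Prod>p\<in>A. cvar p)"

definition sqmon :: "nat set \<Rightarrow> (nat \<Rightarrow>\<^sub>0 nat)"
  where "sqmon A = (\<Sum>k\<in>{k. Suc k \<in> A}. Poly_Mapping.single k 1)"

lemma lookup_sqmon:
  assumes "finite A"
  shows "Poly_Mapping.lookup (sqmon A) k = (if Suc k \<in> A then 1 else 0)"
proof -
  have "finite {k. Suc k \<in> A}"
    using finite_vimageI[OF assms, of Suc] by (simp add: vimage_def)
  then show ?thesis
    by (simp add: sqmon_def lookup_sum lookup_single when_def)
qed

lemma sqfree_sqmon: "sqfree (sqmon A)"
proof (cases "finite A")
  case False
  \<comment> \<open>for infinite \<open>A\<close> the sum in \<open>sqmon A\<close> is \<open>0\<close> by convention\<close>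
  have "infinite {k. Suc k \<in> A}"
  proof
    assume "finite {k. Suc k \<in> A}"
    then have "finite (insert 0 (Suc ` {k. Suc k \<in> A}))" by simp
    moreover have "A \<subseteq> insert 0 (Suc ` {k. Suc k \<in> A})"
    proof
      fix p assume "p \<in> A"
      then show "p \<in> insert 0 (Suc ` {k. Suc k \<in> A})" by (cases p) auto
    qed
    ultimately show False using False finite_subset by blast
  qed
  then show ?thesis by (simp add: sqmon_def sqfree_def)
qed (simp add: sqfree_def lookup_sqmon)

lemma inj_on_sqmon:
  assumes "A \<in> strict_sets" "B \<in> strict_sets" "sqmon A = sqmon B"
  shows "A = B"
proof -
  have "Suc k \<in> A \<longleftrightarrow> Suc k \<in> B" for k
  proof -
    have "finite A" "finite B" using assms(1,2) by (simp_all add: strict_sets_def)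
    have "(if Suc k \<in> A then 1 else 0) = Poly_Mapping.lookup (sqmon A) k"
      using \<open>finite A\<close> by (rule lookup_sqmon[symmetric])
    also have "\<dots> = Poly_Mapping.lookup (sqmon B) k"
      by (simp only: assms(3))
    also have "\<dots> = (if Suc k \<in> B then 1 else 0)"
      using \<open>finite B\<close> by (rule lookup_sqmon)
    finally show ?thesis by (auto split: if_splits)
  qed
  moreover have "0 \<notin> A" "0 \<notin> B" using assms(1,2) by (simp_all add: strict_sets_def)
  ultimately show ?thesis by (intro set_eqI) (metis not0_implies_Suc)
qed

lemma sqfree_imp_sqmon:
  assumes "sqfree m"
  obtains A where "A \<in> strict_sets" "m = sqmon A"
proof
  show "Suc ` Poly_Mapping.keys m \<in> strict_sets" by (auto simp: strict_sets_def)
  show "m = sqmon (Suc ` Poly_Mapping.keys m)"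
  proof (rule poly_mapping_eqI)
    fix k
    have "Poly_Mapping.lookup m k < 2" using assms by (auto simp: sqfree_def)
    then show "Poly_Mapping.lookup m k = Poly_Mapping.lookup (sqmon (Suc ` Poly_Mapping.keys m)) k"
      by (auto simp: lookup_sqmon in_keys_iff inj_image_mem_iff)
  qed
qed

lemma cmon_eq_abs:
  assumes "A \<in> strict_sets"
  shows "cmon A = abs_gamma (Poly_Mapping.single (sqmon A) 1)"
proof -
  have prod: "Poly_Mapping.single (\<Sum>k\<in>K. Poly_Mapping.single k 1) 1 = (\<Prod>k\<in>K. Var k :: (nat, int) mpoly)" for K
  proof (induction K rule: infinite_finite_induct)
    case (insert k K)
    show ?case
      by (simp only: sum.insert[OF insert.hyps] prod.insert[OF insert.hyps] flip: insert.IH)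
         (simp add: Var_def mult_single)
  qed simp_all
  have "cmon A = (\<Prod>k\<in>{k. Suc k \<in> A}. cvar (Suc k))"
    unfolding cmon_def
  proof (rule prod.reindex_bij_witness[of _ Suc "\<lambda>p. p - 1"])
    fix p assume "p \<in> A"
    then have "p \<noteq> 0" using assms by (metis (mono_tags, lifting) strict_sets_def mem_Collect_eq)
    then show "Suc (p - 1) = p" "p - 1 \<in> {k. Suc k \<in> A}" "cvar (Suc (p - 1)) = cvar p"
      using \<open>p \<in> A\<close> by auto
  qed auto
  also have "\<dots> = abs_gamma (\<Prod>k\<in>{k. Suc k \<in> A}. Var k)"
    by (simp add: is_ring_hom_prod[OF is_ring_hom_abs_gamma] cvar.abs_eq cpoly_def)
  finally show ?thesis by (simp only: sqmon_def prod)
qed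

text \<open>The classes of the polynomials \<open>adapted m\<close> generate \<open>\<Gamma>\<close>; they vanish for \<open>m\<close> not square-free
  and are the products \<open>cmon A\<close> otherwise.\<close>
lemma gamma_span_induct [case_names zero add neg cmon]:
  assumes "P 0" "\<And>f g. P f \<Longrightarrow> P g \<Longrightarrow> P (f + g)" "\<And>f. P f \<Longrightarrow> P (- f)"
    and cmon: "\<And>A. A \<in> strict_sets \<Longrightarrow> P (cmon A)"
  shows "P (f :: gamma)"
proof -
  note hom = is_ring_homD[OF is_ring_hom_abs_gamma]
  have "P (abs_gamma g)" for g
  proof (rule adapted_span_induct[where f = g])
    fix m
    show "P (abs_gamma (adapted m))"
    proof (cases "sqfree m")
      case True
      then obtain A where "A \<in> strict_sets" "m = sqmon A" by (rule sqfree_imp_sqmon)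
      then show ?thesis using cmon True by (simp add: adapted_sqfree cmon_eq_abs)
    next
      case False
      then have "abs_gamma (adapted m) = abs_gamma 0"
        using adapted_in_gamma_ideal unfolding gamma.abs_eq_iff by (simp add: gamma_cong_def)
      then show ?thesis using assms(1) by (simp add: hom)
    qed
  qed (auto simp: hom intro: assms)
  from this[of "rep_gamma f"] show ?thesis by (simp add: Quotient_abs_rep[OF Quotient_gamma])
qed

lift_definition gcoef :: "nat set \<Rightarrow> gamma \<Rightarrow> int" is "\<lambda>A. nf_coeff_poly (sqmon A)"
proof -
  fix A f g assume "gamma_cong f g"
  then have "nf_coeff_poly (sqmon A) (f - g) = 0"
    by (intro nf_coeff_poly_gamma_ideal sqfree_sqmon) (simp add: gamma_cong_def)
  then show "nf_coeff_poly (sqmon A) f = nf_coeff_poly (sqmon A) g"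
    using additive.diff[OF additive_nf_coeff_poly] by simp
qed

lemma gcoef_cmon:
  assumes "A \<in> strict_sets" "B \<in> strict_sets"
  shows "gcoef A (cmon B) = (if B = A then 1 else 0)"
  using nf_coeff_poly_adapted[of "sqmon A" "sqmon B"] inj_on_sqmon[OF assms]
  by (auto simp: cmon_eq_abs[OF assms(2)] gcoef.abs_eq adapted_sqfree sqfree_sqmon)

lemma gcoef_add: "gcoef A (f + g) = gcoef A f + gcoef A g"
  by transfer (rule nf_coeff_poly_add)

lemma additive_gcoef: "additive (gcoef A)"
  by standard (rule gcoef_add)

lemma additive_of_int_mult:
  assumes "additive (\<phi> :: 'a::comm_ring_1 \<Rightarrow> 'b::comm_ring_1)"
  shows "\<phi> (of_int k * x) = of_int k * \<phi> x"
proof -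
  interpret additive \<phi> by (rule assms)
  show ?thesis
    by (induction k rule: int_induct[where k = 0])
       (simp_all add: zero distrib_right left_diff_distrib add diff)
qed

lemma gcoef_of_int_mult: "gcoef A (of_int k * f) = k * gcoef A f"
  using additive_of_int_mult[OF additive_gcoef] by simp

text \<open>All finite supersets of a support are admitted, so that the expansions of two elements can be
  added over a common index set.\<close>
definition expands :: "nat set set \<Rightarrow> gamma \<Rightarrow> bool"
  where "expands F f \<longleftrightarrow> finite F \<and> F \<subseteq> strict_sets \<and>
    (\<forall>G. finite G \<longrightarrow> F \<subseteq> G \<longrightarrow> G \<subseteq> strict_sets \<longrightarrow> (\<Sum>A\<in>G. of_int (gcoef A f) * cmon A) = f)"

lemma ex_expands: "\<exists>F. expands F f"
proof (induction f rule: gamma_span_induct)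
  case zero
  show ?case by (rule exI[of _ "{}"]) (simp add: expands_def additive.zero[OF additive_gcoef])
next
  case (add f g)
  then obtain F F' where "expands F f" "expands F' g" by blast
  then have "expands (F \<union> F') (f + g)"
    by (simp add: expands_def gcoef_add distrib_right sum.distrib)
  then show ?case by blast
next
  case (neg f)
  then obtain F where "expands F f" by blast
  then have "expands F (- f)"
    by (simp add: expands_def additive.minus[OF additive_gcoef] sum_negf)
  then show ?case by blast
next
  case (cmon B)
  have "(\<Sum>A\<in>G. of_int (gcoef A (cmon B)) * cmon A) = cmon B"
    if G: "finite G" "{B} \<subseteq> G" "G \<subseteq> strict_sets" for G
  proof -
    have "(\<Sum>A\<in>G. of_int (gcoef A (cmon B)) * cmon A) = (\<Sum>A\<in>G. if B = A then cmon A else 0)"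
    proof (rule sum.cong)
      fix A assume "A \<in> G"
      then have "gcoef A (cmon B) = (if B = A then 1 else 0)"
        using G cmon by (intro gcoef_cmon) auto
      then show "of_int (gcoef A (cmon B)) * cmon A = (if B = A then cmon A else 0)" by simp
    qed simp
    then show ?thesis using G by simp
  qed
  then have "expands {B} (cmon B)" using cmon by (simp add: expands_def)
  then show ?case by blast
qed

lemma gamma_expansion:
  obtains F where "finite F" "F \<subseteq> strict_sets" "f = (\<Sum>A\<in>F. of_int (gcoef A f) * cmon A)"
proof -
  obtain F where "expands F f" using ex_expands by blast
  then show ?thesis by (intro that[of F]) (simp_all add: expands_def)
qed

lemma gamma_eqI:
  assumes "\<And>A. A \<in> strict_sets \<Longrightarrow> gcoef A f = gcoef A g"
  shows "f = g"
proof -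
  obtain F where F: "finite F" "F \<subseteq> strict_sets" "f - g = (\<Sum>A\<in>F. of_int (gcoef A (f - g)) * cmon A)"
    by (rule gamma_expansion[of "f - g"])
  have "(\<Sum>A\<in>F. of_int (gcoef A (f - g)) * cmon A) = 0"
  proof (rule sum.neutral, rule ballI)
    fix A assume "A \<in> F"
    with F(2) assms have "gcoef A f = gcoef A g" by blast
    then show "of_int (gcoef A (f - g)) * cmon A = 0"
      by (simp add: additive.diff[OF additive_gcoef])
  qed
  with F(3) show ?thesis by simp
qed

lemma gamma_torsion_free: "of_int k * f = (0 :: gamma) \<Longrightarrow> k \<noteq> 0 \<Longrightarrow> f = 0"
  by (rule gamma_eqI) (metis gcoef_of_int_mult additive.zero[OF additive_gcoef] mult_eq_0_iff)

section \<open>Divided differences on \<open>\<Gamma>[X,Y]\<close>\<close>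
lemma lookup_single_mult:
  fixes f :: "('v, 'r::comm_ring_1) mpoly"
  shows "Poly_Mapping.lookup (Poly_Mapping.single a c * f) (a + m) = c * Poly_Mapping.lookup f m"
proof -
  have "Poly_Mapping.single a c * f =
      (\<Sum>m'\<in>Poly_Mapping.keys f. Poly_Mapping.single (a + m') (c * Poly_Mapping.lookup f m'))"
    by (subst mpoly_sum_monoms[of f]) (simp add: sum_distrib_left mult_single)
  then show ?thesis
    by (simp add: lookup_sum lookup_single when_def in_keys_iff)
qed

lemma lookup_single_mult_eq_0:
  fixes f :: "('v, 'r::comm_ring_1) mpoly"
  assumes "\<And>m'. m \<noteq> a + m'"
  shows "Poly_Mapping.lookup (Poly_Mapping.single a c * f) m = 0"
proof -
  have "Poly_Mapping.single a c * f =
      (\<Sum>m'\<in>Poly_Mapping.keys f. Poly_Mapping.single (a + m') (c * Poly_Mapping.lookup f m'))"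
    by (subst mpoly_sum_monoms[of f]) (simp add: sum_distrib_left mult_single)
  then show ?thesis
    using assms[symmetric] by (simp add: lookup_sum lookup_single_not_eq)
qed

lemma gammaXY_torsion_free:
  assumes "of_int k * f = (0 :: gammaXY)" "k \<noteq> 0"
  shows "f = 0"
proof (rule poly_mapping_eqI)
  fix m
  have "of_int k * f = Poly_Mapping.single 0 (of_int k) * f"
    by simp
  then have "of_int k * Poly_Mapping.lookup f m = Poly_Mapping.lookup (of_int k * f) m"
    using lookup_single_mult[of 0 "of_int k" f m] by simp
  also have "\<dots> = 0" using assms by simp
  finally show "Poly_Mapping.lookup f m = Poly_Mapping.lookup 0 m"
    using gamma_torsion_free assms(2) by simp
qed

definition denom :: "nat \<Rightarrow> gammaXY"
  where "denom i = (if i = 0 then - 2 * xvar 1 else xvar i - xvar (i + 1))"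

lemma Var_mult_cancel:
  assumes "Var v * g = (0 :: ('v, 'r::comm_ring_1) mpoly)"
  shows "g = 0"
proof (rule poly_mapping_eqI)
  fix m
  show "Poly_Mapping.lookup g m = Poly_Mapping.lookup 0 m"
    using lookup_single_mult[of "Poly_Mapping.single v 1" 1 g m] assms by (simp add: Var_def)
qed

text \<open>If \<open>x g = x' g\<close> then the coefficient of \<open>m\<close> in \<open>g\<close> equals the coefficient of \<open>m x / x'\<close>; after
  finitely many steps the exponent of \<open>x'\<close> is exhausted. This argument is valid over any
  coefficient ring, zero divisors included.\<close>
lemma Var_diff_mult_cancel:
  assumes eq: "(Var v - Var v') * g = (0 :: ('v, 'r::comm_ring_1) mpoly)" and "v \<noteq> v'"
  shows "g = 0"
proof (rule poly_mapping_eqI)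
  define e where "e = Poly_Mapping.single v (1::nat)"
  define e' where "e' = Poly_Mapping.single v' (1::nat)"
  have *: "Poly_Mapping.single e 1 * g = Poly_Mapping.single e' 1 * g"
    using eq by (simp add: Var_def left_diff_distrib e_def e'_def)
  fix m
  have "Poly_Mapping.lookup g m = 0"
  proof (induction "Poly_Mapping.lookup m v'" arbitrary: m)
    case 0
    have "e + m \<noteq> e' + m'" for m'
    proof
      assume "e + m = e' + m'"
      then have "Poly_Mapping.lookup (e + m) v' = Poly_Mapping.lookup (e' + m') v'" by simp
      then show False using 0 assms(2) by (simp add: lookup_add e_def e'_def lookup_single)
    qed
    then have "Poly_Mapping.lookup (Poly_Mapping.single e' 1 * g) (e + m) = 0"
      by (rule lookup_single_mult_eq_0)
    then show ?case using lookup_single_mult[of e 1 g m] unfolding * by simp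
  next
    case (Suc k)
    define m1 where "m1 = m - e'"
    have m: "m = e' + m1"
      by (rule poly_mapping_eqI) (use Suc(2) in \<open>auto simp: m1_def e'_def lookup_add lookup_minus lookup_single when_def\<close>)
    have "Poly_Mapping.lookup (e + m1) v' = k"
      using Suc(2) assms(2) by (simp add: m lookup_add e_def e'_def lookup_single)
    then have "Poly_Mapping.lookup g (e + m1) = 0" using Suc(1) by blast
    moreover have "Poly_Mapping.lookup g m = Poly_Mapping.lookup (Poly_Mapping.single e' 1 * g) (e + m)"
      using lookup_single_mult[of e 1 g m] unfolding * by simp
    moreover have "\<dots> = Poly_Mapping.lookup g (e + m1)"
      using lookup_single_mult[of e' 1 g "e + m1"] by (simp add: m add_ac)
    ultimately show ?case by simp
  qed
  then show "Poly_Mapping.lookup g m = Poly_Mapping.lookup 0 m" by simp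
qed

lemma denom_cancel:
  assumes "denom i * g = 0"
  shows "g = 0"
proof (cases "i = 0")
  case True
  then have "of_int (- 2) * (Var (XV 0) * g) = 0"
    using assms by (simp add: denom_def xvar_def mult.assoc)
  then show ?thesis using gammaXY_torsion_free Var_mult_cancel by (metis neg_equal_0_iff_equal zero_neq_numeral)
next
  case False
  then have "(Var (XV (i - 1)) - Var (XV i)) * g = 0"
    using assms by (simp add: denom_def xvar_def)
  then show ?thesis by (rule Var_diff_mult_cancel) (use False in auto)
qed

text \<open>The polynomials of degree at most \<open>d\<close> in the variables \<open>V\<close>, where \<open>c\<^sub>p\<close> has degree \<open>p\<close> and each
  variable has degree \<open>1\<close>. The inductive form turns the Leibniz rule into a proof that divided
  differences exist, lower the degree and stay within \<open>V\<close>.\<close>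
inductive Fil :: "xyvar set \<Rightarrow> nat \<Rightarrow> gammaXY \<Rightarrow> bool" for V where
  Fil_of_int: "Fil V d (of_int k)"
| Fil_add: "Fil V d f \<Longrightarrow> Fil V d g \<Longrightarrow> Fil V d (f + g)"
| Fil_mult_c: "Fil V d f \<Longrightarrow> Fil V (d + p) (f * Const (cvar p))"
| Fil_mult_Var: "Fil V d f \<Longrightarrow> v \<in> V \<Longrightarrow> Fil V (d + 1) (f * Var v)"

lemma Fil_mono: "Fil V d f \<Longrightarrow> V \<subseteq> V' \<Longrightarrow> Fil V' (d + k) f"
proof (induction rule: Fil.induct)
  case (Fil_mult_c d f p)
  then show ?case using Fil.Fil_mult_c[of V' "d + k" f p] by (simp add: ac_simps)
next
  case (Fil_mult_Var d f v)
  then show ?case using Fil.Fil_mult_Var[of V' "d + k" f v] by (auto simp: ac_simps)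
qed (auto intro: Fil.intros)

lemma Fil_mono_degree: "Fil V d f \<Longrightarrow> d \<le> e \<Longrightarrow> Fil V e f"
  using Fil_mono[of V d f V "e - d"] by simp

lemma Fil_0: "Fil V d 0"
  using Fil_of_int[of V d 0] by simp

lemma Fil_1: "Fil V d 1"
  using Fil_of_int[of V d 1] by simp

lemma Fil_c: "Fil V p (Const (cvar p))"
  using Fil_mult_c[OF Fil_1, of V 0 p] by simp

lemma Fil_Var: "v \<in> V \<Longrightarrow> Fil V 1 (Var v)"
  using Fil_mult_Var[OF Fil_1, of v V 0] by simp

lemma Fil_mult_of_int: "Fil V d f \<Longrightarrow> Fil V d (of_int k * f)"
proof (induction rule: Fil.induct)
  case (Fil_of_int d j)
  then show ?case using Fil.Fil_of_int[of V d "k * j"] by simp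
next
  case (Fil_add d f g)
  then show ?case using Fil.Fil_add by (simp add: distrib_left)
qed (simp_all only: mult.assoc[symmetric] Fil.intros)

lemma Fil_mult:
  assumes f: "Fil V d f" shows "Fil V e g \<Longrightarrow> Fil V (d + e) (f * g)"
proof (induction e g rule: Fil.induct)
  case (Fil_of_int d' k)
  have "Fil V (d + d') f" using Fil_mono_degree[OF f] by simp
  from Fil_mult_of_int[OF this, of k] show ?case by (simp only: mult.commute)
next
  case (Fil_add d' g h)
  then show ?case using Fil.Fil_add by (simp add: distrib_left)
next
  case (Fil_mult_c d' g p)
  then show ?case using Fil.Fil_mult_c[of V "d + d'" "f * g" p] by (simp add: ac_simps)
next
  case (Fil_mult_Var d' g v)
  then show ?case using Fil.Fil_mult_Var[of V "d + d'" "f * g" v] by (simp add: ac_simps)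
qed

lemma Fil_uminus: "Fil V d f \<Longrightarrow> Fil V d (- f)"
  using Fil_mult_of_int[of V d f "- 1"] by simp

lemma Fil_sum: "(\<And>i. i \<in> I \<Longrightarrow> Fil V d (f i)) \<Longrightarrow> Fil V d (sum f I)"
  by (induction I rule: infinite_finite_induct) (auto intro: Fil_0 Fil_add)

lemma Fil_power: "Fil V d f \<Longrightarrow> Fil V (n * d) (f ^ n)"
  by (induction n) (auto intro: Fil_1 Fil_mult)

definition GammaV :: "xyvar set \<Rightarrow> gammaXY set"
  where "GammaV V = {f. \<exists>d. Fil V d f}"

lemma GammaV_add: "f \<in> GammaV V \<Longrightarrow> g \<in> GammaV V \<Longrightarrow> f + g \<in> GammaV V"
proof -
  assume "f \<in> GammaV V" "g \<in> GammaV V"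
  then obtain d e where "Fil V d f" "Fil V e g" by (auto simp: GammaV_def)
  then have "Fil V (max d e) (f + g)" by (intro Fil_add) (auto elim: Fil_mono_degree)
  then show ?thesis by (auto simp: GammaV_def)
qed

lemma GammaV_mult: "f \<in> GammaV V \<Longrightarrow> g \<in> GammaV V \<Longrightarrow> f * g \<in> GammaV V"
  unfolding GammaV_def using Fil_mult by blast

lemma GammaV_of_int: "of_int k \<in> GammaV V"
  unfolding GammaV_def using Fil_of_int by blast

lemma GammaV_0: "0 \<in> GammaV V" and GammaV_1: "1 \<in> GammaV V"
  using GammaV_of_int[of 0 V] GammaV_of_int[of 1 V] by simp_all

lemma GammaV_uminus: "f \<in> GammaV V \<Longrightarrow> - f \<in> GammaV V"
  unfolding GammaV_def using Fil_uminus by blast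

lemma GammaV_diff: "f \<in> GammaV V \<Longrightarrow> g \<in> GammaV V \<Longrightarrow> f - g \<in> GammaV V"
  using GammaV_add[of f V "- g"] GammaV_uminus[of g V] by simp

lemma GammaV_c: "Const (cvar p) \<in> GammaV V"
  unfolding GammaV_def using Fil_c by blast

lemma GammaV_Var: "v \<in> V \<Longrightarrow> Var v \<in> GammaV V"
  unfolding GammaV_def using Fil_Var by blast

lemma GammaV_sum: "(\<And>i. i \<in> I \<Longrightarrow> f i \<in> GammaV V) \<Longrightarrow> sum f I \<in> GammaV V"
  by (induction I rule: infinite_finite_induct) (auto intro: GammaV_0 GammaV_add)

lemma GammaV_prod: "(\<And>i. i \<in> I \<Longrightarrow> f i \<in> GammaV V) \<Longrightarrow> prod f I \<in> GammaV V"
  by (induction I rule: infinite_finite_induct) (auto intro: GammaV_1 GammaV_mult)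

lemma GammaV_power: "f \<in> GammaV V \<Longrightarrow> f ^ n \<in> GammaV V"
  by (induction n) (auto intro: GammaV_1 GammaV_mult)

lemma GammaV_mono: "V \<subseteq> V' \<Longrightarrow> GammaV V \<subseteq> GammaV V'"
  unfolding GammaV_def using Fil_mono[of V _ _ V' 0] by auto

lemma Const_in_GammaV: "Const a \<in> GammaV V"
proof (induction a rule: gamma_span_induct)
  case (cmon A)
  show ?case unfolding cmon_def is_ring_hom_prod[OF is_ring_hom_Const]
    by (intro GammaV_prod GammaV_c)
qed (auto simp: is_ring_homD[OF is_ring_hom_Const] intro: GammaV_0 GammaV_add GammaV_uminus)

lemma single_eq_Const_mult_prod:
  "Poly_Mapping.single m a = Const a * (\<Prod>v\<in>Poly_Mapping.keys m. Var v ^ Poly_Mapping.lookup m v)"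
proof -
  have pow: "Var v ^ n = Poly_Mapping.single (Poly_Mapping.single v n) (1 :: 'b)" for v :: 'a and n
    by (induction n) (simp_all add: Var_def mult_single flip: single_add)
  have "(\<Prod>v\<in>K. Var v ^ Poly_Mapping.lookup m v) =
      Poly_Mapping.single (\<Sum>v\<in>K. Poly_Mapping.single v (Poly_Mapping.lookup m v)) (1 :: 'b)" for K
    by (induction K rule: infinite_finite_induct) (simp_all add: pow mult_single)
  then show ?thesis
    by (simp add: Const_def mult_single flip: poly_mapping_sum_single)
qed

lemma mem_GammaV_iff: "f \<in> GammaV V \<longleftrightarrow> (\<forall>m\<in>Poly_Mapping.keys f. Poly_Mapping.keys m \<subseteq> V)"
proof
  assume "f \<in> GammaV V"
  then obtain d where "Fil V d f" by (auto simp: GammaV_def)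
  then show "\<forall>m\<in>Poly_Mapping.keys f. Poly_Mapping.keys m \<subseteq> V"
  proof (induction rule: Fil.induct)
    case (Fil_of_int d k)
    have "of_int k = (Poly_Mapping.single 0 (of_int k) :: gammaXY)" by simp
    then have "Poly_Mapping.keys (of_int k :: gammaXY) \<subseteq> {0}" by (metis keys_single subset_insertI empty_subsetI subset_refl)
    then show ?case by auto
  next
    case (Fil_add d f g)
    then show ?case using keys_add[of f g] by blast
  next
    case (Fil_mult_c d f p)
    have "Poly_Mapping.keys (Const (cvar p) :: gammaXY) \<subseteq> {0}" by (simp add: Const_def)
    then show ?case using keys_mult[of f "Const (cvar p)"] Fil_mult_c.IH by fastforce
  next
    case (Fil_mult_Var d f v)
    have "Poly_Mapping.keys (Var v :: gammaXY) \<subseteq> {Poly_Mapping.single v 1}" by (simp add: Var_def)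
    moreover have "Poly_Mapping.keys (m + Poly_Mapping.single v 1) \<subseteq> V" if "Poly_Mapping.keys m \<subseteq> V" for m :: "xyvar \<Rightarrow>\<^sub>0 nat"
    proof -
      have "Poly_Mapping.keys (Poly_Mapping.single v (1::nat)) \<subseteq> V"
        using Fil_mult_Var.hyps by simp
      with that keys_add[of m "Poly_Mapping.single v 1"] show ?thesis by blast
    qed
    ultimately show ?case using keys_mult[of f "Var v"] Fil_mult_Var.IH by fastforce
  qed
next
  assume *: "\<forall>m\<in>Poly_Mapping.keys f. Poly_Mapping.keys m \<subseteq> V"
  have "(\<Sum>m\<in>Poly_Mapping.keys f. Poly_Mapping.single m (Poly_Mapping.lookup f m)) \<in> GammaV V"
    unfolding single_eq_Const_mult_prod
  proof (rule GammaV_sum, rule GammaV_mult, rule Const_in_GammaV, rule GammaV_prod, rule GammaV_power, rule GammaV_Var)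
    fix m v assume "m \<in> Poly_Mapping.keys f" "v \<in> Poly_Mapping.keys m"
    then show "v \<in> V" using * by (meson subsetD)
  qed
  then show "f \<in> GammaV V" by (simp flip: mpoly_sum_monoms)
qed

lemma GammaX_eq_GammaV: "GammaX n = GammaV (XV ` {..<n})"
  unfolding GammaX_def by (rule set_eqI) (simp only: mem_GammaV_iff mem_Collect_eq)

lemma GammaV_UNIV: "f \<in> GammaV UNIV"
  by (simp add: mem_GammaV_iff)

text \<open>The ring \<open>\<Gamma>[V]\<close> is generated by the \<open>c\<^sub>p\<close> and the variables in \<open>V\<close>.\<close>
lemma GammaV_hom_eq:
  fixes \<phi> \<psi> :: "gammaXY \<Rightarrow> 'a::comm_ring_1"
  assumes "f \<in> GammaV V" and hom: "is_ring_hom \<phi>" "is_ring_hom \<psi>"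
    and c: "\<And>p. \<phi> (Const (cvar p)) = \<psi> (Const (cvar p))"
    and v: "\<And>v. v \<in> V \<Longrightarrow> \<phi> (Var v) = \<psi> (Var v)"
  shows "\<phi> f = \<psi> f"
proof -
  obtain d where "Fil V d f" using assms(1) by (auto simp: GammaV_def)
  then show ?thesis
    by (induction rule: Fil.induct)
       (simp_all add: is_ring_homD[OF hom(1)] is_ring_homD[OF hom(2)] is_ring_hom_of_int_commute hom c v)
qed

lemma GammaV_hom_image:
  assumes "f \<in> GammaV V" and hom: "is_ring_hom \<phi>"
    and "\<And>p. \<phi> (Const (cvar p)) \<in> GammaV V'" "\<And>v. v \<in> V \<Longrightarrow> \<phi> (Var v) \<in> GammaV V'"
  shows "\<phi> f \<in> GammaV V'"
proof -
  obtain d where "Fil V d f" using assms(1) by (auto simp: GammaV_def)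
  then show ?thesis
    by (induction rule: Fil.induct)
       (auto simp: is_ring_homD[OF hom] is_ring_hom_of_int_commute hom intro!: assms GammaV_of_int GammaV_add GammaV_mult)
qed

lemma is_ring_hom_comp: "is_ring_hom \<phi> \<Longrightarrow> is_ring_hom \<psi> \<Longrightarrow> is_ring_hom (\<lambda>x. \<phi> (\<psi> x))"
  by (simp add: is_ring_hom_def)

lemma act_Var: "act i (Var v) =
    (if i = 0 then if v = XV 0 then - Var v else Var v
     else if v = XV (i - 1) then Var (XV i) else if v = XV i then Var (XV (i - 1)) else Var v)"
  by (simp add: act_def mpoly_subst_Var is_ring_hom_s0_gamma is_ring_hom_Const)

lemma act_denom: "act i (denom i) = - denom i"
  using is_ring_homD[OF is_ring_hom_act[of i]]
  by (auto simp: denom_def xvar_def act_Var)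

text \<open>The variables in the denominator of \<open>\<partial>\<^sub>i\<close>: a set of variables containing them is respected by
  \<open>s\<^sub>i\<close> and \<open>\<partial>\<^sub>i\<close>.\<close>
definition moved :: "nat \<Rightarrow> xyvar set"
  where "moved i = (if i = 0 then {XV 0} else {XV (i - 1), XV i})"

lemma act_c_eq_s0_c: "act 0 (Const (cvar p)) = s0_c (\<lambda>p. Const (cvar p)) (xvar 1) p"
  unfolding act_0_c s0_c_def ..

lemma Fil_act_c:
  assumes "moved i \<subseteq> V" shows "Fil V p (act i (Const (cvar p)))"
proof (cases "i = 0")
  case True
  then have x: "XV 0 \<in> V" using assms by (simp add: moved_def)
  have "Fil V p (xvar 1 ^ j * Const (cvar (p - j)))" if "j \<in> {1..p}" for j
    using Fil_mult[OF Fil_power[OF Fil_Var[OF x], of j] Fil_c[of V "p - j"]] that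
    by (simp add: xvar_def)
  then have "Fil V p (of_int 2 * (\<Sum>j=1..p. xvar 1 ^ j * Const (cvar (p - j))))"
    by (intro Fil_mult_of_int Fil_sum)
  then show ?thesis using True Fil_add Fil_c by (auto simp: act_0_c)
qed (simp add: act_Suc_c Fil_c)

lemma Fil_act_Var:
  assumes "moved i \<subseteq> V" "v \<in> V" shows "Fil V 1 (act i (Var v))"
  using assms by (auto simp: act_Var moved_def simp del: One_nat_def intro!: Fil_uminus Fil_Var)

lemma ex_quotient_c:
  assumes "moved i \<subseteq> V"
  shows "\<exists>h. Fil V (p - 1) h \<and> (p = 0 \<longrightarrow> h = 0) \<and>
    denom i * h = Const (cvar p) - act i (Const (cvar p))"
proof (cases "i = 0")
  case True
  let ?h = "\<Sum>j=1..p. xvar 1 ^ (j - 1) * Const (cvar (p - j))"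
  have x: "XV 0 \<in> V" using True assms by (simp add: moved_def)
  have "Fil V (p - 1) (xvar 1 ^ (j - 1) * Const (cvar (p - j)))" if "j \<in> {1..p}" for j
    using Fil_mult[OF Fil_power[OF Fil_Var[OF x], of "j - 1"] Fil_c[of V "p - j"]] that
    by (simp add: xvar_def)
  then have "Fil V (p - 1) ?h" by (rule Fil_sum)
  moreover have "xvar 1 * ?h = (\<Sum>j=1..p. xvar 1 ^ j * Const (cvar (p - j)))"
    unfolding sum_distrib_left
    by (intro sum.cong) (auto simp: mult.assoc[symmetric] simp flip: power_Suc)
  ultimately show ?thesis
    using True by (intro exI[of _ ?h]) (simp add: denom_def act_0_c mult.assoc)
qed (auto simp: act_Suc_c intro!: exI[of _ 0] Fil_0)

lemma ex_quotient_Var: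
  "\<exists>h. Fil V 0 h \<and> denom i * h = Var v - act i (Var v)"
proof -
  consider "act i (Var v) = Var v" | "i = 0" "v = XV 0" | "i \<noteq> 0" "v = XV (i - 1)" | "i \<noteq> 0" "v = XV i"
    unfolding act_Var by metis
  then show ?thesis
  proof cases
    case 1
    then show ?thesis by (intro exI[of _ 0]) (simp add: Fil_0)
  next
    case 2
    then show ?thesis
      by (intro exI[of _ "- 1"]) (simp add: Fil_uminus Fil_1 act_Var denom_def xvar_def)
  next
    case 3
    then show ?thesis
      by (intro exI[of _ 1]) (simp add: Fil_1 act_Var denom_def xvar_def)
  next
    case 4
    then show ?thesis
      by (intro exI[of _ "- 1"]) (simp add: Fil_uminus Fil_1 act_Var denom_def xvar_def)
  qed
qed

text \<open>The twisted Leibniz rule \<open>\<partial>\<^sub>i(f u) = \<partial>\<^sub>i f \<cdot> s\<^sub>i u + f \<cdot> \<partial>\<^sub>i u\<close>. The cases of degree \<open>0\<close> are separate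
  because \<open>d - 1\<close> is truncated: there the quotient vanishes.\<close>
lemma ex_quotient_mult:
  assumes g: "Fil V (d - 1) g" "d = 0 \<longrightarrow> g = 0" "denom i * g = f - act i f"
    and h: "Fil V (p - 1) h" "p = 0 \<longrightarrow> h = 0" "denom i * h = u - act i u"
    and f: "Fil V d f" and u: "Fil V p (act i u)"
  shows "\<exists>q. Fil V (d + p - 1) q \<and> (d + p = 0 \<longrightarrow> q = 0) \<and> denom i * q = f * u - act i (f * u)"
proof (intro exI conjI)
  have "Fil V (d + p - 1) (g * act i u)"
  proof (cases "d = 0")
    case False
    then show ?thesis using Fil_mult[OF g(1) u] by simp
  qed (use g in \<open>simp add: Fil_0\<close>)
  moreover have "Fil V (d + p - 1) (f * h)"
  proof (cases "p = 0")
    case False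
    then show ?thesis using Fil_mult[OF f h(1)] by simp
  qed (use h in \<open>simp add: Fil_0\<close>)
  ultimately show "Fil V (d + p - 1) (g * act i u + f * h)" by (rule Fil_add)
  show "d + p = 0 \<longrightarrow> g * act i u + f * h = 0" using g h by simp
  have "denom i * (g * act i u + f * h) = (denom i * g) * act i u + f * (denom i * h)"
    by (simp add: algebra_simps)
  also have "\<dots> = f * u - act i (f * u)"
    unfolding g(3) h(3) is_ring_homD(3)[OF is_ring_hom_act] by (simp add: algebra_simps)
  finally show "denom i * (g * act i u + f * h) = f * u - act i (f * u)" .
qed

lemma ex_quotient:
  assumes "Fil V d f" "moved i \<subseteq> V"
  shows "\<exists>g. Fil V (d - 1) g \<and> (d = 0 \<longrightarrow> g = 0) \<and> denom i * g = f - act i f"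
  using assms
proof (induction rule: Fil.induct)
  case (Fil_of_int d k)
  show ?case by (intro exI[of _ 0]) (simp add: Fil_0 is_ring_hom_of_int_commute is_ring_hom_act)
next
  case (Fil_add d f g)
  then obtain a b where "Fil V (d - 1) a" "d = 0 \<longrightarrow> a = 0" "denom i * a = f - act i f"
    "Fil V (d - 1) b" "d = 0 \<longrightarrow> b = 0" "denom i * b = g - act i g" by blast
  then show ?case
    by (intro exI[of _ "a + b"])
       (simp add: Fil.Fil_add distrib_left is_ring_homD[OF is_ring_hom_act])
next
  case (Fil_mult_c d f p)
  then obtain g where "Fil V (d - 1) g" "d = 0 \<longrightarrow> g = 0" "denom i * g = f - act i f" by blast
  moreover obtain h where "Fil V (p - 1) h" "p = 0 \<longrightarrow> h = 0"
    "denom i * h = Const (cvar p) - act i (Const (cvar p))"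
    using ex_quotient_c[OF Fil_mult_c.prems] by blast
  ultimately show ?case
    using Fil_mult_c.hyps Fil_act_c[OF Fil_mult_c.prems] by (rule ex_quotient_mult)
next
  case (Fil_mult_Var d f v)
  then obtain g where "Fil V (d - 1) g" "d = 0 \<longrightarrow> g = 0" "denom i * g = f - act i f" by blast
  moreover obtain h where "Fil V (1 - 1) h" "(1::nat) = 0 \<longrightarrow> h = 0"
    "denom i * h = Var v - act i (Var v)"
    using ex_quotient_Var[of V i v] by auto
  ultimately show ?case
    using Fil_mult_Var.hyps(1) Fil_act_Var[OF Fil_mult_Var.prems Fil_mult_Var.hyps(2)] by (rule ex_quotient_mult)
qed

lemma ddx_eqI: "denom i * g = f - act i f \<Longrightarrow> ddx i f = g"
  unfolding ddx_def denom_def[symmetric]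
proof (rule the_equality)
  fix g' assume "denom i * g = f - act i f" "denom i * g' = f - act i f"
  then have "denom i * (g' - g) = 0" by (simp add: right_diff_distrib)
  then show "g' = g" using denom_cancel by fastforce
qed

lemma denom_mult_ddx: "denom i * ddx i f = f - act i f"
proof -
  obtain d where "Fil UNIV d f" using GammaV_UNIV[of f] by (auto simp: GammaV_def)
  then obtain g where "denom i * g = f - act i f" using ex_quotient[of UNIV d f i] by auto
  then show ?thesis using ddx_eqI by metis
qed

lemma Fil_ddx:
  assumes "Fil V d f" "moved i \<subseteq> V"
  shows "Fil V (d - 1) (ddx i f)" and "d = 0 \<Longrightarrow> ddx i f = 0"
proof -
  obtain g where g: "Fil V (d - 1) g" "d = 0 \<longrightarrow> g = 0" "denom i * g = f - act i f"
    using ex_quotient[OF assms] by blast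
  from ddx_eqI[OF g(3)] g(1,2) show "Fil V (d - 1) (ddx i f)" and "d = 0 \<Longrightarrow> ddx i f = 0"
    by simp_all
qed

lemma additive_ddx: "additive (ddx i)"
proof
  fix f g
  show "ddx i (f + g) = ddx i f + ddx i g"
    by (rule ddx_eqI) (simp only: distrib_left denom_mult_ddx is_ring_homD(2)[OF is_ring_hom_act] add_diff_add)
qed

lemmas ddx_0 = additive.zero[OF additive_ddx]
  and ddx_diff = additive.diff[OF additive_ddx]
  and ddx_sum = additive.sum[OF additive_ddx]
  and ddx_of_int_mult = additive_of_int_mult[OF additive_ddx]

lemma ddx_eq_0_iff: "ddx i f = 0 \<longleftrightarrow> act i f = f"
  using denom_mult_ddx[of i f] denom_cancel[of i "ddx i f"] by auto

context
  includes fps_syntax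
begin

lemma one_minus_mult_geometric:
  "(1 + fps_const (- z) * fps_X) * Abs_fps (\<lambda>n. z ^ n) = (1 :: 'a::comm_ring_1 fps)"
proof (rule fps_ext)
  fix n
  show "((1 + fps_const (- z) * fps_X) * Abs_fps (\<lambda>n. z ^ n)) $ n = (1 :: 'a fps) $ n"
    unfolding one_plus_fps_X_mult_nth by (cases n) simp_all
qed

text \<open>On generating functions \<open>s\<^sub>0\<close> is multiplication by \<open>(1 + z t) / (1 - z t)\<close>, which makes it evident
  that such substitutions commute and that \<open>-z\<close> undoes \<open>z\<close>.\<close>
lemma fps_s0_c:
  fixes c :: "nat \<Rightarrow> 'a::comm_ring_1"
  shows "Abs_fps (s0_c c z) = (1 + fps_const z * fps_X) * Abs_fps (\<lambda>n. z ^ n) * Abs_fps c"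
proof -
  define u where "u n = (if n = 0 then 1 else 2 * z ^ n)" for n
  have "(1 + fps_const z * fps_X) * Abs_fps (\<lambda>n. z ^ n) = Abs_fps u"
  proof (rule fps_ext)
    fix n
    show "((1 + fps_const z * fps_X) * Abs_fps (\<lambda>n. z ^ n)) $ n = Abs_fps u $ n"
      unfolding one_plus_fps_X_mult_nth u_def by (cases n) simp_all
  qed
  moreover have "Abs_fps (s0_c c z) = Abs_fps u * Abs_fps c"
  proof (rule fps_ext)
    fix n
    have "(Abs_fps u * Abs_fps c) $ n = (\<Sum>j=0..n. u j * c (n - j))"
      by (simp add: fps_mult_nth)
    also have "\<dots> = c n + (\<Sum>j=1..n. 2 * (z ^ j * c (n - j)))"
      by (simp add: sum.atLeast_Suc_atMost[of 0] u_def mult.assoc)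
    finally show "Abs_fps (s0_c c z) $ n = (Abs_fps u * Abs_fps c) $ n"
      by (simp add: s0_c_def sum_distrib_left)
  qed
  ultimately show ?thesis by simp
qed

lemma s0_c_commute: "s0_c (s0_c c a) b = s0_c (s0_c c b) (a :: 'a::comm_ring_1)"
proof -
  have "Abs_fps (s0_c (s0_c c a) b) = Abs_fps (s0_c (s0_c c b) a)"
    unfolding fps_s0_c by (simp only: mult_ac)
  then show ?thesis by (metis fps_nth_Abs_fps ext)
qed

lemma s0_c_inverse: "s0_c (s0_c c z) (- z) = (c :: nat \<Rightarrow> 'a::comm_ring_1)"
proof -
  have "Abs_fps (s0_c (s0_c c z) (- z)) =
      ((1 + fps_const (- z) * fps_X) * Abs_fps (\<lambda>n. z ^ n)) *
      ((1 + fps_const (- (- z)) * fps_X) * Abs_fps (\<lambda>n. (- z) ^ n)) * Abs_fps c"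
    unfolding fps_s0_c minus_minus by (simp only: mult_ac)
  then have "Abs_fps (s0_c (s0_c c z) (- z)) = Abs_fps c"
    unfolding one_minus_mult_geometric by simp
  then show ?thesis by (metis fps_nth_Abs_fps ext)
qed

end

lemma hom_s0_c:
  assumes hom: "is_ring_hom \<phi>"
  shows "\<phi> (s0_c c z p) = s0_c (\<lambda>k. \<phi> (c k)) (\<phi> z) p"
  by (simp add: s0_c_def is_ring_homD[OF hom])

lemma act_act: "act i (act i f) = f"
proof (rule GammaV_hom_eq[OF GammaV_UNIV is_ring_hom_comp[OF is_ring_hom_act is_ring_hom_act] is_ring_hom_id])
  fix p
  show "act i (act i (Const (cvar p))) = Const (cvar p)"
  proof (cases "i = 0")
    case True
    then show ?thesis
      by (simp add: act_c_eq_s0_c[abs_def] hom_s0_c[OF is_ring_hom_act] act_0_x s0_c_inverse)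
  qed (simp add: act_Suc_c)
next
  fix v show "act i (act i (Var v)) = Var v"
    by (auto simp: act_Var is_ring_homD[OF is_ring_hom_act])
qed

lemma act_ddx: "act i (ddx i f) = ddx i f"
proof -
  have "act i (denom i * ddx i f) = act i (f - act i f)" by (simp only: denom_mult_ddx)
  then have "- (denom i * act i (ddx i f)) = act i f - f"
    by (simp add: is_ring_homD[OF is_ring_hom_act] act_act act_denom)
  then have "denom i * act i (ddx i f) = f - act i f"
    by (metis minus_diff_eq minus_minus)
  then show ?thesis using ddx_eqI by metis
qed

lemma ddx_ddx: "ddx i (ddx i f) = 0"
  by (simp add: ddx_eq_0_iff act_ddx)

lemma GammaX_mono: "n \<le> n' \<Longrightarrow> GammaX n \<subseteq> GammaX n'"
  unfolding GammaX_eq_GammaV by (rule GammaV_mono) auto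

lemma act_GammaX: "f \<in> GammaX n \<Longrightarrow> n < i \<Longrightarrow> act i f = f"
  unfolding GammaX_eq_GammaV
  by (rule GammaV_hom_eq[OF _ is_ring_hom_act is_ring_hom_id]) (auto simp: act_Suc_c act_Var)

lemma moved_subset: "moved i \<subseteq> XV ` {..<max n (i + 1)}"
  by (auto simp: moved_def)

lemma ddx_in_GammaX:
  assumes "f \<in> GammaX n" shows "ddx i f \<in> GammaX (max n (i + 1))"
proof -
  have "f \<in> GammaX (max n (i + 1))" using assms GammaX_mono[of n "max n (i + 1)"] by auto
  then obtain d where "Fil (XV ` {..<max n (i + 1)}) d f" by (auto simp: GammaX_eq_GammaV GammaV_def)
  from Fil_ddx(1)[OF this moved_subset] show ?thesis by (auto simp: GammaX_eq_GammaV GammaV_def)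
qed

text \<open>Write \<open>f\<close> as \<open>f(x\<^sub>n, x\<^bsub>n+1\<^esub>)\<close>. Since \<open>f\<close> does not depend on its second argument,
  \<open>f(x\<^sub>n, x\<^bsub>n+1\<^esub>) = f(x\<^sub>n, 0) = f(0, x\<^sub>n)\<close> by symmetry, and this is \<open>f\<close> at \<open>x\<^sub>n = 0\<close>.\<close>
lemma GammaX_descend:
  assumes f: "f \<in> GammaX n" and "n \<ge> 1" "ddx n f = 0"
  shows "f \<in> GammaX (n - 1)"
proof -
  \<comment> \<open>\<open>\<tau> v\<close> sets the variable \<open>x\<^bsub>v+1\<^esub>\<close>, which is \<open>XV v\<close>, to \<open>0\<close>\<close>
  define \<tau> :: "nat \<Rightarrow> gammaXY \<Rightarrow> gammaXY"
    where "\<tau> v = mpoly_subst Const (\<lambda>u. if u = XV v then 0 else Var u)" for v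
  have hom: "is_ring_hom (\<tau> v)" for v
    unfolding \<tau>_def by (intro is_ring_hom_subst is_ring_hom_Const)
  have \<tau>_c: "\<tau> v (Const a) = Const a" and \<tau>_Var: "\<tau> v (Var u) = (if u = XV v then 0 else Var u)"
    for v a u by (simp_all add: \<tau>_def mpoly_subst_Const mpoly_subst_Var is_ring_hom_Const)
  have "f = \<tau> n f"
    using f unfolding GammaX_eq_GammaV
    by (rule GammaV_hom_eq[OF _ is_ring_hom_id hom]) (auto simp: \<tau>_c \<tau>_Var)
  also have "\<dots> = \<tau> n (act n f)"
    using assms(3) by (simp add: ddx_eq_0_iff)
  also have "\<dots> = \<tau> (n - 1) f"
    using f unfolding GammaX_eq_GammaV
    by (rule GammaV_hom_eq[OF _ is_ring_hom_comp[OF hom is_ring_hom_act] hom])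
       (use \<open>n \<ge> 1\<close> in \<open>auto simp: \<tau>_c \<tau>_Var act_Suc_c act_Var\<close>)
  also have "\<dots> \<in> GammaX (n - 1)"
    using f unfolding GammaX_eq_GammaV
    by (rule GammaV_hom_image[OF _ hom]) (auto simp: \<tau>_c \<tau>_Var GammaV_c GammaV_0 intro!: GammaV_Var)
  finally show ?thesis .
qed

lemma GammaX_descend_to:
  assumes "f \<in> GammaX N" "\<And>i. i > n \<Longrightarrow> ddx i f = 0"
  shows "f \<in> GammaX n"
  using assms(1)
proof (induction N)
  case 0
  then show ?case using GammaX_mono[of 0 n] by auto
next
  case (Suc N)
  show ?case
  proof (cases "Suc N \<le> n")
    case True
    then show ?thesis using Suc.prems GammaX_mono by blast
  next
    case False
    then show ?thesis using Suc GammaX_descend[of f "Suc N"] assms(2)[of "Suc N"] by simp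
  qed
qed

lemma is_ring_hom_at_Y_0: "is_ring_hom at_Y_0"
  unfolding at_Y_0_def by (intro is_ring_hom_subst is_ring_hom_Const)

lemma at_Y_0_Const: "at_Y_0 (Const a) = Const a"
  by (simp add: at_Y_0_def mpoly_subst_Const is_ring_hom_Const)

lemma at_Y_0_Var: "at_Y_0 (Var v) = (case v of XV k \<Rightarrow> Var v | YV k \<Rightarrow> 0)"
  by (simp add: at_Y_0_def mpoly_subst_Var is_ring_hom_Const split: xyvar.split)

lemma at_Y_0_act: "at_Y_0 (act i f) = act i (at_Y_0 f)"
proof (rule GammaV_hom_eq[OF GammaV_UNIV is_ring_hom_comp[OF is_ring_hom_at_Y_0 is_ring_hom_act]
      is_ring_hom_comp[OF is_ring_hom_act is_ring_hom_at_Y_0]])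
  fix p
  show "at_Y_0 (act i (Const (cvar p))) = act i (at_Y_0 (Const (cvar p)))"
    by (cases "i = 0")
       (simp_all add: act_Suc_c at_Y_0_Const act_c_eq_s0_c hom_s0_c[OF is_ring_hom_at_Y_0] xvar_def at_Y_0_Var)
next
  fix v show "at_Y_0 (act i (Var v)) = act i (at_Y_0 (Var v))"
    by (auto simp: act_Var at_Y_0_Var is_ring_homD[OF is_ring_hom_act] is_ring_homD[OF is_ring_hom_at_Y_0]
        split: xyvar.split)
qed

lemma at_Y_0_denom: "at_Y_0 (denom i) = denom i"
  by (simp add: denom_def xvar_def at_Y_0_Var is_ring_homD[OF is_ring_hom_at_Y_0])

lemma at_Y_0_ddx: "at_Y_0 (ddx i f) = ddx i (at_Y_0 f)"
proof (rule ddx_eqI[symmetric])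
  have "at_Y_0 (denom i * ddx i f) = at_Y_0 (f - act i f)" by (simp only: denom_mult_ddx)
  then show "denom i * at_Y_0 (ddx i f) = at_Y_0 f - act i (at_Y_0 f)"
    by (simp add: is_ring_homD[OF is_ring_hom_at_Y_0] at_Y_0_act at_Y_0_denom)
qed

lemma at_Y_0_in_GammaX: "\<exists>N. at_Y_0 f \<in> GammaX N"
proof -
  obtain d where "Fil UNIV d f" using GammaV_UNIV[of f] by (auto simp: GammaV_def)
  then show ?thesis
  proof (induction rule: Fil.induct)
    case (Fil_of_int d k)
    then show ?case
      by (auto simp: is_ring_hom_of_int_commute is_ring_hom_at_Y_0 GammaX_eq_GammaV intro: GammaV_of_int)
  next
    case (Fil_add d f g)
    then obtain N M where "at_Y_0 f \<in> GammaX N" "at_Y_0 g \<in> GammaX M" by blast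
    then have "at_Y_0 f \<in> GammaX (max N M)" "at_Y_0 g \<in> GammaX (max N M)"
      using GammaX_mono[of N "max N M"] GammaX_mono[of M "max N M"] by auto
    then show ?case by (auto simp: is_ring_homD[OF is_ring_hom_at_Y_0] GammaX_eq_GammaV intro: GammaV_add)
  next
    case (Fil_mult_c d f p)
    then show ?case
      by (auto simp: is_ring_homD[OF is_ring_hom_at_Y_0] at_Y_0_Const GammaX_eq_GammaV intro: GammaV_mult GammaV_c)
  next
    case (Fil_mult_Var d f v)
    then obtain N where N: "at_Y_0 f \<in> GammaX N" by blast
    show ?case
    proof (cases v)
      case (XV k)
      have "at_Y_0 f \<in> GammaX (max N (Suc k))" using N GammaX_mono[of N "max N (Suc k)"] by auto
      then have "at_Y_0 f * Var v \<in> GammaX (max N (Suc k))"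
        unfolding GammaX_eq_GammaV using XV by (intro GammaV_mult GammaV_Var) auto
      then show ?thesis using XV by (auto simp: is_ring_homD[OF is_ring_hom_at_Y_0] at_Y_0_Var)
    next
      case (YV k)
      then show ?thesis
        by (auto simp: is_ring_homD[OF is_ring_hom_at_Y_0] at_Y_0_Var GammaX_eq_GammaV intro: GammaV_0)
    qed
  qed
qed

lemma is_ring_hom_gamma_const_term: "is_ring_hom gamma_const_term"
  unfolding is_ring_hom_def
  by (safe; transfer; simp add: is_ring_homD[OF is_ring_hom_subst[OF is_ring_hom_id]])

lemma constant_term_eq_subst: "constant_term f = mpoly_subst gamma_const_term (\<lambda>_. 0) f"
proof -
  have "monom_subst (\<lambda>_. 0 :: int) m = (if m = 0 then 1 else 0)" for m :: "xyvar \<Rightarrow>\<^sub>0 nat"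
  proof (cases "m = 0")
    case False
    then obtain v where "v \<in> Poly_Mapping.keys m" by (meson equals0I keys_eq_empty)
    then show ?thesis
      by (auto simp: monom_subst_def in_keys_iff False intro!: prod_zero bexI[of _ v])
  qed simp
  then have "mpoly_subst gamma_const_term (\<lambda>_. 0) f =
      (\<Sum>m\<in>Poly_Mapping.keys f. if 0 = m then gamma_const_term (Poly_Mapping.lookup f m) else 0)"
    unfolding mpoly_subst_def by (intro sum.cong) auto
  then show ?thesis
    by (simp add: constant_term_def in_keys_iff is_ring_homD[OF is_ring_hom_gamma_const_term])
qed

lemma is_ring_hom_constant_term: "is_ring_hom constant_term"
  using is_ring_hom_subst[OF is_ring_hom_gamma_const_term, of "\<lambda>_. 0"]
  by (simp add: constant_term_eq_subst[abs_def])

lemma constant_term_at_Y_0: "constant_term (at_Y_0 f) = constant_term f"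
proof (rule GammaV_hom_eq[OF GammaV_UNIV is_ring_hom_comp[OF is_ring_hom_constant_term is_ring_hom_at_Y_0]
      is_ring_hom_constant_term])
  fix v show "constant_term (at_Y_0 (Var v)) = constant_term (Var v)"
    by (simp add: at_Y_0_Var constant_term_eq_subst mpoly_subst_Var is_ring_hom_gamma_const_term
        is_ring_homD[OF is_ring_hom_subst[OF is_ring_hom_gamma_const_term]] split: xyvar.split)
qed (simp add: at_Y_0_Const)

section \<open>Compositions of divided differences that vanish\<close>

text \<open>
  With \<open>a, b, c\<close> for \<open>x\<^sub>n, x\<^bsub>n+1\<^esub>, x\<^bsub>n+2\<^esub>\<close>, clearing denominators in \<open>f\<^sub>2 = \<partial>\<^bsub>n+1\<^esub> \<partial>\<^sub>n f\<close> gives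
  \<open>(a - b)(a - c)(b - c) f\<^sub>2 = (b - c) f(a) - (a - c) f(b) + (a - b) f(c)\<close>,
  where \<open>f\<close> is regarded as a function of \<open>x\<^sub>n\<close>. Both the factor on the left and
  the right-hand side change sign under \<open>s\<^sub>n\<close>, hence \<open>f\<^sub>2\<close> is fixed by \<open>s\<^sub>n\<close>.
\<close>
lemma ddx_braid_vanish:
  assumes f: "f \<in> GammaX n" and n: "n \<ge> 1"
  shows "ddx n (ddx (n + 1) (ddx n f)) = 0"
proof -
  define m where "m = n + 1"
  let ?s = "act n" and ?t = "act m"
  note hs = is_ring_homD[OF is_ring_hom_act[of n]] and ht = is_ring_homD[OF is_ring_hom_act[of m]]
  define a b c where "a = xvar n" and "b = xvar m" and "c = xvar (m + 1)"
  have s: "?s a = b" "?s b = a" "?s c = c" and t: "?t a = a" "?t b = c" "?t c = b"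
    using n by (auto simp: a_def b_def c_def m_def act_Suc_x)
  have da: "denom n = a - b" and db: "denom m = b - c"
    using n by (simp_all add: denom_def a_def b_def c_def m_def)
  define f1 where "f1 = ddx n f"
  define f2 where "f2 = ddx m f1"
  have tf: "?t f = f" using f by (intro act_GammaX) (auto simp: m_def)
  have stsf: "?s (?t (?s f)) = ?t (?s f)"
    using f unfolding GammaX_eq_GammaV
    by (rule GammaV_hom_eq[OF _ is_ring_hom_comp[OF is_ring_hom_act is_ring_hom_comp[OF is_ring_hom_act is_ring_hom_act]]
          is_ring_hom_comp[OF is_ring_hom_act is_ring_hom_act]])
       (use n in \<open>auto simp: act_Suc_c act_Var m_def\<close>)
  have e1: "(a - b) * f1 = f - ?s f"
    using denom_mult_ddx[of n f] by (simp add: f1_def da)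
  have "?t ((a - b) * f1) = ?t (f - ?s f)" by (simp only: e1)
  then have e1': "(a - c) * ?t f1 = f - ?t (?s f)" by (simp add: ht t tf)
  have e2: "(b - c) * f2 = f1 - ?t f1"
    using denom_mult_ddx[of m f1] by (simp add: f2_def db)
  have E: "(a - b) * ((a - c) * ((b - c) * f2)) = (b - c) * f - (a - c) * ?s f + (a - b) * ?t (?s f)"
  proof -
    have "(a - b) * ((a - c) * ((b - c) * f2)) = (a - c) * ((a - b) * f1) - (a - b) * ((a - c) * ?t f1)"
      unfolding e2 by (simp add: algebra_simps)
    also have "\<dots> = (b - c) * f - (a - c) * ?s f + (a - b) * ?t (?s f)"
      unfolding e1 e1' by (simp add: algebra_simps)
    finally show ?thesis .
  qed
  have "?s ((a - b) * ((a - c) * ((b - c) * f2))) = ?s ((b - c) * f - (a - c) * ?s f + (a - b) * ?t (?s f))"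
    by (simp only: E)
  then have E': "(b - a) * ((b - c) * ((a - c) * ?s f2)) = (a - c) * ?s f - (b - c) * f + (b - a) * ?t (?s f)"
    by (simp add: hs s stsf act_act)
  have "(a - b) * ((b - c) * ((a - c) * (f2 - ?s f2))) =
      (a - b) * ((a - c) * ((b - c) * f2)) + (b - a) * ((b - c) * ((a - c) * ?s f2))"
    by (simp add: algebra_simps)
  also have "\<dots> = 0" unfolding E E' by (simp add: algebra_simps)
  finally have "denom n * (denom m * ((a - c) * (f2 - ?s f2))) = 0" by (simp only: da db)
  then have "(a - c) * (f2 - ?s f2) = 0" using denom_cancel by blast
  \<comment> \<open>\<open>a - c\<close> is not a denominator itself, but its image under \<open>s\<^bsub>n+1\<^esub>\<close> is\<close>
  then have "?t ((a - c) * (f2 - ?s f2)) = 0" by (simp only: ht)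
  then have "denom n * ?t (f2 - ?s f2) = 0" by (simp add: ht(3) t da ht(6))
  then have "?t (?t (f2 - ?s f2)) = 0" using denom_cancel ht(4) by metis
  then have "?s f2 = f2" unfolding act_act by simp
  then show ?thesis by (simp add: ddx_eq_0_iff f2_def f1_def m_def)
qed

text \<open>With \<open>a, b\<close> for \<open>x\<^sub>1, x\<^sub>2\<close>, clearing denominators in \<open>g\<^sub>3 = \<partial>\<^sub>0 \<partial>\<^sub>1 \<partial>\<^sub>0 f\<close> gives
  \<open>4 a b (a\<^sup>2 - b\<^sup>2) g\<^sub>3 = (b - a)(F - D) - (a + b)(A - B)\<close>, where \<open>F, A, B, D\<close> are the images of \<open>f\<close> under
  \<open>1, s\<^sub>0, s\<^sub>1 s\<^sub>0, s\<^sub>0 s\<^sub>1 s\<^sub>0\<close>. The reflection \<open>s\<^sub>1\<close> fixes \<open>F\<close>, exchanges \<open>A\<close> and \<open>B\<close>, and fixes \<open>D\<close> by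
  \<open>tsts\<close>, so both sides change sign and \<open>g\<^sub>3\<close> is fixed by \<open>s\<^sub>1\<close>.\<close>
lemma ddx_braid4_vanish:
  assumes f: "f \<in> GammaX 0"
  shows "ddx 1 (ddx 0 (ddx 1 (ddx 0 f))) = 0"
proof -
  let ?s = "act 0" and ?t = "act 1"
  note hs = is_ring_homD[OF is_ring_hom_act[of 0]] and ht = is_ring_homD[OF is_ring_hom_act[of 1]]
  define a b where "a = xvar 1" and "b = xvar (Suc (Suc 0))"
  have s: "?s a = - a" "?s b = b" and t: "?t a = b" "?t b = a"
    by (auto simp: a_def b_def act_Suc_x act_0_x)
  have d0: "denom 0 = - 2 * a" and d1: "denom 1 = a - b"
    by (simp_all add: denom_def a_def b_def)
  have tf: "?t f = f" using f by (intro act_GammaX) auto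
  have tsts: "?t (?s (?t (?s f))) = ?s (?t (?s f))"
    using f unfolding GammaX_eq_GammaV
  proof (rule GammaV_hom_eq[OF _
        is_ring_hom_comp[OF is_ring_hom_act is_ring_hom_comp[OF is_ring_hom_act is_ring_hom_comp[OF is_ring_hom_act is_ring_hom_act]]]
        is_ring_hom_comp[OF is_ring_hom_act is_ring_hom_comp[OF is_ring_hom_act is_ring_hom_act]]])
    fix p
    have x: "xvar (Suc 0) = a" by (simp add: a_def)
    show "?t (?s (?t (?s (Const (cvar p))))) = ?s (?t (?s (Const (cvar p))))"
      using s0_c_commute[of "\<lambda>p. Const (cvar p)" a b]
      by (simp add: act_c_eq_s0_c[abs_def] x hom_s0_c[OF is_ring_hom_act] s t[unfolded One_nat_def] act_Suc_c)
  qed auto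
  define F A B D where "F = f" and "A = ?s f" and "B = ?t (?s f)" and "D = ?s (?t (?s f))"
  have sF: "?s F = A" "?s A = F" "?s B = D" and tF: "?t F = F" "?t A = B" "?t B = A" "?t D = D"
    by (simp_all only: F_def A_def B_def D_def tf tsts act_act)
  define g1 where "g1 = ddx 0 f"
  define g2 where "g2 = ddx 1 g1"
  define g3 where "g3 = ddx 0 g2"
  have e1: "- 2 * a * g1 = F - A"
    using denom_mult_ddx[of 0 f] by (simp add: g1_def d0 F_def A_def)
  have "?t (- 2 * a * g1) = ?t (F - A)" by (simp only: e1)
  then have e1': "- 2 * b * ?t g1 = F - B" by (simp add: ht t tF del: One_nat_def)
  have e2: "(a - b) * g2 = g1 - ?t g1"
    using denom_mult_ddx[of 1 g1] by (simp only: g2_def d1)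
  have E2: "- 2 * a * (b * ((a - b) * g2)) = (b - a) * F - b * A + a * B"
  proof -
    have "- 2 * a * (b * ((a - b) * g2)) = b * (- 2 * a * g1) - a * (- 2 * b * ?t g1)"
      unfolding e2 by (simp add: algebra_simps)
    also have "\<dots> = (b - a) * F - b * A + a * B"
      unfolding e1 e1' by (simp add: algebra_simps)
    finally show ?thesis .
  qed
  have "?s (- 2 * a * (b * ((a - b) * g2))) = ?s ((b - a) * F - b * A + a * B)" by (simp only: E2)
  then have E2': "2 * a * (b * ((- a - b) * ?s g2)) = (b + a) * A - b * F - a * D"
    by (simp add: hs s sF)
  have e3: "- 2 * a * g3 = g2 - ?s g2"
    using denom_mult_ddx[of 0 g2] by (simp only: g3_def d0)
  have "- 2 * a * (- 2 * (a * (b * ((a - b) * ((a + b) * g3))))) =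
      (a + b) * (- 2 * a * (b * ((a - b) * g2))) - (a - b) * (2 * a * (b * ((- a - b) * ?s g2)))"
  proof -
    have "- 2 * a * (- 2 * (a * (b * ((a - b) * ((a + b) * g3))))) =
        - 2 * (a * (b * ((a - b) * ((a + b) * (- 2 * a * g3)))))"
      by (simp add: algebra_simps)
    then show ?thesis unfolding e3 by (simp add: algebra_simps)
  qed
  also have "\<dots> = - 2 * a * 0 + a * ((b - a) * (F - D) - (a + b) * (A - B))"
    unfolding E2 E2' by (simp add: algebra_simps)
  finally have "a * (4 * (a * (b * ((a - b) * ((a + b) * g3)))) - ((b - a) * (F - D) - (a + b) * (A - B))) = 0"
    by (simp add: algebra_simps)
  then have E3: "4 * (a * (b * ((a - b) * ((a + b) * g3)))) = (b - a) * (F - D) - (a + b) * (A - B)"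
    by (subst eq_iff_diff_eq_0) (rule Var_mult_cancel[of "XV 0"], simp add: a_def xvar_def)
  then have "?t (4 * (a * (b * ((a - b) * ((a + b) * g3))))) = ?t ((b - a) * (F - D) - (a + b) * (A - B))"
    by (simp only: E3)
  then have E3': "4 * (b * (a * ((b - a) * ((b + a) * ?t g3)))) = (a - b) * (F - D) - (b + a) * (B - A)"
    by (simp add: ht t tF del: One_nat_def)
  have "4 * (a * (b * ((a - b) * ((a + b) * (g3 - ?t g3))))) =
      4 * (a * (b * ((a - b) * ((a + b) * g3)))) + 4 * (b * (a * ((b - a) * ((b + a) * ?t g3))))"
    by (simp add: algebra_simps)
  also have "\<dots> = 0" unfolding E3 E3' by (simp add: algebra_simps)
  finally have "of_int 4 * (Var (XV 0) * (Var (XV 1) * (denom 1 * ((a + b) * (g3 - ?t g3))))) = 0"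
    by (simp add: a_def b_def xvar_def denom_def)
  then have "(a + b) * (g3 - ?t g3) = 0"
    using gammaXY_torsion_free Var_mult_cancel denom_cancel by (metis zero_neq_numeral)
  \<comment> \<open>the reflection \<open>s\<^sub>0\<close> turns the factor \<open>b + a\<close> into \<open>b - a\<close>, which can be cancelled\<close>
  then have "?s ((b + a) * (g3 - ?t g3)) = 0" by (simp only: hs add.commute)
  then have z: "(b - a) * ?s (g3 - ?t g3) = 0"
    by (simp only: hs(2,3) s add_uminus_conv_diff)
  have "denom 1 * ?s (g3 - ?t g3) = - ((b - a) * ?s (g3 - ?t g3))"
    unfolding d1 by (simp only: minus_mult_left minus_diff_eq)
  then have "denom 1 * ?s (g3 - ?t g3) = 0" by (simp only: z minus_zero)
  then have "?s (?s (g3 - ?t g3)) = 0" using denom_cancel hs(4) by metis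
  then have "?t g3 = g3" unfolding act_act by simp
  then show ?thesis by (simp add: ddx_eq_0_iff g3_def g2_def g1_def)
qed

section \<open>Elements of \<open>\<Gamma>\<close> invariant under \<open>s\<^sub>0\<close>\<close>

text \<open>
  Since \<open>s\<^sub>0 c\<^sub>q = c\<^sub>q + 2 e\<^sub>q\<close>, the map \<open>s\<^sub>0 - 1\<close> is twice a derivation up to multiples of \<open>4\<close>.
\<close>
lemma prod_add_twice:
  fixes u e :: "'i \<Rightarrow> 'a::comm_ring_1"
  assumes "finite A"
  shows "\<exists>h. (\<Prod>q\<in>A. u q + 2 * e q) = (\<Prod>q\<in>A. u q) + 2 * (\<Sum>q\<in>A. e q * (\<Prod>r\<in>A - {q}. u r)) + 4 * h"
  using assms
proof (induction A rule: finite_induct)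
  case empty
  show ?case by (intro exI[of _ 0]) simp
next
  case (insert q A)
  then obtain h where h: "(\<Prod>q\<in>A. u q + 2 * e q) =
      (\<Prod>q\<in>A. u q) + 2 * (\<Sum>q\<in>A. e q * (\<Prod>r\<in>A - {q}. u r)) + 4 * h" by blast
  define S where "S = (\<Sum>q\<in>A. e q * (\<Prod>r\<in>A - {q}. u r))"
  have "(\<Sum>r\<in>A. e r * (\<Prod>r'\<in>insert q A - {r}. u r')) = (\<Sum>r\<in>A. u q * (e r * (\<Prod>r'\<in>A - {r}. u r')))"
  proof (rule sum.cong)
    fix r assume "r \<in> A"
    then have "insert q A - {r} = insert q (A - {r})" using insert.hyps by auto
    then show "e r * (\<Prod>r'\<in>insert q A - {r}. u r') = u q * (e r * (\<Prod>r'\<in>A - {r}. u r'))"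
      using insert.hyps by (simp add: mult_ac)
  qed simp
  also have "\<dots> = u q * S" by (simp add: S_def sum_distrib_left)
  moreover have "insert q A - {q} = A" using insert.hyps by auto
  ultimately have "(\<Sum>r\<in>insert q A. e r * (\<Prod>r'\<in>insert q A - {r}. u r')) = e q * prod u A + u q * S"
    using insert.hyps by simp
  moreover have "(\<Prod>r\<in>insert q A. u r + 2 * e r) = (u q + 2 * e q) * (prod u A + 2 * S + 4 * h)"
    using insert.hyps by (simp add: h S_def)
  moreover have "prod u (insert q A) = u q * prod u A" using insert.hyps by simp
  ultimately show ?case
    by (intro exI[of _ "e q * S + u q * h + 2 * (e q * h)"]) (simp add: algebra_simps)
qed

lemma even_sum_single_odd:
  fixes t :: "'a \<Rightarrow> int"
  assumes "finite F" "x \<in> F" "odd (t x)" "\<And>y. y \<in> F \<Longrightarrow> y \<noteq> x \<Longrightarrow> even (t y)"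
  shows "odd (sum t F)"
proof -
  have "even (sum t (F - {x}))" using assms(4) by (intro dvd_sum) auto
  then show ?thesis using assms sum.remove[OF assms(1,2), of t] by simp
qed

text \<open>Only the pure power of \<open>x\<^sub>1\<close> is picked: the images \<open>s\<^sub>0 c\<^sub>q\<close> involve no other variable.\<close>
definition xcoeff :: "nat \<Rightarrow> gammaXY \<Rightarrow> gamma"
  where "xcoeff p f = Poly_Mapping.lookup f (Poly_Mapping.single (XV 0) p)"

lemma additive_xcoeff: "additive (xcoeff p)"
  by standard (simp add: xcoeff_def lookup_add)

lemma xcoeff_monomial: "xcoeff p (xvar 1 ^ j * Const a) = (if j = p then a else 0)"
proof -
  have "xvar 1 ^ j = Poly_Mapping.single (Poly_Mapping.single (XV 0) j) 1"
    by (induction j) (simp_all add: xvar_def Var_def mult_single flip: single_add)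
  moreover have "Poly_Mapping.single (XV 0) j = Poly_Mapping.single (XV 0) p \<longleftrightarrow> j = p"
    by (metis lookup_single_eq)
  ultimately show ?thesis
    by (simp add: xcoeff_def Const_def mult_single lookup_single when_def)
qed

lemma act_0_cmon:
  assumes "A \<in> strict_sets"
  shows "\<exists>h. act 0 (Const (cmon A)) = Const (cmon A) +
    of_int 2 * (\<Sum>q\<in>A. \<Sum>j=1..q. xvar 1 ^ j * Const (cvar (q - j) * cmon (A - {q}))) + of_int 4 * h"
proof -
  have fin: "finite A" using assms by (simp add: strict_sets_def)
  have Const: "Const (cmon B) = (\<Prod>q\<in>B. Const (cvar q) :: gammaXY)" for B
    by (simp add: cmon_def is_ring_hom_prod[OF is_ring_hom_Const])
  have "act 0 (Const (cmon A)) = (\<Prod>q\<in>A. Const (cvar q) + 2 * (\<Sum>j=1..q. xvar 1 ^ j * Const (cvar (q - j))))"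
    by (simp add: Const is_ring_hom_prod[OF is_ring_hom_act] act_0_c)
  moreover obtain h where "(\<Prod>q\<in>A. Const (cvar q) + 2 * (\<Sum>j=1..q. xvar 1 ^ j * Const (cvar (q - j)))) =
      Const (cmon A) + 2 * (\<Sum>q\<in>A. (\<Sum>j=1..q. xvar 1 ^ j * Const (cvar (q - j))) * Const (cmon (A - {q}))) + 4 * h"
    using prod_add_twice[OF fin, of "\<lambda>q. Const (cvar q)" "\<lambda>q. \<Sum>j=1..q. xvar 1 ^ j * Const (cvar (q - j))"]
    unfolding Const by blast
  ultimately show ?thesis
    by (intro exI[of _ h]) (simp add: sum_distrib_right is_ring_homD(3)[OF is_ring_hom_Const] mult.assoc)
qed

text \<open>Let \<open>p\<close> be the largest part occurring in a strict partition \<open>B\<close> with odd coefficient \<open>a\<^sub>B\<close> in \<open>g\<close>. Half the coefficient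
  of \<open>x\<^sub>1\<^sup>p\<close> in \<open>s\<^sub>0 g - g\<close> is, modulo \<open>2\<close>, the sum of \<open>a\<^sub>B cmon (B - {p})\<close> over the \<open>B\<close> containing
  \<open>p\<close>: a product with a part larger than \<open>p\<close> has an even coefficient, a part \<open>q < p\<close> contributes no \<open>x\<^sub>1\<^sup>p\<close>, and the part \<open>p\<close> contributes it with \<open>c\<^sub>0 = 1\<close>. These
  products are distinct basis elements, so they cannot cancel.\<close>
lemma even_gcoef_of_invariant:
  assumes inv: "act 0 (Const g) = Const g" and A: "A \<in> strict_sets" "A \<noteq> {}"
  shows "even (gcoef A g)"
proof (rule ccontr)
  assume odd: "odd (gcoef A g)"
  obtain F where F: "finite F" "F \<subseteq> strict_sets" "g = (\<Sum>A\<in>F. of_int (gcoef A g) * cmon A)"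
    by (rule gamma_expansion[of g])
  define a where "a B = gcoef B g" for B
  define odds where "odds = {B \<in> F. odd (a B)}"
  have "A \<in> F"
  proof (rule ccontr)
    assume "A \<notin> F"
    have "gcoef A g = (\<Sum>B\<in>F. gcoef B g * gcoef A (cmon B))"
      by (subst F(3)) (simp add: additive.sum[OF additive_gcoef] gcoef_of_int_mult)
    also have "\<dots> = 0"
      using F(2) \<open>A \<notin> F\<close> A by (intro sum.neutral ballI) (auto simp: gcoef_cmon subset_iff)
    finally show False using odd by simp
  qed
  then have "A \<in> odds" using odd by (simp add: odds_def a_def)
  have fin: "finite (\<Union>odds)" using F by (auto simp: odds_def strict_sets_def)
  define p where "p = Max (\<Union>odds)"
  have ne: "\<Union>odds \<noteq> {}" using \<open>A \<in> odds\<close> A(2) by auto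
  have p_in: "p \<in> \<Union>odds" unfolding p_def using fin ne by (rule Max_in)
  have p_max: "q \<le> p" if "q \<in> B" "B \<in> odds" for q B
    unfolding p_def using fin that by (intro Max_ge) auto
  obtain A0 where A0: "A0 \<in> odds" "p \<in> A0" using p_in by auto
  have A0_strict: "A0 \<in> strict_sets" using A0 F(2) by (auto simp: odds_def)
  then have "p \<ge> 1" using A0(2) by (cases p) (auto simp: strict_sets_def)
  define T where "T B = (\<Sum>q\<in>B. \<Sum>j=1..q. xvar 1 ^ j * Const (cvar (q - j) * cmon (B - {q})))" for B
  have "\<forall>B\<in>strict_sets. \<exists>h. act 0 (Const (cmon B)) = Const (cmon B) + of_int 2 * T B + of_int 4 * h"
    using act_0_cmon unfolding T_def by blast
  from bchoice[OF this] obtain h where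
    h: "\<And>B. B \<in> strict_sets \<Longrightarrow> act 0 (Const (cmon B)) = Const (cmon B) + of_int 2 * T B + of_int 4 * h B"
    by blast
  have Const_of_int: "Const (of_int k * x) = of_int k * (Const x :: gammaXY)" for k x
    by (simp add: is_ring_homD(3)[OF is_ring_hom_Const] is_ring_hom_of_int_commute[OF is_ring_hom_Const])
  have Const_g: "(Const g :: gammaXY) = (\<Sum>B\<in>F. of_int (a B) * Const (cmon B))"
  proof -
    have "Const g = (\<Sum>B\<in>F. Const (of_int (a B) * cmon B) :: gammaXY)"
      by (subst F(3)) (simp only: is_ring_homD(7)[OF is_ring_hom_Const] a_def)
    then show ?thesis unfolding Const_of_int .
  qed
  have "0 = act 0 (Const g) - Const g" using inv by simp
  also have "\<dots> = (\<Sum>B\<in>F. of_int (a B) * act 0 (Const (cmon B))) - Const g"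
    by (simp add: Const_g is_ring_homD[OF is_ring_hom_act] is_ring_hom_of_int_commute[OF is_ring_hom_act])
  also have "\<dots> = (\<Sum>B\<in>F. of_int (a B) * (of_int 2 * T B + of_int 4 * h B))"
  proof -
    have "(\<Sum>B\<in>F. of_int (a B) * act 0 (Const (cmon B))) =
        (\<Sum>B\<in>F. of_int (a B) * Const (cmon B) + of_int (a B) * (of_int 2 * T B + of_int 4 * h B))"
      using F(2) h by (intro sum.cong) (auto simp: subset_iff algebra_simps)
    then show ?thesis by (simp add: sum.distrib Const_g)
  qed
  also have "\<dots> = of_int 2 * (\<Sum>B\<in>F. of_int (a B) * (T B + of_int 2 * h B))"
    unfolding sum_distrib_left by (intro sum.cong) (simp_all add: algebra_simps)
  finally have twice: "0 = of_int 2 * (\<Sum>B\<in>F. of_int (a B) * (T B + of_int 2 * h B))" .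
  have "(\<Sum>B\<in>F. of_int (a B) * (T B + of_int 2 * h B)) = 0"
    by (rule gammaXY_torsion_free[OF twice[symmetric]]) simp
  then have "gcoef (A0 - {p}) (xcoeff p (\<Sum>B\<in>F. of_int (a B) * (T B + of_int 2 * h B))) = 0"
    by (simp add: additive.zero[OF additive_xcoeff] additive.zero[OF additive_gcoef])
  then have sum0: "(\<Sum>B\<in>F. a B * (gcoef (A0 - {p}) (xcoeff p (T B)) + 2 * gcoef (A0 - {p}) (xcoeff p (h B)))) = 0"
    by (simp only: additive.sum[OF additive_xcoeff] additive.sum[OF additive_gcoef]
        additive_of_int_mult[OF additive_xcoeff] gcoef_of_int_mult
        additive.add[OF additive_xcoeff] gcoef_add)
  have xT: "xcoeff p (T B) = (if p \<in> B then cmon (B - {p}) else 0)" if B: "B \<in> odds" for B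
  proof -
    have finB: "finite B" using B F(2) by (auto simp: odds_def strict_sets_def)
    have "xcoeff p (T B) = (\<Sum>q\<in>B. \<Sum>j=1..q. if j = p then cvar (q - j) * cmon (B - {q}) else 0)"
      by (simp only: T_def additive.sum[OF additive_xcoeff] xcoeff_monomial)
    also have "\<dots> = (\<Sum>q\<in>B. if q = p then cmon (B - {p}) else 0)"
      using p_max[OF _ B] \<open>p \<ge> 1\<close> by (intro sum.cong) (fastforce simp: cvar_0)+
    also have "\<dots> = (if p \<in> B then cmon (B - {p}) else 0)"
      using finB by simp
    finally show ?thesis .
  qed
  have "odd (\<Sum>B\<in>F. a B * (gcoef (A0 - {p}) (xcoeff p (T B)) + 2 * gcoef (A0 - {p}) (xcoeff p (h B))))"
  proof (rule even_sum_single_odd)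
    have minus_strict: "B - {p} \<in> strict_sets" if "B \<in> strict_sets" for B using that by (auto simp: strict_sets_def)
    show "A0 \<in> F" "finite F" using A0 F by (auto simp: odds_def)
    have "gcoef (A0 - {p}) (xcoeff p (T A0)) = 1"
      using A0 A0_strict by (simp add: xT gcoef_cmon minus_strict)
    then show "odd (a A0 * (gcoef (A0 - {p}) (xcoeff p (T A0)) + 2 * gcoef (A0 - {p}) (xcoeff p (h A0))))"
      using A0 by (simp add: odds_def)
    fix B assume B: "B \<in> F" "B \<noteq> A0"
    show "even (a B * (gcoef (A0 - {p}) (xcoeff p (T B)) + 2 * gcoef (A0 - {p}) (xcoeff p (h B))))"
    proof (cases "B \<in> odds")
      case True
      have "gcoef (A0 - {p}) (xcoeff p (T B)) = 0"
      proof (cases "p \<in> B")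
        case True
        then have "B - {p} \<noteq> A0 - {p}" using B A0 by auto
        then show ?thesis
          using True \<open>B \<in> odds\<close> B F(2) A0_strict by (simp add: xT gcoef_cmon minus_strict subset_iff)
      qed (use True in \<open>simp add: xT additive.zero[OF additive_gcoef]\<close>)
      then show ?thesis by simp
    qed (use B in \<open>simp add: odds_def\<close>)
  qed
  with sum0 show False by simp
qed

lemma gcoef_of_int: "A \<in> strict_sets \<Longrightarrow> gcoef A (of_int k) = (if A = {} then k else 0)"
  using gcoef_of_int_mult[of A k "cmon {}"] gcoef_cmon[of A "{}"]
  by (auto simp: cmon_def strict_sets_def)

text \<open>An invariant element minus its integer part is divisible by \<open>2\<close>, and the half is again invariant
  because there is no torsion.\<close>
lemma power_2_dvd_gcoef_of_invariant:
  assumes "act 0 (Const g) = Const g" "A \<in> strict_sets" "A \<noteq> {}"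
  shows "2 ^ k dvd gcoef A g"
  using assms(1)
proof (induction k arbitrary: g)
  case (Suc k)
  define g' where "g' = g - of_int (gcoef {} g)"
  have Const_of_int: "Const (of_int j) = (of_int j :: gammaXY)" for j
    by (rule is_ring_hom_of_int_commute[OF is_ring_hom_Const])
  have gcoef_g': "gcoef B g' = (if B = {} then 0 else gcoef B g)" if "B \<in> strict_sets" for B
    using that by (simp add: g'_def additive.diff[OF additive_gcoef] gcoef_of_int)
  have inv': "act 0 (Const g') = Const g'"
    using Suc.prems by (simp add: g'_def is_ring_homD[OF is_ring_hom_Const] Const_of_int
        is_ring_homD[OF is_ring_hom_act] is_ring_hom_of_int_commute[OF is_ring_hom_act])
  obtain F where F: "finite F" "F \<subseteq> strict_sets" "g' = (\<Sum>A\<in>F. of_int (gcoef A g') * cmon A)"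
    by (rule gamma_expansion[of g'])
  define h where "h = (\<Sum>A\<in>F. of_int (gcoef A g' div 2) * cmon A)"
  have "of_int 2 * h = (\<Sum>A\<in>F. of_int (gcoef A g') * cmon A)"
    unfolding h_def sum_distrib_left
  proof (rule sum.cong)
    fix B assume "B \<in> F"
    then have "B \<in> strict_sets" using F(2) by auto
    then have "even (gcoef B g')"
    proof (cases "B = {}")
      case False
      with \<open>B \<in> strict_sets\<close> show ?thesis by (rule even_gcoef_of_invariant[OF inv'])
    qed (simp add: gcoef_g')
    then have "2 * (gcoef B g' div 2) = gcoef B g'" by simp
    then show "of_int 2 * (of_int (gcoef B g' div 2) * cmon B) = of_int (gcoef B g') * cmon B"
      by (metis mult.assoc of_int_mult)
  qed simp
  then have g'h: "g' = of_int 2 * h" using F(3) by simp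
  have "of_int 2 * (act 0 (Const h) - Const h) = act 0 (Const g') - Const g'"
    by (simp add: g'h is_ring_homD[OF is_ring_hom_Const] is_ring_homD[OF is_ring_hom_act] algebra_simps)
  then have "act 0 (Const h) = Const h"
    using inv' gammaXY_torsion_free[of 2 "act 0 (Const h) - Const h"] by simp
  then have "2 ^ k dvd gcoef A h" by (rule Suc.IH)
  moreover have "gcoef A g = 2 * gcoef A h"
    using gcoef_g'[OF assms(2)] assms(3) gcoef_of_int_mult[of A 2 h] g'h by simp
  ultimately show ?case by simp
qed simp

lemma invariant_imp_integer:
  assumes f: "f \<in> GammaX 0" and inv: "ddx 0 f = 0"
  shows "\<exists>k. f = of_int k"
proof -
  define g where "g = Poly_Mapping.lookup f 0"
  have fg: "f = Const g"
  proof (rule poly_mapping_eqI)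
    fix m
    have "m = 0" if "m \<in> Poly_Mapping.keys f"
      using f that by (auto simp: GammaX_def)
    then show "Poly_Mapping.lookup f m = Poly_Mapping.lookup (Const g) m"
      by (auto simp: Const_def g_def lookup_single when_def in_keys_iff)
  qed
  have inv': "act 0 (Const g) = Const g" using inv by (simp add: ddx_eq_0_iff fg)
  have "g = of_int (gcoef {} g)"
  proof (rule gamma_eqI)
    fix A assume A: "A \<in> strict_sets"
    have "gcoef A g = 0" if "A \<noteq> {}"
    proof (rule ccontr)
      assume nz: "gcoef A g \<noteq> 0"
      define k where "k = nat \<bar>gcoef A g\<bar>"
      have "2 ^ k dvd gcoef A g" by (rule power_2_dvd_gcoef_of_invariant[OF inv' A that])
      then have "2 ^ k \<le> \<bar>gcoef A g\<bar>" using nz by (metis dvd_abs_iff zero_less_abs_iff zdvd_imp_le)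
      moreover have "int k < 2 ^ k" using less_exp[of k] by (metis of_nat_less_iff of_nat_numeral of_nat_power)
      ultimately show False using nz by (simp add: k_def)
    qed
    then show "gcoef A g = gcoef A (of_int (gcoef {} g))"
      using A by (auto simp: gcoef_of_int)
  qed
  then have "f = of_int (gcoef {} g)"
    using fg is_ring_hom_of_int_commute[OF is_ring_hom_Const] by metis
  then show ?thesis by blast
qed

section \<open>Length and descents of signed permutations\<close>
lemma W_infE:
  assumes "w \<in> W_inf"
  obtains k where "bij w" "\<And>i. w (- i) = - w i" "\<And>i. i > int k \<Longrightarrow> w i = i"
  using assms by (auto simp: W_inf_def signed_perms_def)

lemma W_inf_odd: "w \<in> W_inf \<Longrightarrow> w (- i) = - w i"
  and W_inf_bij: "w \<in> W_inf \<Longrightarrow> bij w"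
  by (auto elim: W_infE)

lemma W_inf_inj: "w \<in> W_inf \<Longrightarrow> w i = w j \<longleftrightarrow> i = j"
  using W_inf_bij bij_is_inj inj_eq by metis

lemma W_inf_0: "w \<in> W_inf \<Longrightarrow> w 0 = 0"
  using W_inf_odd[of w 0] by simp

lemma id_in_W_inf: "id \<in> W_inf"
  by (auto simp: W_inf_def signed_perms_def)

lemma comp_in_W_inf:
  assumes "u \<in> W_inf" "v \<in> W_inf" shows "u \<circ> v \<in> W_inf"
proof -
  obtain k where u: "bij u" "\<And>i. u (- i) = - u i" "\<And>i. i > int k \<Longrightarrow> u i = i"
    using assms(1) by (rule W_infE) blast
  obtain l where v: "bij v" "\<And>i. v (- i) = - v i" "\<And>i. i > int l \<Longrightarrow> v i = i"
    using assms(2) by (rule W_infE) blast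
  have "u \<circ> v \<in> signed_perms (max k l)"
    using u v by (simp add: signed_perms_def bij_comp)
  then show ?thesis by (auto simp: W_inf_def)
qed

lemma gen_0: "gen 0 m = (if m = 1 then - 1 else if m = - 1 then 1 else m)"
  by (auto simp: gen_def)

lemma gen_pos:
  assumes "i \<noteq> 0"
  shows "gen i m = (if m = int i then int i + 1 else if m = - int i then - int i - 1
    else if m = int i + 1 then int i else if m = - int i - 1 then - int i else m)"
  using assms by (auto simp: gen_def abs_if sgn_if)

lemma gen_gen: "gen i (gen i m) = m"
  by (cases "i = 0") (auto simp: gen_0 gen_pos)

lemma gen_comp_gen: "gen i \<circ> gen i = id"
  by (auto simp: gen_gen)

lemma comp_gen_gen: "w \<circ> gen i \<circ> gen i = w"
  by (simp add: comp_assoc gen_comp_gen)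

lemma gen_uminus: "gen i (- m) = - gen i m"
  by (cases "i = 0") (auto simp: gen_0 gen_pos)

lemma gen_eq_0_iff: "gen i m = 0 \<longleftrightarrow> m = 0"
  by (cases "i = 0") (auto simp: gen_0 gen_pos)

lemma gen_in_W_inf: "gen i \<in> W_inf"
proof -
  have "gen i \<in> signed_perms (i + 1)"
    unfolding signed_perms_def
    using o_bij[OF gen_comp_gen gen_comp_gen]
    by (cases "i = 0") (auto simp: gen_uminus gen_0 gen_pos)
  then show ?thesis by (auto simp: W_inf_def)
qed

lemma comp_gen_in_W_inf: "w \<in> W_inf \<Longrightarrow> w \<circ> gen i \<in> W_inf"
  by (intro comp_in_W_inf gen_in_W_inf)

definition desc :: "nat \<Rightarrow> (int \<Rightarrow> int) \<Rightarrow> bool"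
  where "desc i w \<longleftrightarrow> (if i = 0 then w 1 < 0 else w (int i + 1) < w (int i))"

lemma desc_comp_gen:
  assumes "w \<in> W_inf" shows "desc i (w \<circ> gen i) \<longleftrightarrow> \<not> desc i w"
proof (cases "i = 0")
  case True
  have "w 1 \<noteq> 0" using W_inf_inj[OF assms, of 1 0] W_inf_0[OF assms] by simp
  then show ?thesis using True W_inf_odd[OF assms, of 1] by (auto simp: desc_def gen_0)
next
  case False
  have "w (int i) \<noteq> w (int i + 1)" using W_inf_inj[OF assms] by simp
  then show ?thesis using False by (auto simp: desc_def gen_pos)
qed

text \<open>All pairs of nonzero integers are counted, so that multiplication by a generator is a bijection of
  pairs except for the few pairs that it reverses. Symmetric pairs \<open>(a, b)\<close> and \<open>(-b, -a)\<close> are both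
  counted, but the pairs \<open>(-b, b)\<close> only once; adding the number of negative entries makes the
  total \<open>twice_inv\<close> exactly twice the length.\<close>
definition inversions :: "(int \<Rightarrow> int) \<Rightarrow> (int \<times> int) set"
  where "inversions w = {(a, b). a \<noteq> 0 \<and> b \<noteq> 0 \<and> a < b \<and> w b < w a}"

definition negatives :: "(int \<Rightarrow> int) \<Rightarrow> int set"
  where "negatives w = {j. 0 < j \<and> w j < 0}"

definition twice_inv :: "(int \<Rightarrow> int) \<Rightarrow> nat"
  where "twice_inv w = card (inversions w) + card (negatives w)"

lemma finite_inversions:
  assumes "w \<in> W_inf" shows "finite (inversions w)" "finite (negatives w)"
proof -
  obtain k where w: "bij w" "\<And>i. w (- i) = - w i" "\<And>i. i > int k \<Longrightarrow> w i = i"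
    using assms by (rule W_infE) blast
  have fix': "w i = i" if "i < - int k" for i
    using w(2)[of "- i"] w(3)[of "- i"] that by simp
  have inside: "- int k \<le> w i \<and> w i \<le> int k" if "- int k \<le> i" "i \<le> int k" for i
  proof -
    have "w (w i) \<noteq> w i \<or> w i = i" using W_inf_inj[OF assms] by metis
    then show ?thesis using w(3)[of "w i"] fix'[of "w i"] that by linarith
  qed
  have "inversions w \<subseteq> {- int k..int k} \<times> {- int k..int k}"
  proof
    fix x assume "x \<in> inversions w"
    then obtain a b where x: "x = (a, b)" "a < b" "w b < w a" by (auto simp: inversions_def)
    have "- int k \<le> a" using x(2,3) fix'[of a] fix'[of b] w(3)[of b] inside[of b] by linarith
    moreover have "b \<le> int k" using x(2,3) fix'[of a] w(3)[of a] w(3)[of b] inside[of a] by linarith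
    ultimately show "x \<in> {- int k..int k} \<times> {- int k..int k}" using x by auto
  qed
  then show "finite (inversions w)" by (rule finite_subset) auto
  have "negatives w \<subseteq> {0..int k}"
  proof
    fix j assume "j \<in> negatives w"
    then show "j \<in> {0..int k}" using w(3)[of j] by (auto simp: negatives_def not_less intro: ccontr)
  qed
  then show "finite (negatives w)" by (rule finite_subset) auto
qed

lemma reversed_pairs:
  "{(a, b). a \<noteq> 0 \<and> b \<noteq> 0 \<and> a < b \<and> gen i b < gen i a} =
    (if i = 0 then {(- 1, 1)} else {(int i, int i + 1), (- int i - 1, - int i)})"
proof (cases "i = 0")
  case True
  then show ?thesis by (auto simp: gen_0 split: if_splits)
next
  case False
  have near: "m - 1 \<le> gen i m" "gen i m \<le> m + 1" for m
    using gen_pos[OF False, of m] by auto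
  have "a \<noteq> 0 \<and> b \<noteq> 0 \<and> a < b \<and> gen i b < gen i a \<longleftrightarrow>
      a = int i \<and> b = int i + 1 \<or> a = - int i - 1 \<and> b = - int i" for a b
  proof
    assume ab: "a \<noteq> 0 \<and> b \<noteq> 0 \<and> a < b \<and> gen i b < gen i a"
    then have "b = a + 1" "gen i a = a + 1" using near[of a] near[of b] by linarith+
    moreover have "gen i a = a + 1 \<longrightarrow> a = int i \<or> a = - int i - 1"
      unfolding gen_pos[OF False] by presburger
    ultimately show "a = int i \<and> b = int i + 1 \<or> a = - int i - 1 \<and> b = - int i"
      by linarith
  next
    assume "a = int i \<and> b = int i + 1 \<or> a = - int i - 1 \<and> b = - int i"
    then show "a \<noteq> 0 \<and> b \<noteq> 0 \<and> a < b \<and> gen i b < gen i a"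
      using False by (auto simp: gen_pos)
  qed
  then show ?thesis using False by auto
qed

text \<open>Applying \<open>s\<^sub>i\<close> to both entries of a pair matches the inversions of \<open>w s\<^sub>i\<close> and \<open>w\<close> outside the set \<open>R\<close> of pairs reversed by
  \<open>s\<^sub>i\<close>. All of \<open>R\<close> belongs to the inversions of \<open>w\<close>, none of it to those of \<open>w s\<^sub>i\<close>. For \<open>i \<ge> 1\<close> the set
  \<open>R\<close> has two elements; for \<open>i = 0\<close> it has one, and one negative entry disappears.\<close>
lemma twice_inv_desc:
  assumes w: "w \<in> W_inf" and desc: "desc i w"
  shows "twice_inv w = twice_inv (w \<circ> gen i) + 2"
proof -
  let ?s = "gen i" and ?w' = "w \<circ> gen i"
  define R where "R = {(a, b). a \<noteq> 0 \<and> b \<noteq> 0 \<and> a < b \<and> gen i b < gen i a}"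
  note fin = finite_inversions[OF w] finite_inversions[OF comp_gen_in_W_inf[OF w, of i]]
  have R: "R = (if i = 0 then {(- 1, 1)} else {(int i, int i + 1), (- int i - 1, - int i)})"
    unfolding R_def by (rule reversed_pairs)
  have "map_prod ?s ?s ` (inversions ?w' - R) = inversions w - R"
  proof (rule set_eqI, rule iffI)
    have fwd: "(?s a, ?s b) \<in> inversions u - R" if "(a, b) \<in> inversions (u \<circ> ?s) - R" for a b u
    proof -
      have "?s a \<noteq> ?s b"
      proof
        assume "?s a = ?s b"
        then have "a = b" by (metis gen_gen)
        then show False using that by (simp add: inversions_def)
      qed
      then show ?thesis using that by (auto simp: inversions_def R_def gen_gen gen_eq_0_iff)
    qed
    fix x
    show "x \<in> inversions w - R" if "x \<in> map_prod ?s ?s ` (inversions ?w' - R)"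
      using that fwd by auto
    assume x: "x \<in> inversions w - R"
    obtain a b where ab: "x = (a, b)" by (cases x)
    then have "(?s a, ?s b) \<in> inversions ?w' - R"
      using fwd[of a b ?w'] x by (simp add: comp_gen_gen)
    moreover have "x = map_prod ?s ?s (?s a, ?s b)" by (simp add: ab gen_gen)
    ultimately show "x \<in> map_prod ?s ?s ` (inversions ?w' - R)" by blast
  qed
  moreover have "inj (map_prod ?s ?s)"
    by (rule inj_on_inverseI[where g = "map_prod ?s ?s"]) (auto simp: gen_gen)
  ultimately have diff: "card (inversions w - R) = card (inversions ?w' - R)"
    by (metis card_image inj_on_subset subset_UNIV)
  have odd: "w (- int i - 1) = - w (int i + 1)" "w (- int i) = - w (int i)" "w (- 1) = - w 1"
    using W_inf_odd[OF w, of "int i + 1"] W_inf_odd[OF w] by simp_all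
  have "R \<subseteq> inversions w"
    using desc odd by (auto simp: R inversions_def desc_def)
  then have "card (inversions w) = card (inversions w - R) + card R"
    using fin(1) card_Diff_subset[of R "inversions w"] card_mono[of "inversions w" R]
    by (simp add: finite_subset)
  moreover have "inversions ?w' \<inter> R = {}"
    using desc odd by (auto simp: R inversions_def desc_def gen_0 gen_pos)
  then have "inversions ?w' - R = inversions ?w'" by auto
  ultimately have inv: "card (inversions w) = card (inversions ?w') + card R"
    using diff by simp
  show ?thesis
  proof (cases "i = 0")
    case True
    define M where "M = {j. 1 < j \<and> w j < 0}"
    have "negatives w = insert 1 M" using desc True
      by (auto simp: negatives_def M_def desc_def order_le_less)
    moreover have "negatives ?w' = M"
      using desc True odd(3) by (auto simp: negatives_def M_def desc_def gen_0 split: if_splits)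
    moreover have "finite M" using fin(2) calculation by simp
    ultimately have "card (negatives w) = card (negatives ?w') + 1"
      by (simp add: M_def)
    then show ?thesis using inv True by (simp add: twice_inv_def R)
  next
    case False
    have "negatives w = ?s ` negatives ?w'"
    proof (rule set_eqI, rule iffI)
      have pos: "0 < gen i j" if "0 < j" for j using that False by (auto simp: gen_pos)
      fix j
      show "j \<in> negatives w" if "j \<in> ?s ` negatives ?w'" using that pos by (auto simp: negatives_def)
      assume "j \<in> negatives w"
      then have "?s j \<in> negatives ?w'" using pos by (auto simp: negatives_def gen_gen)
      then show "j \<in> ?s ` negatives ?w'" by (metis gen_gen image_eqI)
    qed
    moreover have "inj ?s" by (metis gen_gen injI)
    ultimately have "card (negatives w) = card (negatives ?w')"
      by (metis card_image inj_on_subset subset_UNIV)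
    then show ?thesis using inv False by (simp add: twice_inv_def R)
  qed
qed

lemma twice_inv_asc:
  assumes "w \<in> W_inf" "\<not> desc i w"
  shows "twice_inv (w \<circ> gen i) = twice_inv w + 2"
  using twice_inv_desc[of "w \<circ> gen i" i] assms by (simp add: comp_gen_in_W_inf desc_comp_gen comp_gen_gen)

text \<open>Without descents the entries \<open>w\<^sub>1, w\<^sub>2, \<dots>\<close> are positive and increasing, so \<open>w\<^sub>i \<ge> i\<close>; as \<open>w\<close> eventually is the
  identity, descending induction gives \<open>w\<^sub>i \<le> i\<close>.\<close>
lemma no_desc_imp_id:
  assumes w: "w \<in> W_inf" and no: "\<And>i. \<not> desc i w"
  shows "w = id"
proof -
  obtain k where k: "\<And>i. i > int k \<Longrightarrow> w i = i"
    using w by (rule W_infE) blast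
  have inc: "w (int i) < w (int i + 1)" if "i \<ge> 1" for i
    using no[of i] that W_inf_inj[OF w, of "int i" "int i + 1"] by (auto simp: desc_def)
  have "w 1 > 0" using no[of 0] W_inf_inj[OF w, of 1 0] W_inf_0[OF w] by (auto simp: desc_def)
  have lower: "w (int i) \<ge> int i" if "i \<ge> 1" for i
    using that
  proof (induction i rule: nat_induct_at_least)
    case base
    then show ?case using \<open>w 1 > 0\<close> by simp
  next
    case (Suc n)
    then show ?case using inc[of n] by (simp add: add.commute)
  qed
  have upper: "w (int i) \<le> int i" if "i \<ge> 1" "i \<le> Suc k" for i
    using that(2,1)
  proof (induction i rule: inc_induct)
    case base
    then show ?case using k[of "int (Suc k)"] by simp
  next
    case (step n)
    then show ?case using inc[of n] by (simp add: add.commute)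
  qed
  have pos: "w j = j" if "j > 0" for j
  proof (cases "j > int k")
    case False
    then have "w (int (nat j)) = int (nat j)"
      using lower[of "nat j"] upper[of "nat j"] that by (intro antisym) auto
    then show ?thesis using that by simp
  qed (use k in simp)
  have "w j = j" for j
    using pos[of j] pos[of "- j"] W_inf_odd[OF w, of j] W_inf_0[OF w]
    by (cases j "0 :: int" rule: linorder_cases) auto
  then show ?thesis by auto
qed

definition word :: "nat list \<Rightarrow> int \<Rightarrow> int"
  where "word v = foldr (\<lambda>i u. gen i \<circ> u) v id"

lemma word_Nil [simp]: "word [] = id"
  by (simp add: word_def)

lemma word_snoc [simp]: "word (v @ [i]) = word v \<circ> gen i"
  unfolding word_def by (induction v) (auto simp: comp_assoc)

lemma word_in_W_inf: "word v \<in> W_inf"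
  by (induction v rule: rev_induct) (simp_all only: word_Nil word_snoc id_in_W_inf comp_gen_in_W_inf)

lemma twice_inv_id: "twice_inv id = 0"
proof -
  have "inversions id = {}" "negatives id = {}"
    by (auto simp: inversions_def negatives_def)
  then show ?thesis unfolding twice_inv_def by (simp only: card.empty add_0)
qed

lemma twice_inv_word_le: "twice_inv (word v) \<le> 2 * length v"
proof (induction v rule: rev_induct)
  case (snoc i v)
  have "twice_inv (word v \<circ> gen i) \<le> twice_inv (word v) + 2"
    using twice_inv_desc[OF word_in_W_inf, of i v] twice_inv_asc[OF word_in_W_inf, of i v] by fastforce
  with snoc.IH show ?case
    unfolding word_snoc length_append_singleton mult_Suc_right by linarith
qed (simp only: word_Nil twice_inv_id le0)

lemma ex_reduced_word:
  assumes "w \<in> W_inf" shows "\<exists>v. w = word v \<and> 2 * length v = twice_inv w"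
  using assms
proof (induction "twice_inv w" arbitrary: w rule: less_induct)
  case less
  show ?case
  proof (cases "\<exists>i. desc i w")
    case True
    then obtain i where i: "desc i w" by blast
    have inv: "twice_inv w = twice_inv (w \<circ> gen i) + 2" by (rule twice_inv_desc[OF less.prems i])
    then obtain v where v: "w \<circ> gen i = word v" "2 * length v = twice_inv (w \<circ> gen i)"
      using less.hyps[of "w \<circ> gen i"] comp_gen_in_W_inf[OF less.prems] by auto
    have "w = word (v @ [i])" using v(1) comp_gen_gen[of w i] by simp
    moreover have "2 * length (v @ [i]) = twice_inv w" using v inv by simp
    ultimately show ?thesis by blast
  next
    case False
    then have "w = id" using no_desc_imp_id[OF less.prems] by blast
    then show ?thesis by (intro exI[of _ "[]"]) (simp add: twice_inv_id)
  qed
qed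

lemma twice_len_eq:
  assumes "w \<in> W_inf" shows "2 * len w = twice_inv w"
proof -
  obtain v where v: "w = word v" "2 * length v = twice_inv w"
    using ex_reduced_word[OF assms] by blast
  have "len w = length v"
    unfolding len_def word_def[symmetric]
  proof (rule Least_equality)
    show "\<exists>v'. length v' = length v \<and> w = word v'" using v by blast
    fix r assume "\<exists>v'. length v' = r \<and> w = word v'"
    then obtain v' where "length v' = r" "w = word v'" by blast
    then show "length v \<le> r" using twice_inv_word_le[of v'] v(2) by simp
  qed
  then show ?thesis using v by simp
qed

lemma len_desc:
  assumes "w \<in> W_inf" "desc i w" shows "len w = len (w \<circ> gen i) + 1"
  using twice_len_eq[OF assms(1)] twice_len_eq[OF comp_gen_in_W_inf[OF assms(1), of i]]
    twice_inv_desc[OF assms] by simp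

lemma len_asc:
  assumes "w \<in> W_inf" "\<not> desc i w" shows "len (w \<circ> gen i) = len w + 1"
  using twice_len_eq[OF assms(1)] twice_len_eq[OF comp_gen_in_W_inf[OF assms(1), of i]]
    twice_inv_asc[OF assms] by simp

lemma len_comp_gen_less_iff: "w \<in> W_inf \<Longrightarrow> len (w \<circ> gen i) < len w \<longleftrightarrow> desc i w"
  using len_desc[of w i] len_asc[of w i] by fastforce

section \<open>The single Schubert polynomials\<close>
abbreviation zspan :: "'a::comm_ring_1 set \<Rightarrow> 'a set"
  where "zspan \<equiv> module.span (\<lambda>(k::int) a. of_int k * a)"

lemma module_of_int_mult: "module (\<lambda>(k::int) (a::'a::comm_ring_1). of_int k * a)"
  by standard (simp_all add: algebra_simps)

text \<open>This filtration replaces the degree in the spanning argument: membership of \<open>C\<^sub>w\<close> in step \<open>len w\<close>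
  is immediate from the action of divided differences, whereas bounding the degree of \<open>C\<^sub>w\<close> would
  need an argument of its own.\<close>
primrec ddx_nilpotent :: "nat \<Rightarrow> gammaXY \<Rightarrow> bool" where
  "ddx_nilpotent 0 f \<longleftrightarrow> (\<forall>i. ddx i f = 0)"
| "ddx_nilpotent (Suc d) f \<longleftrightarrow> (\<forall>i. ddx_nilpotent d (ddx i f))"

lemma ddx_nilpotent_0: "ddx_nilpotent d 0"
  by (induction d) (simp_all add: ddx_0)

lemma ddx_nilpotent_diff: "ddx_nilpotent d f \<Longrightarrow> ddx_nilpotent d g \<Longrightarrow> ddx_nilpotent d (f - g)"
  by (induction d arbitrary: f g) (simp_all add: ddx_diff)

lemma ddx_nilpotent_sum_of_int_mult:
  "(\<And>x. x \<in> A \<Longrightarrow> ddx_nilpotent d (f x)) \<Longrightarrow> ddx_nilpotent d (\<Sum>x\<in>A. of_int (a x) * f x)"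
  by (induction d arbitrary: f) (simp_all add: ddx_sum ddx_of_int_mult)

lemma Fil_max: "Fil (XV ` {..<n}) d f \<Longrightarrow> Fil (XV ` {..<max n m}) d f"
  using Fil_mono[of "XV ` {..<n}" d f "XV ` {..<max n m}" 0] image_mono[of "{..<n}" "{..<max n m}" XV]
  by simp

lemma Fil_imp_ddx_nilpotent: "Fil (XV ` {..<n}) d f \<Longrightarrow> ddx_nilpotent d f"
proof (induction d arbitrary: n f)
  case 0
  have "ddx i f = 0" for i
  proof (rule Fil_ddx(2)[OF _ moved_subset])
    show "Fil (XV ` {..<max n (i + 1)}) 0 f" using 0 by (rule Fil_max)
  qed simp
  then show ?case by simp
next
  case (Suc d)
  have "ddx_nilpotent d (ddx i f)" for i
  proof (rule Suc.IH)
    have "Fil (XV ` {..<max n (i + 1)}) (Suc d) f"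
      using Suc.prems by (rule Fil_max)
    from Fil_ddx(1)[OF this moved_subset] show "Fil (XV ` {..<max n (i + 1)}) d (ddx i f)" by simp
  qed
  then show ?case by simp
qed

lemma GammaX_ddx_nilpotent: "f \<in> GammaX n \<Longrightarrow> \<exists>d. ddx_nilpotent d f"
  unfolding GammaX_eq_GammaV GammaV_def using Fil_imp_ddx_nilpotent by blast

lemma GammaX_diff: "f \<in> GammaX n \<Longrightarrow> g \<in> GammaX n \<Longrightarrow> f - g \<in> GammaX n"
  unfolding GammaX_eq_GammaV by (rule GammaV_diff)

lemma GammaX_sum_of_int_mult:
  "(\<And>x. x \<in> A \<Longrightarrow> f x \<in> GammaX n) \<Longrightarrow> (\<Sum>x\<in>A. of_int (a x) * f x) \<in> GammaX n"
  unfolding GammaX_eq_GammaV by (intro GammaV_sum GammaV_mult GammaV_of_int)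

lemma subspace_GammaX: "module.subspace (\<lambda>(k::int) a. of_int k * a) (GammaX n)"
  unfolding GammaX_eq_GammaV
  by (rule module.subspaceI[OF module_of_int_mult]) (auto intro: GammaV_0 GammaV_add GammaV_mult GammaV_of_int)

lemma constants_of_ddx:
  assumes "f \<in> GammaX n" "\<And>i. ddx i f = 0"
  shows "\<exists>k. f = of_int k"
  using GammaX_descend_to[OF assms(1), of 0] assms(2) by (intro invariant_imp_integer) auto

lemma inj_comp_gen: "u \<circ> gen i = v \<circ> gen i \<Longrightarrow> u = v"
  by (metis comp_gen_gen)

lemma W_upper_in_W_inf: "w \<in> W_upper n \<Longrightarrow> w \<in> W_inf"
  by (simp add: W_upper_def)

lemma W_upper_not_desc: "w \<in> W_upper n \<Longrightarrow> n < i \<Longrightarrow> \<not> desc i w"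
  by (auto simp: W_upper_def desc_def dest!: spec[of _ "int i"])

lemma W_upper_mono: "m \<le> n \<Longrightarrow> W_upper m \<subseteq> W_upper n"
  by (auto simp: W_upper_def)

lemma len_id: "len id = 0"
  using twice_len_eq[OF id_in_W_inf] by (simp only: twice_inv_id)

lemma id_in_W_upper: "id \<in> W_upper n"
  using id_in_W_inf by (simp add: W_upper_def)

text \<open>The condition says \<open>-v\<^sub>1 < v\<^sub>2\<close>, that is, no descent is created at position \<open>1\<close>.\<close>
lemma comp_gen_0_in_W_upper:
  assumes v: "v \<in> W_upper 1" "\<not> desc 0 v" and pos: "v 1 + v 2 > 0"
  shows "v \<circ> gen 0 \<in> W_upper 0"
proof -
  have vW: "v \<in> W_inf" using v by (simp add: W_upper_def)
  have "(v \<circ> gen 0) i < (v \<circ> gen 0) (i + 1)" if "i > 0" for i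
  proof (cases "i = 1")
    case True
    then show ?thesis using W_inf_odd[OF vW, of 1] pos by (simp add: gen_0)
  next
    case False
    then have "v i < v (i + 1)" using v(1) that by (auto simp: W_upper_def)
    then show ?thesis using False that by (simp add: gen_0)
  qed
  then show ?thesis using comp_gen_in_W_inf[OF vW] by (simp add: W_upper_def)
qed

lemma comp_gen_in_W_upper:
  assumes v: "v \<in> W_upper (n + 1)" "\<not> desc n v" and less: "v (int n) < v (int n + 2)" and n: "n \<ge> 1"
  shows "v \<circ> gen n \<in> W_upper n"
proof -
  have vW: "v \<in> W_inf" using v by (simp add: W_upper_def)
  have "(v \<circ> gen n) i < (v \<circ> gen n) (i + 1)" if "i > int n" for i
  proof (cases "i = int n + 1")
    case True
    then have "gen n i = int n" "gen n (i + 1) = int n + 2" using n by (auto simp: gen_pos)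
    then show ?thesis using less by simp
  next
    case False
    then have "v i < v (i + 1)" using v(1) that by (auto simp: W_upper_def)
    moreover have "gen n i = i" "gen n (i + 1) = i + 1" using False that n by (auto simp: gen_pos)
    ultimately show ?thesis by simp
  qed
  then show ?thesis using comp_gen_in_W_inf[OF vW] by (simp add: W_upper_def)
qed

context
  fixes S :: "(int \<Rightarrow> int) \<Rightarrow> gammaXY"
  assumes S: "typeC_double_schubert S"
begin

definition schubert_X :: "(int \<Rightarrow> int) \<Rightarrow> gammaXY"
  where "schubert_X w = at_Y_0 (S w)"

lemma ddx_C:
  assumes "w \<in> W_inf"
  shows "ddx i (schubert_X w) = (if desc i w then schubert_X (w \<circ> gen i) else 0)"
proof -
  have "ddx i (S w) = (if len (w \<circ> gen i) < len w then S (w \<circ> gen i) else 0)"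
    using S assms unfolding typeC_double_schubert_def by blast
  then have "ddx i (schubert_X w) = at_Y_0 (if desc i w then S (w \<circ> gen i) else 0)"
    unfolding schubert_X_def at_Y_0_ddx[symmetric] len_comp_gen_less_iff[OF assms] by simp
  then show ?thesis unfolding schubert_X_def using is_ring_homD(4)[OF is_ring_hom_at_Y_0] by simp
qed

lemma constant_term_C: "w \<in> W_inf \<Longrightarrow> constant_term (schubert_X w) = (if w = id then 1 else 0)"
  using S unfolding schubert_X_def constant_term_at_Y_0 typeC_double_schubert_def by blast

lemma C_in_GammaX:
  assumes "w \<in> W_upper n" shows "schubert_X w \<in> GammaX n"
proof -
  obtain N where "schubert_X w \<in> GammaX N" using at_Y_0_in_GammaX unfolding schubert_X_def by blast
  then show ?thesis
  proof (rule GammaX_descend_to)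
    fix i assume "n < i"
    then show "ddx i (schubert_X w) = 0"
      using W_upper_not_desc[OF assms] by (simp only: ddx_C[OF W_upper_in_W_inf[OF assms]] if_False)
  qed
qed

lemma C_id: "schubert_X id = 1"
proof -
  have "ddx i (schubert_X id) = 0" for i
    unfolding ddx_C[OF id_in_W_inf] by (simp add: desc_def)
  then obtain k where k: "schubert_X id = of_int k"
    using constants_of_ddx[OF C_in_GammaX[OF id_in_W_upper]] by blast
  then have "k = 1"
    using constant_term_C[OF id_in_W_inf] is_ring_hom_of_int_commute[OF is_ring_hom_constant_term, of k]
    by simp
  then show ?thesis using k by simp
qed

lemma ddx_sum_C:
  assumes "finite A" "\<And>v. v \<in> A \<Longrightarrow> h v \<in> W_inf"
  shows "ddx i (\<Sum>v\<in>A. of_int (a v) * schubert_X (h v)) =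
    (\<Sum>v\<in>{v \<in> A. desc i (h v)}. of_int (a v) * schubert_X (h v \<circ> gen i))"
proof -
  have "ddx i (\<Sum>v\<in>A. of_int (a v) * schubert_X (h v)) =
      (\<Sum>v\<in>A. if desc i (h v) then of_int (a v) * schubert_X (h v \<circ> gen i) else 0)"
    unfolding ddx_sum ddx_of_int_mult by (rule sum.cong) (simp_all add: ddx_C[OF assms(2)])
  then show ?thesis using assms(1) by (simp only: sum.inter_filter)
qed

text \<open>Induction on the length of \<open>h u\<close>: a divided difference at a descent of \<open>h u\<close> shortens it and keeps
  its coefficient; at the identity the constant term reads the coefficient off. The
  reindexing \<open>h\<close> makes the statement stable under this step.\<close>
lemma C_independent:
  assumes "finite A" "inj_on h A" "\<And>v. v \<in> A \<Longrightarrow> h v \<in> W_inf"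
    and "(\<Sum>v\<in>A. of_int (a v) * schubert_X (h v)) = 0" and "u \<in> A"
  shows "a u = 0"
  using assms
proof (induction "len (h u)" arbitrary: A h u rule: less_induct)
  case less
  show ?case
  proof (cases "\<exists>i. desc i (h u)")
    case True
    then obtain i where i: "desc i (h u)" by blast
    let ?A = "{v \<in> A. desc i (h v)}"
    show ?thesis
    proof (rule less.hyps[where A = ?A and h = "\<lambda>v. h v \<circ> gen i" and u = u])
      show "len (h u \<circ> gen i) < len (h u)"
        using len_comp_gen_less_iff[OF less.prems(3)[OF less.prems(5)]] i by blast
      show "finite ?A" "u \<in> ?A" using less.prems i by auto
      show "inj_on (\<lambda>v. h v \<circ> gen i) ?A"
      proof (rule inj_onI)
        fix v v' assume v: "v \<in> ?A" "v' \<in> ?A" and "h v \<circ> gen i = h v' \<circ> gen i"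
        then have "h v = h v'" by (rule_tac inj_comp_gen)
        then show "v = v'" using less.prems(2) v by (auto dest: inj_onD)
      qed
      show "h v \<circ> gen i \<in> W_inf" if "v \<in> ?A" for v
        using that less.prems(3) by (intro comp_gen_in_W_inf) auto
      show "(\<Sum>v\<in>?A. of_int (a v) * schubert_X (h v \<circ> gen i)) = 0"
        using ddx_sum_C[where h = h and i = i and a = a, OF less.prems(1,3)] less.prems(4) by (simp only: ddx_0)
    qed
  next
    case False
    then have id: "h u = id" using no_desc_imp_id less.prems by blast
    have "0 = constant_term (\<Sum>v\<in>A. of_int (a v) * schubert_X (h v))"
      using less.prems(4) is_ring_homD(4)[OF is_ring_hom_constant_term] by simp
    also have "\<dots> = (\<Sum>v\<in>A. a v * constant_term (schubert_X (h v)))"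
      using is_ring_hom_of_int_commute[OF is_ring_hom_constant_term]
      by (simp add: is_ring_homD[OF is_ring_hom_constant_term])
    also have "\<dots> = (\<Sum>v\<in>A. if v = u then a v else 0)"
    proof (rule sum.cong)
      fix v assume v: "v \<in> A"
      have "h v = id \<longleftrightarrow> v = u"
        using less.prems(2,5) v id inj_onD by metis
      then show "a v * constant_term (schubert_X (h v)) = (if v = u then a v else 0)"
        using constant_term_C[OF less.prems(3)[OF v]] by simp
    qed simp
    also have "\<dots> = a u" using less.prems by simp
    finally show ?thesis by simp
  qed
qed

lemma ddx_nilpotent_C: "w \<in> W_inf \<Longrightarrow> len w \<le> d \<Longrightarrow> ddx_nilpotent d (schubert_X w)"
proof (induction d arbitrary: w)
  case 0
  then have "\<not> desc i w" for i using len_desc[of w i] by auto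
  then show ?case using ddx_C[OF 0(1)] by simp
next
  case (Suc d)
  have "ddx_nilpotent d (ddx i (schubert_X w))" for i
  proof (cases "desc i w")
    case True
    then have "len (w \<circ> gen i) \<le> d" using Suc.prems len_desc[of w i] by simp
    with comp_gen_in_W_inf[OF Suc.prems(1)] have "ddx_nilpotent d (schubert_X (w \<circ> gen i))" by (rule Suc.IH)
    then show ?thesis using True by (simp only: ddx_C[OF Suc.prems(1)] if_True)
  qed (use ddx_C[OF Suc.prems(1)] in \<open>simp add: ddx_nilpotent_0\<close>)
  then show ?case by simp
qed

lemma zspan_C_expansion:
  assumes "f \<in> zspan (schubert_X ` W)"
  obtains A a where "finite A" "A \<subseteq> W" "f = (\<Sum>w\<in>A. of_int (a w) * schubert_X w)" "\<And>w. w \<in> A \<Longrightarrow> a w \<noteq> (0::int)"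
proof -
  obtain t r where t: "finite t" "t \<subseteq> schubert_X ` W" "f = (\<Sum>x\<in>t. of_int (r x) * x)"
    using assms unfolding module.span_explicit[OF module_of_int_mult] by auto
  then obtain B where B: "B \<subseteq> W" "inj_on schubert_X B" "t = schubert_X ` B"
    by (auto simp: subset_image_inj)
  have finB: "finite B" using B t(1) by (simp add: finite_image_iff)
  let ?A = "{w \<in> B. r (schubert_X w) \<noteq> 0}"
  have "f = (\<Sum>w\<in>B. of_int (r (schubert_X w)) * schubert_X w)"
    using t(3) B by (simp add: sum.reindex)
  also have "\<dots> = (\<Sum>w\<in>?A. of_int (r (schubert_X w)) * schubert_X w)"
    using finB by (intro sum.mono_neutral_right) auto
  finally show ?thesis
    using finB B(1) by (intro that[of ?A "\<lambda>w. r (schubert_X w)"]) auto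
qed

lemma no_desc_of_ddx_eq_0:
  assumes "finite A" "A \<subseteq> W_inf" "\<And>w. w \<in> A \<Longrightarrow> a w \<noteq> (0::int)"
    and "ddx i (\<Sum>w\<in>A. of_int (a w) * schubert_X w) = 0" and "v \<in> A"
  shows "\<not> desc i v"
proof
  assume "desc i v"
  have sum0: "(\<Sum>w\<in>{w \<in> A. desc i w}. of_int (a w) * schubert_X (w \<circ> gen i)) = 0"
    using ddx_sum_C[of A "\<lambda>w. w" i a] assms(1,2,4) by (simp add: subset_iff)
  have "a v = 0"
  proof (rule C_independent[OF _ _ _ sum0])
    show "inj_on (\<lambda>w. w \<circ> gen i) {w \<in> A. desc i w}"
      by (rule inj_onI) (rule inj_comp_gen)
    show "w \<circ> gen i \<in> W_inf" if "w \<in> {w \<in> A. desc i w}" for w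
      using that assms(2) by (intro comp_gen_in_W_inf) auto
  qed (use assms(1,5) \<open>desc i v\<close> in auto)
  then show False using assms(3,5) by blast
qed

text \<open>If \<open>v\<close> has no descent at \<open>i\<close>, then \<open>v s\<^sub>i\<close> has one, and \<open>\<partial>\<^sub>i\<close> takes its Schubert polynomial back to
  that of \<open>v\<close>.\<close>
lemma ddx_antiderivative:
  assumes "finite A" "A \<subseteq> W_inf" "\<And>v. v \<in> A \<Longrightarrow> \<not> desc i v"
  shows "ddx i (\<Sum>v\<in>A. of_int (a v) * schubert_X (v \<circ> gen i)) = (\<Sum>v\<in>A. of_int (a v) * schubert_X v)"
proof -
  have "{v \<in> A. desc i (v \<circ> gen i)} = A" using assms desc_comp_gen by blast
  moreover have "ddx i (\<Sum>v\<in>A. of_int (a v) * schubert_X (v \<circ> gen i)) =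
      (\<Sum>v\<in>{v \<in> A. desc i (v \<circ> gen i)}. of_int (a v) * schubert_X (v \<circ> gen i \<circ> gen i))"
    using assms by (intro ddx_sum_C) (auto intro: comp_gen_in_W_inf)
  ultimately show ?thesis by (simp only: comp_gen_gen)
qed

definition bounded_C :: "nat \<Rightarrow> nat \<Rightarrow> gammaXY set"
  where "bounded_C n d = schubert_X ` {w \<in> W_upper n. len w \<le> d}"

lemma sum_lifts_in_zspan:
  assumes "\<And>v. v \<in> A \<Longrightarrow> v \<in> W_inf \<and> len v \<le> d \<and> \<not> desc i v \<and> v \<circ> gen i \<in> W_upper n"
  shows "(\<Sum>v\<in>A. of_int (a v) * schubert_X (v \<circ> gen i)) \<in> zspan (bounded_C n (Suc d))"
proof (intro module.span_sum[OF module_of_int_mult] module.span_scale[OF module_of_int_mult]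
    module.span_base[OF module_of_int_mult])
  fix v assume "v \<in> A"
  then have "v \<circ> gen i \<in> W_upper n" "len (v \<circ> gen i) \<le> Suc d"
    using assms[of v] len_asc[of v i] by auto
  then show "schubert_X (v \<circ> gen i) \<in> bounded_C n (Suc d)"
    unfolding bounded_C_def by blast
qed

lemma of_int_in_zspan: "of_int k \<in> zspan (bounded_C n d)"
proof -
  have "schubert_X id \<in> bounded_C n d"
    unfolding bounded_C_def using id_in_W_upper by (intro imageI) (simp only: len_id mem_Collect_eq le0)
  then have "of_int k * schubert_X id \<in> zspan (bounded_C n d)"
    by (intro module.span_scale[OF module_of_int_mult] module.span_base[OF module_of_int_mult])
  then show ?thesis by (simp only: C_id mult_1_right)
qed

text \<open>If \<open>v\<^sub>1 > 0\<close> and \<open>v\<^sub>1 + v\<^sub>2 < 0\<close>, then multiplying \<open>v\<close> successively by \<open>s\<^sub>1, s\<^sub>0, s\<^sub>1\<close> goes down in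
  length each time, so \<open>\<partial>\<^sub>1 \<partial>\<^sub>0 \<partial>\<^sub>1\<close> would not kill the term of \<open>v\<close>.\<close>
lemma ddx_101_vanish_imp_sum_pos:
  assumes "finite A" "A \<subseteq> W_inf" "\<And>w. w \<in> A \<Longrightarrow> a w \<noteq> (0::int)"
    and zero: "ddx 1 (ddx 0 (ddx 1 (\<Sum>w\<in>A. of_int (a w) * schubert_X w))) = 0"
    and v: "v \<in> A" "\<not> desc 0 v"
  shows "v 1 + v 2 > 0"
proof (rule ccontr)
  assume "\<not> v 1 + v 2 > 0"
  have vW: "v \<in> W_inf" using v assms by blast
  have odd2: "v (- 2) = - v 2" by (rule W_inf_odd[OF vW])
  have "v 1 \<noteq> - v 2" using W_inf_inj[OF vW, of 1 "- 2"] odd2 by auto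
  moreover have "v 1 \<noteq> 0" using W_inf_inj[OF vW, of 1 0] W_inf_0[OF vW] by auto
  ultimately have neg: "v 1 + v 2 < 0" "v 1 > 0"
    using \<open>\<not> v 1 + v 2 > 0\<close> v(2) by (auto simp: desc_def)
  let ?A1 = "{w \<in> A. desc 1 w}"
  let ?A2 = "{w \<in> ?A1. desc 0 (w \<circ> gen 1)}"
  let ?A3 = "{w \<in> ?A2. desc 1 (w \<circ> gen 1 \<circ> gen 0)}"
  have "ddx 1 (\<Sum>w\<in>A. of_int (a w) * schubert_X w) = (\<Sum>w\<in>?A1. of_int (a w) * schubert_X (w \<circ> gen 1))"
    using assms by (intro ddx_sum_C) auto
  moreover have "ddx 0 (\<Sum>w\<in>?A1. of_int (a w) * schubert_X (w \<circ> gen 1)) =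
      (\<Sum>w\<in>?A2. of_int (a w) * schubert_X (w \<circ> gen 1 \<circ> gen 0))"
    using assms by (intro ddx_sum_C) (auto intro: comp_gen_in_W_inf)
  moreover have "ddx 1 (\<Sum>w\<in>?A2. of_int (a w) * schubert_X (w \<circ> gen 1 \<circ> gen 0)) =
      (\<Sum>w\<in>?A3. of_int (a w) * schubert_X (w \<circ> gen 1 \<circ> gen 0 \<circ> gen 1))"
    using assms by (intro ddx_sum_C) (auto intro!: comp_gen_in_W_inf)
  ultimately have sum0: "(\<Sum>w\<in>?A3. of_int (a w) * schubert_X (w \<circ> gen 1 \<circ> gen 0 \<circ> gen 1)) = 0"
    using zero by simp
  have g: "gen 1 1 = 2" "gen 1 2 = 1" "gen 1 (- 1) = - 2" "gen 0 1 = - 1" "gen 0 2 = 2"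
    using gen_pos[of 1] by (auto simp: gen_0)
  have "desc 1 v" "desc 0 (v \<circ> gen 1)" "desc 1 (v \<circ> gen 1 \<circ> gen 0)"
    using neg odd2 g by (auto simp: desc_def)
  then have "v \<in> ?A3" using v by blast
  have "a v = 0"
  proof (rule C_independent[OF _ _ _ sum0 \<open>v \<in> ?A3\<close>])
    show "finite ?A3" using assms(1) by simp
    show "inj_on (\<lambda>w. w \<circ> gen 1 \<circ> gen 0 \<circ> gen 1) ?A3"
      by (rule inj_onI) (blast dest: inj_comp_gen)
    show "\<And>w. w \<in> ?A3 \<Longrightarrow> w \<circ> gen 1 \<circ> gen 0 \<circ> gen 1 \<in> W_inf"
      using assms(2) by (intro comp_gen_in_W_inf) auto
  qed
  then show False using assms(3) v(1) by blast
qed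

text \<open>If \<open>v\<^bsub>n+2\<^esub> < v\<^sub>n < v\<^bsub>n+1\<^esub>\<close>, then multiplying \<open>v\<close> successively by \<open>s\<^bsub>n+1\<^esub>, s\<^sub>n\<close> goes down in length
  each time, so \<open>\<partial>\<^sub>n \<partial>\<^bsub>n+1\<^esub>\<close> would not kill the term of \<open>v\<close>.\<close>
lemma ddx_succ_vanish_imp_less:
  assumes "finite A" "A \<subseteq> W_inf" "\<And>w. w \<in> A \<Longrightarrow> a w \<noteq> (0::int)"
    and zero: "ddx n (ddx (n + 1) (\<Sum>w\<in>A. of_int (a w) * schubert_X w)) = 0"
    and v: "v \<in> A" "\<not> desc n v" and n: "n \<ge> 1"
  shows "v (int n) < v (int n + 2)"
proof (rule ccontr)
  assume not_less: "\<not> v (int n) < v (int n + 2)"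
  have vW: "v \<in> W_inf" using v assms by blast
  have "v (int n) \<noteq> v (int n + 2)" using W_inf_inj[OF vW] by simp
  then have gt: "v (int n + 2) < v (int n)" using not_less by simp
  have le: "v (int n) \<le> v (int n + 1)" using v(2) n by (simp add: desc_def)
  let ?A1 = "{w \<in> A. desc (n + 1) w}"
  let ?A2 = "{w \<in> ?A1. desc n (w \<circ> gen (n + 1))}"
  have "ddx (n + 1) (\<Sum>w\<in>A. of_int (a w) * schubert_X w) = (\<Sum>w\<in>?A1. of_int (a w) * schubert_X (w \<circ> gen (n + 1)))"
    using assms by (intro ddx_sum_C) auto
  moreover have "ddx n (\<Sum>w\<in>?A1. of_int (a w) * schubert_X (w \<circ> gen (n + 1))) =
      (\<Sum>w\<in>?A2. of_int (a w) * schubert_X (w \<circ> gen (n + 1) \<circ> gen n))"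
    using assms by (intro ddx_sum_C) (auto intro: comp_gen_in_W_inf)
  ultimately have sum0: "(\<Sum>w\<in>?A2. of_int (a w) * schubert_X (w \<circ> gen (n + 1) \<circ> gen n)) = 0"
    using zero by simp
  have g: "gen (n + 1) (int n) = int n" "gen (n + 1) (int n + 1) = int n + 2"
    using gen_pos[of "n + 1"] n by auto
  have "desc (n + 1) v"
    using gt le by (simp add: desc_def add.commute add.left_commute)
  moreover have "desc n (v \<circ> gen (n + 1))" using gt n g by (simp add: desc_def)
  ultimately have "v \<in> ?A2" using v by blast
  have "a v = 0"
  proof (rule C_independent[OF _ _ _ sum0 \<open>v \<in> ?A2\<close>])
    show "finite ?A2" using assms(1) by simp
    show "inj_on (\<lambda>w. w \<circ> gen (n + 1) \<circ> gen n) ?A2"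
      by (rule inj_onI) (blast dest: inj_comp_gen)
    show "\<And>w. w \<in> ?A2 \<Longrightarrow> w \<circ> gen (n + 1) \<circ> gen n \<in> W_inf"
      using assms(2) by (intro comp_gen_in_W_inf) auto
  qed
  then show False using assms(3) v(1) by blast
qed

text \<open>The bound \<open>len w \<le> d\<close> is carried along because the combination subtracted from \<open>f\<close> must satisfy
  the same nilpotency bound as \<open>f\<close> for the inner induction to apply to the difference.\<close>
lemma zspan_C_of_ddx_nilpotent:
  "f \<in> GammaX n \<Longrightarrow> ddx_nilpotent d f \<Longrightarrow> f \<in> zspan (bounded_C n d)"
proof (induction d arbitrary: n f)
  case 0
  then obtain k where "f = of_int k" using constants_of_ddx[of f n] by auto
  then show ?case by (simp only: of_int_in_zspan)
next
  case (Suc d)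
  note outer = Suc.IH
  from Suc.prems show ?case
  proof (induction n arbitrary: f)
    case 0
    have f: "f \<in> GammaX 0" by fact
    have "ddx 0 f \<in> GammaX 1" using ddx_in_GammaX[OF f, of 0] by simp
    moreover have "ddx_nilpotent d (ddx 0 f)" using 0 by simp
    ultimately have "ddx 0 f \<in> zspan (bounded_C 1 d)" by (rule outer)
    then obtain A a where A: "finite A" "A \<subseteq> {w \<in> W_upper 1. len w \<le> d}"
      and ddx_f: "ddx 0 f = (\<Sum>w\<in>A. of_int (a w) * schubert_X w)" and nz: "\<And>w. w \<in> A \<Longrightarrow> a w \<noteq> 0"
      unfolding bounded_C_def by (rule zspan_C_expansion) blast
    have AW: "A \<subseteq> W_inf" using A(2) W_upper_in_W_inf by blast
    have asc: "\<not> desc 0 v" if "v \<in> A" for v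
      using no_desc_of_ddx_eq_0[where a = a, OF A(1) AW nz _ that] ddx_ddx[of 0 f] unfolding ddx_f by blast
    have upper: "v \<circ> gen 0 \<in> W_upper 0" if "v \<in> A" for v
    proof (rule comp_gen_0_in_W_upper)
      show "v 1 + v 2 > 0"
        using ddx_101_vanish_imp_sum_pos[where a = a, OF A(1) AW nz _ that asc[OF that]] ddx_braid4_vanish[OF f]
        unfolding ddx_f by blast
    qed (use A(2) asc that in auto)
    define g where "g = (\<Sum>v\<in>A. of_int (a v) * schubert_X (v \<circ> gen 0))"
    have "g \<in> GammaX 0"
      unfolding g_def using upper C_in_GammaX by (intro GammaX_sum_of_int_mult) auto
    then have fg: "f - g \<in> GammaX 0" using f by (rule_tac GammaX_diff)
    moreover have "ddx 0 g = ddx 0 f"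
      unfolding g_def ddx_f using A(1) AW asc by (rule ddx_antiderivative)
    then have "ddx 0 (f - g) = 0" by (simp add: ddx_diff)
    ultimately obtain k where "f - g = of_int k" using invariant_imp_integer by blast
    then have "f - g \<in> zspan (bounded_C 0 (Suc d))" by (simp only: of_int_in_zspan)
    moreover have "g \<in> zspan (bounded_C 0 (Suc d))"
      unfolding g_def using AW A(2) asc upper by (intro sum_lifts_in_zspan) auto
    ultimately show ?case
      using module.span_add[OF module_of_int_mult, of "f - g" _ g] by simp
  next
    case (Suc m)
    define n where "n = Suc m"
    have n: "n \<ge> 1" by (simp add: n_def)
    have f: "f \<in> GammaX n" using Suc.prems by (simp add: n_def)
    have "ddx n f \<in> GammaX (n + 1)" using ddx_in_GammaX[OF f, of n] by simp
    moreover have "ddx_nilpotent d (ddx n f)" using Suc.prems by simp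
    ultimately have "ddx n f \<in> zspan (bounded_C (n + 1) d)" by (rule outer)
    then obtain A a where A: "finite A" "A \<subseteq> {w \<in> W_upper (n + 1). len w \<le> d}"
      and ddx_f: "ddx n f = (\<Sum>w\<in>A. of_int (a w) * schubert_X w)" and nz: "\<And>w. w \<in> A \<Longrightarrow> a w \<noteq> 0"
      unfolding bounded_C_def by (rule zspan_C_expansion) blast
    have AW: "A \<subseteq> W_inf" using A(2) W_upper_in_W_inf by blast
    have asc: "\<not> desc n v" if "v \<in> A" for v
      using no_desc_of_ddx_eq_0[where a = a, OF A(1) AW nz _ that] ddx_ddx[of n f] unfolding ddx_f by blast
    have upper: "v \<circ> gen n \<in> W_upper n" if "v \<in> A" for v
    proof (rule comp_gen_in_W_upper)
      show "v (int n) < v (int n + 2)"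
        using ddx_succ_vanish_imp_less[where a = a, OF A(1) AW nz _ that asc[OF that] n] ddx_braid_vanish[OF f n]
        unfolding ddx_f by blast
    qed (use A(2) asc that n in auto)
    define g where "g = (\<Sum>v\<in>A. of_int (a v) * schubert_X (v \<circ> gen n))"
    have "g \<in> GammaX n"
      unfolding g_def using upper C_in_GammaX by (intro GammaX_sum_of_int_mult) auto
    then have fg: "f - g \<in> GammaX n" using f by (rule_tac GammaX_diff)
    have "ddx n g = ddx n f"
      unfolding g_def ddx_f using A(1) AW asc by (rule ddx_antiderivative)
    then have "ddx n (f - g) = 0" by (simp add: ddx_diff)
    then have "f - g \<in> GammaX m" using GammaX_descend[OF fg n] by (simp add: n_def)
    moreover have "ddx_nilpotent (Suc d) (f - g)"
    proof (rule ddx_nilpotent_diff)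
      show "ddx_nilpotent (Suc d) f" by (rule Suc.prems)
      have "ddx_nilpotent (Suc d) (schubert_X (v \<circ> gen n))" if "v \<in> A" for v
      proof (rule ddx_nilpotent_C)
        show "v \<circ> gen n \<in> W_inf" using that AW by (intro comp_gen_in_W_inf) auto
        have "v \<in> W_inf" "len v \<le> d" using that AW A(2) by blast+
        then show "len (v \<circ> gen n) \<le> Suc d" using len_asc[of v n] asc[OF that] by simp
      qed
      then show "ddx_nilpotent (Suc d) g"
        unfolding g_def by (rule ddx_nilpotent_sum_of_int_mult)
    qed
    ultimately have "f - g \<in> zspan (bounded_C m (Suc d))" by (rule Suc.IH)
    moreover have "bounded_C m (Suc d) \<subseteq> bounded_C n (Suc d)"
      unfolding bounded_C_def n_def using W_upper_mono[of m "Suc m"] by auto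
    ultimately have "f - g \<in> zspan (bounded_C n (Suc d))"
      using module.span_mono[OF module_of_int_mult] by blast
    moreover have "g \<in> zspan (bounded_C n (Suc d))"
      unfolding g_def using AW A(2) asc upper by (intro sum_lifts_in_zspan) auto
    ultimately show ?case
      using module.span_add[OF module_of_int_mult, of "f - g" _ g] by (simp add: n_def)
  qed
qed

lemma inj_on_C: "inj_on schubert_X W_inf"
proof (rule inj_onI, rule ccontr)
  fix u v assume uv: "u \<in> W_inf" "v \<in> W_inf" "schubert_X u = schubert_X v" "u \<noteq> v"
  have sum0: "(\<Sum>w\<in>{u, v}. of_int (if w = u then 1 else - 1) * schubert_X w) = 0"
    using uv by simp
  have "(if u = u then 1 else - 1 :: int) = 0"
    by (rule C_independent[OF _ _ _ sum0]) (use uv in auto)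
  then show False by simp
qed

lemma C_Z_basis: "is_Z_basis schubert_X (W_upper n) (GammaX n)"
  unfolding is_Z_basis_def
proof (intro conjI)
  have sub: "W_upper n \<subseteq> W_inf" by (auto simp: W_upper_def)
  show "inj_on schubert_X (W_upper n)" using inj_on_C sub by (rule inj_on_subset)
  show "\<not> module.dependent (\<lambda>(k::int) a. of_int k * a) (schubert_X ` W_upper n)"
  proof (rule notI)
    assume "module.dependent (\<lambda>(k::int) a. of_int k * a) (schubert_X ` W_upper n)"
    then obtain t r where t: "finite t" "t \<subseteq> schubert_X ` W_upper n" "(\<Sum>x\<in>t. of_int (r x) * x) = 0"
      and nz: "\<exists>x\<in>t. r x \<noteq> (0::int)"
      unfolding module.dependent_explicit[OF module_of_int_mult] by auto
    obtain B where B: "B \<subseteq> W_upper n" "inj_on schubert_X B" "t = schubert_X ` B"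
      using t(2) by (auto simp: subset_image_inj)
    have "finite B" using B t(1) by (simp add: finite_image_iff)
    have sum0: "(\<Sum>w\<in>B. of_int (r (schubert_X w)) * schubert_X w) = 0"
      using t(3) B by (simp add: sum.reindex)
    have "r (schubert_X w) = 0" if "w \<in> B" for w
      by (rule C_independent[OF \<open>finite B\<close> _ _ sum0 that]) (use B(1) sub in auto)
    then show False using nz B(3) by auto
  qed
  show "zspan (schubert_X ` W_upper n) = GammaX n"
  proof
    show "zspan (schubert_X ` W_upper n) \<subseteq> GammaX n"
      using C_in_GammaX by (intro module.span_minimal[OF module_of_int_mult] subspace_GammaX) auto
    show "GammaX n \<subseteq> zspan (schubert_X ` W_upper n)"
    proof
      fix f assume f: "f \<in> GammaX n"
      then obtain d where "ddx_nilpotent d f" using GammaX_ddx_nilpotent by blast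
      with f have "f \<in> zspan (bounded_C n d)" by (rule zspan_C_of_ddx_nilpotent)
      moreover have "bounded_C n d \<subseteq> schubert_X ` W_upper n" by (auto simp: bounded_C_def)
      ultimately show "f \<in> zspan (schubert_X ` W_upper n)"
        using module.span_mono[OF module_of_int_mult] by blast
    qed
  qed
qed

end

theorem proposition1:
  fixes n :: nat and S :: "(int \<Rightarrow> int) \<Rightarrow> gammaXY"
  assumes "n \<ge> 1"
    and "typeC_double_schubert S"
  shows "is_Z_basis (\<lambda>w. at_Y_0 (S w)) (W_upper n) (GammaX n)"
  using C_Z_basis[OF assms(2), of n] unfolding schubert_X_def[OF assms(2), abs_def] .

end
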